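(* Let $2<p\le\infty$ and $g\in H(\mathbb{D})$. Then $I_g:H^p(\mathbb{D})\to\mathcal{L}^{2,1-\frac{2}{p}}(\mathbb{D})$ is bounded if and only if $g\in H^\infty(\mathbb{D})$. Moreover $\|I_g\|\approx\|g\|_\infty$, where $\|g\|_\infty=\sup_{z\in\mathbb{D}}|g(z)|$.
   Context: $\mathbb{D}$ is the open unit disc, $H(\mathbb{D})$ the analytic functions on $\mathbb{D}$, $dA=\frac{1}{\pi}dx\,dy$. For $0<p<\infty$, $H^p(\mathbb{D})$ is the Hardy space with $\|f\|_{H^p}^p=\sup_{0<r<1}\frac{1}{2\pi}\int_0^{2\pi}|f(re^{i\theta})|^pd\theta$; $H^\infty(\mathbb{D})$ is the space of bounded analytic functions with the sup norm. For $g\in H(\mathbb{D})$, $I_gf(z)=\int_0^z f'(w)g(w)\,dw$. For an arc $I\subset\partial\mathbb{D}$, $|I|=\frac{1}{2\pi}\int_I|d\zeta|$, $f_I=\frac{1}{|I|}\int_I f(\zeta)\frac{|d\zeta|}{2\pi}$, $S(I)=\{z\in\mathbb{D}:1-|I|\le |z|<1,\ z/|z|\in I\}$. For $0<\lambda\le1$, $\mathcal{L}^{2,\lambda}(\mathbb{D})$ is the set of $f\in H^2(\mathbb{D})$ with $\sup_{I}\big(|I|^{-\lambda}\int_I|f(\zeta)-f_I|^2\frac{|d\zeta|}{2\pi}\big)^{1/2}<\infty$, normed by $\|f\|_{\mathcal{L}^{2,\lambda}}=|f(0)|+\sup_{I}\big(|I|^{-\lambda}\int_{S(I)}|f'(z)|^2(1-|z|^2)dA(z)\big)^{1/2}$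 (for $p=\infty$, $\lambda=1$). $A\approx B$ means $A\lesssim B\lesssim A$ with constants depending only on $p$. *)

theory Defs
  imports "HOL-Complex_Analysis.Complex_Analysis"
begin

definition hardy_mean :: "real \<Rightarrow> (complex \<Rightarrow> complex) \<Rightarrow> real \<Rightarrow> real" where
  "hardy_mean p f r = (1 / (2*pi)) * (LBINT t=0..2*pi. cmod (f (of_real r * cis t)) powr p)"

definition hardy :: "ereal \<Rightarrow> (complex \<Rightarrow> complex) set" where
  "hardy p = {f. f holomorphic_on ball 0 1 \<and>
     (if p = \<infinity> then bounded (f ` ball 0 1)
      else bdd_above (hardy_mean (real_of_ereal p) f ` {0<..<1}))}"

definition hardy_norm :: "ereal \<Rightarrow> (complex \<Rightarrow> complex) \<Rightarrow> real" where
  "hardy_norm p f =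
     (if p = \<infinity> then (SUP z\<in>ball 0 1. cmod (f z))
      else (SUP r\<in>{0<..<1}. hardy_mean (real_of_ereal p) f r) powr (1 / real_of_ereal p))"

definition sup_norm :: "(complex \<Rightarrow> complex) \<Rightarrow> real" where
  "sup_norm g = (SUP z\<in>ball 0 1. cmod (g z))"

definition Ig :: "(complex \<Rightarrow> complex) \<Rightarrow> (complex \<Rightarrow> complex) \<Rightarrow> complex \<Rightarrow> complex" where
  "Ig g f z = contour_integral (linepath 0 z) (\<lambda>w. deriv f w * g w)"

definition arc_params :: "(real \<times> real) set" where
  "arc_params = {(a, l). 0 < l \<and> l \<le> 2*pi}"

definition arc :: "real \<Rightarrow> real \<Rightarrow> complex set" where
  "arc a l = cis ` {a..a+l}"

definition arc_len :: "real \<Rightarrow> real" where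
  "arc_len l = l / (2*pi)"

definition carleson_box :: "real \<Rightarrow> real \<Rightarrow> complex set" where
  "carleson_box a l = {z. 1 - arc_len l \<le> cmod z \<and> cmod z < 1 \<and> z / of_real (cmod z) \<in> arc a l}"

definition bval :: "(complex \<Rightarrow> complex) \<Rightarrow> complex \<Rightarrow> complex" where
  "bval f \<zeta> = Lim (at_left 1) (\<lambda>r. f (of_real r * \<zeta>))"

definition arc_int :: "real \<Rightarrow> real \<Rightarrow> (complex \<Rightarrow> 'b::{banach,second_countable_topology}) \<Rightarrow> 'b" where
  "arc_int a l h = (1 / (2*pi)) *\<^sub>R (LBINT t=a..a+l. h (cis t))"

definition arc_mean :: "real \<Rightarrow> real \<Rightarrow> (complex \<Rightarrow> complex) \<Rightarrow> complex" where
  "arc_mean a l h = (1 / arc_len l) *\<^sub>R arc_int a l h"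

definition morrey :: "real \<Rightarrow> (complex \<Rightarrow> complex) set" where
  "morrey lam = {f. f \<in> hardy 2 \<and>
     bdd_above ((\<lambda>(a,l). sqrt (arc_len l powr (-lam) *
        arc_int a l (\<lambda>\<zeta>. cmod (bval f \<zeta> - arc_mean a l (bval f)) ^ 2))) ` arc_params)}"

text \<open>Area integral part of the norm (squared, extended valued), dA = dx dy / pi.\<close>
definition morrey_area_sup :: "real \<Rightarrow> (complex \<Rightarrow> complex) \<Rightarrow> ennreal" where
  "morrey_area_sup lam f = (SUP (a,l)\<in>arc_params.
      ennreal (arc_len l powr (-lam)) *
      ((\<integral>\<^sup>+ z\<in>carleson_box a l. ennreal (cmod (deriv f z) ^ 2 * (1 - cmod z ^ 2)) \<partial>lborel) / ennreal pi))"

definition morrey_norm :: "real \<Rightarrow> (complex \<Rightarrow> complex) \<Rightarrow> real" where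
  "morrey_norm lam f = cmod (f 0) + sqrt (enn2real (morrey_area_sup lam f))"

definition lam_of :: "ereal \<Rightarrow> real" where
  "lam_of p = (if p = \<infinity> then 1 else 1 - 2 / real_of_ereal p)"

definition Ig_bounded :: "ereal \<Rightarrow> real \<Rightarrow> (complex \<Rightarrow> complex) \<Rightarrow> bool" where
  "Ig_bounded p lam g \<longleftrightarrow> (\<exists>C. \<forall>f\<in>hardy p.
      Ig g f \<in> morrey lam \<and> morrey_area_sup lam (Ig g f) < \<infinity> \<and>
      morrey_norm lam (Ig g f) \<le> C * hardy_norm p f)"

definition Ig_opnorm :: "ereal \<Rightarrow> real \<Rightarrow> (complex \<Rightarrow> complex) \<Rightarrow> real" where
  "Ig_opnorm p lam g = Sup {morrey_norm lam (Ig g f) | f. f \<in> hardy p \<and> hardy_norm p f \<le> 1}"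

end

theory Submission
  imports Defs
begin

text \<open>
  Write \<open>F\<close> for \<open>Ig g f\<close>, so that \<open>|F'| \<le> K |f'|\<close> with \<open>K\<close> the supremum of \<open>|g|\<close>. Upper bound for the area norm: on the
  Carleson box over an arc of length \<open>L\<close> the kernel \<open>1 - cnj a * z\<close>, with \<open>|a| = 1 - L\<close> over the midpoint, is comparable
  to \<open>L\<close>, so \<open>f'\<close> is controlled by \<open>h = f / (1 - cnj a * z)\<close>; the Littlewood--Paley identity reduces everything
  to the mean square of \<open>h\<close>, and comparing squares with \<open>p\<close>-th powers at the scale \<open>L powr (-1/p)\<close> yields the exponent
  \<open>1 - 2/p\<close>.

  Membership of \<open>F\<close> in the Morrey space: since \<open>|(F \<circ> \<phi>)'| \<le> K |(f \<circ> \<phi>)'|\<close> for the disc automorphism \<open>\<phi>\<close>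
  exchanging \<open>0\<close> and \<open>a\<close>, Littlewood--Paley bounds the Poisson average of \<open>|F - F a|\<^sup>2\<close> by that of \<open>|f|\<^sup>2\<close> on every
  circle of radius less than one. The passage to boundary values is Fatou's theorem, obtained from the radial maximal
  inequality, which is a \<open>T T\<^sup>*\<close> estimate for the Poisson kernel.

  Necessity and the lower bound: test on multiples of \<open>1 / (1 - cnj a * z)\<close> and apply the mean value inequality
  for \<open>|g|\<^sup>2\<close> on the disc of radius \<open>(1 - |a|) / 2\<close> around \<open>a\<close>.
\<close>

section \<open>Poisson and Parseval formulas on the circle\<close>

text \<open>The space and its norm are given by different quantities: membership is an oscillation
  condition on radial boundary values, the norm is an area integral. The two are estimated
  separately, and the oscillation estimate has to be carried from circles of radius below one to
  \<open>bval\<close>, which is a radial limit only where such a limit exists. This obstacle forces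
  the a.e. existence and the measurability of radial limits. On circles inside the disc a dilation
  makes every function holomorphic beyond the closed disc, so Parseval's formula applies with
  absolutely convergent series. Both cases of p run through one real parameter
  \<open>q = real_of_ereal p\<close>: infinity becomes \<open>q = 0\<close>, and since division by
  zero gives zero, 1 - 2/q is then 1, the right exponent. Squares are compared with q-th powers at
  an explicit threshold with absolute constants, so the final constants 1/144 and 18 are the same
  for all p.\<close>

definition pker :: "complex \<Rightarrow> real \<Rightarrow> real" where
  "pker a t = (1 - (cmod a)\<^sup>2) / (cmod (1 - cnj a * cis t))\<^sup>2"

lemma one_minus_cnj_mult_nonzero:
  assumes "cmod a < 1" "cmod z \<le> 1"
  shows "1 - cnj a * z \<noteq> 0"
proof
  assume "1 - cnj a * z = 0"
  hence "cmod (cnj a * z) = 1" by simp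
  hence "cmod a * cmod z = 1" by (simp add: norm_mult)
  moreover have "cmod a * cmod z \<le> cmod a * 1" using assms by (intro mult_left_mono) auto
  ultimately show False using assms by linarith
qed

lemma pker_nonneg: "cmod a \<le> 1 \<Longrightarrow> 0 \<le> pker a t"
  unfolding pker_def by (intro divide_nonneg_nonneg) (auto simp: power_le_one)

lemma continuous_on_pker [continuous_intros]:
  assumes "cmod a < 1" "continuous_on S f"
  shows "continuous_on S (\<lambda>t. pker a (f t))"
  unfolding pker_def using assms one_minus_cnj_mult_nonzero[OF assms(1)]
  by (auto intro!: continuous_intros)

text \<open>Cauchy's formula is applied not to G but to u w = G w * (1 - |a|^2) / (1 - cnj a * w),
  which agrees with G at a and whose pole lies outside the closed disc. On the circle the extra
  factor turns the Cauchy kernel into the Poisson kernel, with no detour through real parts.\<close>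

lemma poisson_integral:
  fixes G :: "complex \<Rightarrow> complex"
  assumes hol: "G holomorphic_on ball 0 R" and "1 < R" and a: "cmod a < 1"
  shows "((\<lambda>t. G (cis t) * of_real (pker a t)) has_integral (2 * of_real pi * G a)) {0..2*pi}"
proof -
  define u where "u w = G w * ((1 - (cmod a)\<^sup>2) / (1 - cnj a * w))" for w
  have sub: "cball 0 1 \<subseteq> ball (0::complex) R" using \<open>1 < R\<close> by auto
  have holu: "u holomorphic_on cball 0 1"
    unfolding u_def using one_minus_cnj_mult_nonzero[OF a]
    by (intro holomorphic_intros holomorphic_on_subset[OF hol] sub) auto
  have "((\<lambda>w. u w / (w - a)) has_contour_integral (2 * of_real pi * \<i> * u a)) (circlepath 0 1)"
    by (rule Cauchy_integral_circlepath)
       (use holu a in \<open>auto intro: holomorphic_on_imp_continuous_on holomorphic_on_subset\<close>)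
  hence "((\<lambda>t. u (cis t) / (cis t - a) * \<i> * cis t) has_integral (2 * of_real pi * \<i> * u a)) {0..2*pi}"
    unfolding circlepath_def by (subst (asm) has_contour_integral_part_circlepath_iff) auto
  hence "((\<lambda>t. u (cis t) / (cis t - a) * \<i> * cis t * (-\<i>)) has_integral (2 * of_real pi * \<i> * u a * (-\<i>))) {0..2*pi}"
    by (rule has_integral_mult_left)
  moreover have "u a = G a"
  proof -
    have "complex_of_real (1 - (cmod a)\<^sup>2) = 1 - cnj a * a"
      using complex_norm_square[of a] by (simp add: mult.commute)
    thus ?thesis unfolding u_def using one_minus_cnj_mult_nonzero[OF a, of a] a by simp
  qed
  moreover have "u (cis t) / (cis t - a) * \<i> * cis t * (-\<i>) = G (cis t) * of_real (pker a t)" for t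
  proof -
    have nz: "1 - cnj a * cis t \<noteq> 0" using one_minus_cnj_mult_nonzero[OF a] by simp
    have nz2: "cis t - a \<noteq> 0" using a by (metis eq_iff_diff_eq_0 less_irrefl norm_cis)
    \<comment> \<open>Conjugation inverts cis t; hence the two denominators 1 - cnj a * cis t and
      cis t - a combine into a squared modulus.\<close>
    have e: "cnj (1 - cnj a * cis t) * cis t = cis t - a"
      by (simp add: algebra_simps cis_cnj cis_mult)
    have "complex_of_real ((cmod (1 - cnj a * cis t))\<^sup>2) * cis t = (1 - cnj a * cis t) * (cis t - a)"
      using complex_norm_square[of "1 - cnj a * cis t"] e by (metis mult.assoc)
    hence "cis t / ((1 - cnj a * cis t) * (cis t - a)) = cis t / (complex_of_real ((cmod (1 - cnj a * cis t))\<^sup>2) * cis t)"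
      by simp
    hence "cis t / ((1 - cnj a * cis t) * (cis t - a)) = 1 / complex_of_real ((cmod (1 - cnj a * cis t))\<^sup>2)"
      by simp
    moreover have "u (cis t) / (cis t - a) * \<i> * cis t * (-\<i>)
        = G (cis t) * (1 - (cmod a)\<^sup>2) * (cis t / ((1 - cnj a * cis t) * (cis t - a)))"
      unfolding u_def by (simp add: mult_ac)
    ultimately show ?thesis unfolding pker_def by (metis (no_types, lifting) mult.assoc mult.right_neutral of_real_divide times_divide_eq_right)
  qed
  ultimately show ?thesis by (simp add: algebra_simps)
qed

lemma poisson_kernel_integral:
  assumes "cmod a < 1"
  shows "(pker a has_integral 2 * pi) {0..2*pi}"
proof -
  have "((\<lambda>t. complex_of_real (pker a t)) has_integral complex_of_real (2*pi)) {0..2*pi}"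
    using poisson_integral[of "\<lambda>_. 1" 2 a] assms by simp
  from has_integral_linear[OF this bounded_linear_Re] show ?thesis
    by (simp add: o_def)
qed

lemma Re_mult_real: "Re (z * of_real r) = Re z * r"
  by simp

text \<open>Since \<psi> is unimodular, \<psi>^N times the conjugate of \<psi>^n is \<psi>^(N-n), so
  vanishing integrals of the positive powers already give full orthogonality, and each cross term in
  the induction disappears. The abstract pair (\<psi>, w) is meant for two cases: \<open>cis\<close>
  with weight 1, and a disc automorphism on the circle with the Poisson kernel as weight.\<close>

lemma parseval_finite:
  fixes b :: "nat \<Rightarrow> complex" and \<psi> :: "real \<Rightarrow> complex" and w :: "real \<Rightarrow> real"
  assumes cont: "continuous_on {x..y} \<psi>" "continuous_on {x..y} w"
    and norm1: "\<And>t. t \<in> {x..y} \<Longrightarrow> cmod (\<psi> t) = 1"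
    and orth: "\<And>n. n \<ge> 1 \<Longrightarrow> ((\<lambda>t. \<psi> t ^ n * of_real (w t)) has_integral 0) {x..y}"
    and total: "(w has_integral m) {x..y}"
  shows "((\<lambda>t. (cmod (\<Sum>n<N. b n * \<psi> t ^ n))\<^sup>2 * w t) has_integral (m * (\<Sum>n<N. (cmod (b n))\<^sup>2))) {x..y}"
proof (induction N)
  case 0
  show ?case by simp
next
  case (Suc N)
  define S where "S t = (\<Sum>n<N. b n * \<psi> t ^ n)" for t
  have cr: "((\<lambda>t. cnj (\<Sum>n<N. b n * \<psi> t ^ n) * (b N * \<psi> t ^ N) * of_real (w t)) has_integral 0) {x..y}"
  proof -
    have "((\<lambda>t. \<Sum>n<N. cnj (b n) * b N * (\<psi> t ^ (N - n) * of_real (w t))) has_integral (\<Sum>n<N. cnj (b n) * b N * 0)) {x..y}"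
      by (intro has_integral_sum has_integral_mult_right orth) auto
    moreover have "(\<Sum>n<N. cnj (b n) * b N * (\<psi> t ^ (N - n) * of_real (w t)))
        = cnj (\<Sum>n<N. b n * \<psi> t ^ n) * (b N * \<psi> t ^ N) * of_real (w t)" if "t \<in> {x..y}" for t
    proof -
      have "\<psi> t ^ (N - n) = cnj (\<psi> t) ^ n * \<psi> t ^ N" if "n < N" for n
      proof -
        have "cnj (\<psi> t) * \<psi> t = 1"
          using norm1[OF \<open>t \<in> {x..y}\<close>] complex_norm_square[of "\<psi> t"] by (simp add: mult.commute)
        hence "cnj (\<psi> t) ^ n * \<psi> t ^ n = 1" by (metis power_mult_distrib power_one)
        moreover have "\<psi> t ^ N = \<psi> t ^ n * \<psi> t ^ (N - n)"
          using that by (simp flip: power_add)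
        ultimately show ?thesis by (metis mult.assoc mult.left_neutral)
      qed
      thus ?thesis by (simp add: sum_distrib_right sum_distrib_left mult_ac)
    qed
    ultimately show ?thesis
      by (subst has_integral_cong[where g = "\<lambda>t. \<Sum>n<N. cnj (b n) * b N * (\<psi> t ^ (N - n) * of_real (w t))"]) auto
  qed
  have "((\<lambda>t. Re (cnj (S t) * (b N * \<psi> t ^ N) * of_real (w t))) has_integral 0) {x..y}"
    using has_integral_linear[OF cr bounded_linear_Re] by (simp add: o_def S_def)
  from has_integral_mult_right[OF this, of 2]
  have 1: "((\<lambda>t. 2 * Re (cnj (S t) * (b N * \<psi> t ^ N)) * w t) has_integral 0) {x..y}"
    unfolding Re_mult_real by (simp only: mult.assoc mult_zero_right)
  have 2: "((\<lambda>t. (cmod (b N))\<^sup>2 * w t) has_integral ((cmod (b N))\<^sup>2 * m)) {x..y}"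
    by (intro has_integral_mult_right total)
  have "((\<lambda>t. (cmod (S t))\<^sup>2 * w t + 2 * Re (cnj (S t) * (b N * \<psi> t ^ N)) * w t + (cmod (b N))\<^sup>2 * w t)
     has_integral (m * (\<Sum>n<N. (cmod (b n))\<^sup>2) + 0 + (cmod (b N))\<^sup>2 * m)) {x..y}"
    using Suc.IH 1 2 unfolding S_def[symmetric] by (intro has_integral_add)
  moreover have "(cmod (S t))\<^sup>2 * w t + 2 * Re (cnj (S t) * (b N * \<psi> t ^ N)) * w t + (cmod (b N))\<^sup>2 * w t
     = (cmod (\<Sum>n<Suc N. b n * \<psi> t ^ n))\<^sup>2 * w t" if "t \<in> {x..y}" for t
  proof -
    have sq: "(cmod (u + v))\<^sup>2 = (cmod u)\<^sup>2 + 2 * Re (cnj u * v) + (cmod v)\<^sup>2" for u v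
      unfolding cmod_power2 by (simp add: power2_eq_square algebra_simps)
    have nb: "cmod (b N * \<psi> t ^ N) = cmod (b N)" using norm1[OF that] by (simp add: norm_mult norm_power)
    have "(\<Sum>n<Suc N. b n * \<psi> t ^ n) = S t + b N * \<psi> t ^ N" unfolding S_def by simp
    thus ?thesis by (simp only: sq nb distrib_right)
  qed
  ultimately have "((\<lambda>t. (cmod (\<Sum>n<Suc N. b n * \<psi> t ^ n))\<^sup>2 * w t)
     has_integral (m * (\<Sum>n<N. (cmod (b n))\<^sup>2) + 0 + (cmod (b N))\<^sup>2 * m)) {x..y}"
    by (rule has_integral_eq[rotated])
  thus ?case by (simp add: algebra_simps)
qed

lemma uniform_limit_integral_real:
  fixes f :: "nat \<Rightarrow> real \<Rightarrow> real"
  assumes "uniform_limit {x..y} f g sequentially" "\<And>n. (f n has_integral I n) {x..y}" "I \<longlonglongrightarrow> J"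
    "\<And>n. continuous_on {x..y} (f n)"
  shows "(g has_integral J) {x..y}"
proof -
  obtain I' J' where 1: "\<And>n. (f n has_integral I' n) {x..y}" "(g has_integral J') {x..y}" "I' \<longlonglongrightarrow> J'"
    using uniform_limit_integral[OF assms(1,4)] by auto
  have "I' = I" using 1(1) assms(2) has_integral_unique by blast
  with 1 assms(3) show ?thesis using LIMSEQ_unique by blast
qed

lemma summable_norm_square:
  fixes b :: "nat \<Rightarrow> complex"
  assumes "summable (\<lambda>n. cmod (b n))"
  shows "summable (\<lambda>n. (cmod (b n))\<^sup>2)"
proof -
  have "\<forall>\<^sub>F n in sequentially. cmod (b n) < 1"
    using summable_LIMSEQ_zero[OF assms] by (auto dest!: order_tendstoD(2)[of _ _ _ 1])
  hence "\<forall>\<^sub>F n in sequentially. norm ((cmod (b n))\<^sup>2) \<le> cmod (b n)"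
    by eventually_elim (auto simp: power2_eq_square mult_left_le)
  thus ?thesis using assms by (rule summable_comparison_test_ev)
qed

text \<open>The partial sums converge uniformly by the M-test, so the finite identity passes to the
  limit. The absolute summability comes from evaluating power series strictly inside their disc of
  convergence.\<close>

lemma parseval_weighted:
  fixes b :: "nat \<Rightarrow> complex" and \<psi> :: "real \<Rightarrow> complex" and w :: "real \<Rightarrow> real"
  assumes cont: "continuous_on {x..y} \<psi>" "continuous_on {x..y} w"
    and norm1: "\<And>t. t \<in> {x..y} \<Longrightarrow> cmod (\<psi> t) = 1"
    and orth: "\<And>n. n \<ge> 1 \<Longrightarrow> ((\<lambda>t. \<psi> t ^ n * of_real (w t)) has_integral 0) {x..y}"
    and total: "(w has_integral m) {x..y}"
    and summ: "summable (\<lambda>n. cmod (b n))"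
  shows "((\<lambda>t. (cmod (\<Sum>n. b n * \<psi> t ^ n))\<^sup>2 * w t) has_integral (m * (\<Sum>n. (cmod (b n))\<^sup>2))) {x..y}"
proof (rule uniform_limit_integral_real)
  have ul: "uniform_limit {x..y} (\<lambda>N t. \<Sum>n<N. b n * \<psi> t ^ n) (\<lambda>t. \<Sum>n. b n * \<psi> t ^ n) sequentially"
    by (rule Weierstrass_m_test[OF _ summ]) (auto simp: norm_mult norm_power norm1)
  have contS: "continuous_on {x..y} (\<lambda>t. \<Sum>n<N. b n * \<psi> t ^ n)" for N
    by (intro continuous_intros cont)
  have contL: "continuous_on {x..y} (\<lambda>t. \<Sum>n. b n * \<psi> t ^ n)"
    by (rule uniform_limit_theorem[OF _ ul]) (use contS in auto)
  have bdd: "bounded ((\<lambda>t. \<Sum>n. b n * \<psi> t ^ n) ` {x..y})"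
    by (intro compact_imp_bounded compact_continuous_image contL) auto
  have bdw: "bounded (w ` {x..y})"
    by (intro compact_imp_bounded compact_continuous_image cont) auto
  have ul1: "uniform_limit {x..y} (\<lambda>N t. cmod (\<Sum>n<N. b n * \<psi> t ^ n)) (\<lambda>t. cmod (\<Sum>n. b n * \<psi> t ^ n)) sequentially"
    by (rule uniform_limit_norm[OF ul])
  have bdd': "bounded ((\<lambda>t. cmod (\<Sum>n. b n * \<psi> t ^ n)) ` {x..y})"
    by (intro compact_imp_bounded compact_continuous_image continuous_intros contL) auto
  have bddp: "bounded ((\<lambda>t. cmod (\<Sum>n. b n * \<psi> t ^ n) * cmod (\<Sum>n. b n * \<psi> t ^ n)) ` {x..y})"
    by (intro compact_imp_bounded compact_continuous_image continuous_intros contL) auto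
  have ul2: "uniform_limit {x..y} (\<lambda>N t. cmod (\<Sum>n<N. b n * \<psi> t ^ n) * cmod (\<Sum>n<N. b n * \<psi> t ^ n)) (\<lambda>t. cmod (\<Sum>n. b n * \<psi> t ^ n) * cmod (\<Sum>n. b n * \<psi> t ^ n)) sequentially"
    by (rule uniform_lim_mult[OF ul1 ul1 bdd' bdd'])
  show "uniform_limit {x..y} (\<lambda>N t. (cmod (\<Sum>n<N. b n * \<psi> t ^ n))\<^sup>2 * w t) (\<lambda>t. (cmod (\<Sum>n. b n * \<psi> t ^ n))\<^sup>2 * w t) sequentially"
    unfolding power2_eq_square
    by (rule uniform_lim_mult[OF ul2 uniform_limit_const bddp bdw])
  show "continuous_on {x..y} (\<lambda>t. (cmod (\<Sum>n<N. b n * \<psi> t ^ n))\<^sup>2 * w t)" for N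
    by (intro continuous_intros cont contS)
  show "((\<lambda>t. (cmod (\<Sum>n<N. b n * \<psi> t ^ n))\<^sup>2 * w t) has_integral (m * (\<Sum>n<N. (cmod (b n))\<^sup>2))) {x..y}" for N
    by (rule parseval_finite[OF cont norm1 orth total])
  show "(\<lambda>N. m * (\<Sum>n<N. (cmod (b n))\<^sup>2)) \<longlonglongrightarrow> m * (\<Sum>n. (cmod (b n))\<^sup>2)"
    by (intro tendsto_intros summable_LIMSEQ summable_norm_square summ)
qed

lemma cis_power_integral: "n \<ge> 1 \<Longrightarrow> ((\<lambda>t. cis t ^ n) has_integral 0) {0..2*pi}"
  using poisson_integral[of "\<lambda>z. z ^ n" 2 0] by (simp add: pker_def holomorphic_intros zero_power)

lemma parseval:
  assumes "summable (\<lambda>n. cmod (b n * z ^ n))"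
  shows "((\<lambda>t. (cmod (\<Sum>n. b n * (cis t * z) ^ n))\<^sup>2) has_integral (2*pi * (\<Sum>n. (cmod (b n))\<^sup>2 * (cmod z)\<^sup>2 ^ n))) {0..2*pi}"
proof -
  have "((\<lambda>t. (cmod (\<Sum>n. (b n * z ^ n) * cis t ^ n))\<^sup>2 * 1) has_integral (2*pi * (\<Sum>n. (cmod (b n * z ^ n))\<^sup>2))) {0..2*pi}"
  proof (rule parseval_weighted)
    show "((\<lambda>t. cis t ^ n * complex_of_real 1) has_integral 0) {0..2*pi}" if "n \<ge> 1" for n
      using cis_power_integral[OF that] by simp
    show "((\<lambda>_. 1::real) has_integral 2*pi) {0..2*pi}"
      using has_integral_const_real[of "1::real" 0 "2*pi"] by simp
  qed (use assms in \<open>auto intro!: continuous_intros\<close>)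
  moreover have "(cmod (b n * z ^ n))\<^sup>2 = (cmod (b n))\<^sup>2 * (cmod z)\<^sup>2 ^ n" for n
    by (simp add: norm_mult norm_power power_mult_distrib flip: power_mult) (simp add: mult.commute)
  moreover have "(b n * z ^ n) * cis t ^ n = b n * (cis t * z) ^ n" for n t
    by (simp add: power_mult_distrib mult_ac)
  ultimately show ?thesis by simp
qed

section \<open>Area integrals over the disc\<close>

text \<open>Lebesgue measure is determined by its values on boxes. The product form opens the plane
  to Fubini in the real and imaginary parts.\<close>

lemma lborel_complex_eq_distr:
  "(lborel :: complex measure) = distr (lborel \<Otimes>\<^sub>M lborel) borel (\<lambda>(x, y). Complex x y)"
proof (rule lborel_eqI)
  have [measurable]: "(\<lambda>(x, y). Complex x y) \<in> borel_measurable (lborel \<Otimes>\<^sub>M lborel)"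
    by (subst borel_measurable_complex_iff) (auto simp: case_prod_beta)
  fix l u :: complex
  assume lu: "\<And>b. b \<in> Basis \<Longrightarrow> l \<bullet> b \<le> u \<bullet> b"
  have le: "Re l \<le> Re u" "Im l \<le> Im u"
    using lu[of 1] lu[of \<i>] by (auto simp: Basis_complex_def)
  have "(\<lambda>(x, y). Complex x y) -` box l u \<inter> space (lborel \<Otimes>\<^sub>M lborel) = {Re l<..<Re u} \<times> {Im l<..<Im u}"
    by (auto simp: space_pair_measure in_box_complex_iff)
  thus "emeasure (distr (lborel \<Otimes>\<^sub>M lborel) borel (\<lambda>(x, y). Complex x y)) (box l u) = ennreal (\<Prod>b\<in>Basis. (u - l) \<bullet> b)"
    using le by (simp add: emeasure_distr lborel.emeasure_pair_measure_Times Basis_complex_def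
        flip: ennreal_mult)
qed simp

lemma measurable_Complex [measurable]:
  assumes "f \<in> borel_measurable M" "g \<in> borel_measurable M"
  shows "(\<lambda>x. Complex (f x) (g x)) \<in> borel_measurable M"
  using assms by (subst borel_measurable_complex_iff) auto

lemma measurable_cis [measurable]: "cis \<in> borel_measurable borel"
  by (intro borel_measurable_continuous_onI continuous_intros)

lemma nn_integral_complex:
  assumes [measurable]: "u \<in> borel_measurable borel"
  shows "(\<integral>\<^sup>+z. u z \<partial>lborel) = (\<integral>\<^sup>+x. \<integral>\<^sup>+y. u (Complex x y) \<partial>lborel \<partial>lborel)"
    and "(\<integral>\<^sup>+z. u z \<partial>lborel) = (\<integral>\<^sup>+y. \<integral>\<^sup>+x. u (Complex x y) \<partial>lborel \<partial>lborel)"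
proof -
  have "(\<integral>\<^sup>+z. u z \<partial>lborel) = (\<integral>\<^sup>+p. u (Complex (fst p) (snd p)) \<partial>(lborel \<Otimes>\<^sub>M lborel))"
    by (subst lborel_complex_eq_distr, subst nn_integral_distr) (auto simp: case_prod_beta)
  also have "\<dots> = (\<integral>\<^sup>+x. \<integral>\<^sup>+y. u (Complex x y) \<partial>lborel \<partial>lborel)"
    by (subst lborel.nn_integral_fst[symmetric]) auto
  finally show *: "(\<integral>\<^sup>+z. u z \<partial>lborel) = (\<integral>\<^sup>+x. \<integral>\<^sup>+y. u (Complex x y) \<partial>lborel \<partial>lborel)" .
  also have "\<dots> = (\<integral>\<^sup>+y. \<integral>\<^sup>+x. u (Complex x y) \<partial>lborel \<partial>lborel)"
    by (rule lborel_pair.Fubini') auto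
  finally show "(\<integral>\<^sup>+z. u z \<partial>lborel) = (\<integral>\<^sup>+y. \<integral>\<^sup>+x. u (Complex x y) \<partial>lborel \<partial>lborel)" .
qed

lemma nn_integral_translate_real:
  fixes c :: real
  assumes "f \<in> borel_measurable borel"
  shows "(\<integral>\<^sup>+x. f (x + c) \<partial>lborel) = (\<integral>\<^sup>+x. f x \<partial>lborel)"
  using nn_integral_real_affine[OF assms, of 1 c] by (simp add: add.commute)

text \<open>With the imaginary part frozen a shear is a translation of the real part, so Fubini
  reduces the claim to translation invariance on the line.\<close>

lemma nn_integral_shear_Re:
  assumes [measurable]: "u \<in> borel_measurable borel"
  shows "(\<integral>\<^sup>+z. u (Complex (Re z + c * Im z) (Im z)) \<partial>lborel) = (\<integral>\<^sup>+z. u z \<partial>lborel)"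
proof -
  have inner: "(\<integral>\<^sup>+x. u (Complex (x + c * y) y) \<partial>lborel) = (\<integral>\<^sup>+x. u (Complex x y) \<partial>lborel)" for y
    by (rule nn_integral_translate_real[of "\<lambda>x. u (Complex x y)"]) auto
  have "(\<integral>\<^sup>+z. u (Complex (Re z + c * Im z) (Im z)) \<partial>lborel)
      = (\<integral>\<^sup>+y. \<integral>\<^sup>+x. u (Complex (x + c * y) y) \<partial>lborel \<partial>lborel)"
    by (subst nn_integral_complex(2)) auto
  thus ?thesis unfolding inner by (simp add: nn_integral_complex(2)[of u])
qed

lemma nn_integral_shear_Im:
  assumes [measurable]: "u \<in> borel_measurable borel"
  shows "(\<integral>\<^sup>+z. u (Complex (Re z) (Im z + c * Re z)) \<partial>lborel) = (\<integral>\<^sup>+z. u z \<partial>lborel)"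
proof -
  have inner: "(\<integral>\<^sup>+y. u (Complex x (y + c * x)) \<partial>lborel) = (\<integral>\<^sup>+y. u (Complex x y) \<partial>lborel)" for x
    by (rule nn_integral_translate_real[of "\<lambda>y. u (Complex x y)"]) auto
  have "(\<integral>\<^sup>+z. u (Complex (Re z) (Im z + c * Re z)) \<partial>lborel)
      = (\<integral>\<^sup>+x. \<integral>\<^sup>+y. u (Complex x (y + c * x)) \<partial>lborel \<partial>lborel)"
    by (subst nn_integral_complex(1)) auto
  thus ?thesis unfolding inner by (simp add: nn_integral_complex(1)[of u])
qed

text \<open>A rotation by an angle other than \<open>\<pi>\<close> is a product of three shears.\<close>

lemma nn_integral_rotate_aux:
  assumes u [measurable]: "u \<in> borel_measurable borel" and ne: "cos t \<noteq> -1"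
  shows "(\<integral>\<^sup>+z. u (cis t * z) \<partial>lborel) = (\<integral>\<^sup>+z. u z \<partial>lborel)"
proof -
  \<comment> \<open>This is - tan (t/2), the factor of the two outer shears; the middle one has
    factor sin t. It blows up exactly at the half turn.\<close>
  define k where "k = - sin t / (1 + cos t)"
  have nz: "1 + cos t \<noteq> 0" using ne by linarith
  have k1: "1 + sin t * k = cos t"
  proof -
    have "(sin t)\<^sup>2 = (1 - cos t) * (1 + cos t)"
      by (simp add: sin_squared_eq algebra_simps power2_eq_square)
    hence "sin t * sin t / (1 + cos t) = 1 - cos t"
      using nz by (simp add: power2_eq_square)
    thus ?thesis unfolding k_def by simp
  qed
  have k2: "k * (1 + cos t) = - sin t" unfolding k_def using nz by simp
  define A where "A z = Complex (Re z + k * Im z) (Im z)" for z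
  define B where "B z = Complex (Re z) (Im z + sin t * Re z)" for z
  have [measurable]: "A \<in> borel_measurable borel" "B \<in> borel_measurable borel"
    unfolding A_def B_def by measurable
  have "cis t * z = A (B (A z))" for z
  proof (rule complex_eqI)
    have "Re (A (B (A z))) = Re z * (1 + sin t * k) + Im z * (k + k * (1 + sin t * k))"
      by (simp add: A_def B_def algebra_simps)
    also have "\<dots> = Re (cis t * z)" unfolding k1 using k2 by (simp add: algebra_simps)
    finally show "Re (cis t * z) = Re (A (B (A z)))" ..
    have "Im (A (B (A z))) = sin t * Re z + Im z * (1 + sin t * k)"
      by (simp add: A_def B_def algebra_simps)
    thus "Im (cis t * z) = Im (A (B (A z)))" unfolding k1 by simp
  qed
  hence "(\<integral>\<^sup>+z. u (cis t * z) \<partial>lborel) = (\<integral>\<^sup>+z. u (A (B (A z))) \<partial>lborel)" by simp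
  also have "\<dots> = (\<integral>\<^sup>+z. u (A (B z)) \<partial>lborel)"
    using nn_integral_shear_Re[of "\<lambda>z. u (A (B z))" k] by (simp add: A_def[symmetric])
  also have "\<dots> = (\<integral>\<^sup>+z. u (A z) \<partial>lborel)"
    using nn_integral_shear_Im[of "\<lambda>z. u (A z)" "sin t"] by (simp add: B_def[symmetric])
  also have "\<dots> = (\<integral>\<^sup>+z. u z \<partial>lborel)"
    using nn_integral_shear_Re[of u k] by (simp add: A_def[symmetric])
  finally show ?thesis .
qed

lemma nn_integral_rotate:
  assumes u [measurable]: "u \<in> borel_measurable borel"
  shows "(\<integral>\<^sup>+z. u (cis t * z) \<partial>lborel) = (\<integral>\<^sup>+z. u z \<partial>lborel)"
proof (cases "cos t = -1")
  \<comment> \<open>The half turn, where the shears break down, is two quarter turns.\<close>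
  case True
  hence "sin t = 0" using sin_cos_squared_add[of t] by simp
  hence "cis t = -1" using True by (simp add: complex_eq_iff)
  hence "(\<integral>\<^sup>+z. u (cis t * z) \<partial>lborel) = (\<integral>\<^sup>+z. u (cis (pi/2) * (cis (pi/2) * z)) \<partial>lborel)"
    by (simp add: mult.assoc[symmetric])
  also have "\<dots> = (\<integral>\<^sup>+z. u z \<partial>lborel)"
    using nn_integral_rotate_aux[of "\<lambda>z. u (cis (pi/2) * z)" "pi/2"] nn_integral_rotate_aux[of u "pi/2"]
    by simp
  finally show ?thesis .
qed (rule nn_integral_rotate_aux[OF u])

text \<open>This replaces polar coordinates: integrating the rotation invariance over all angles and
  swapping the integrals exchanges a function for its circle means, which depend on the modulus
  alone.\<close>

lemma nn_integral_circle_average: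
  assumes u [measurable]: "u \<in> borel_measurable borel"
  shows "ennreal (2 * pi) * (\<integral>\<^sup>+z. u z \<partial>lborel) = (\<integral>\<^sup>+z. (\<integral>\<^sup>+t\<in>{0..2*pi}. u (cis t * z) \<partial>lborel) \<partial>lborel)"
proof -
  have "(\<integral>\<^sup>+z. (\<integral>\<^sup>+t\<in>{0..2*pi}. u (cis t * z) \<partial>lborel) \<partial>lborel)
     = (\<integral>\<^sup>+t. (\<integral>\<^sup>+z. u (cis t * z) * indicator {0..2*pi} t \<partial>lborel) \<partial>lborel)"
    by (rule lborel_pair.Fubini') auto
  also have "\<dots> = (\<integral>\<^sup>+t. (\<integral>\<^sup>+z. u z \<partial>lborel) * indicator {0..2*pi} t \<partial>lborel)"
    by (intro nn_integral_cong) (simp add: nn_integral_multc nn_integral_rotate)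
  also have "\<dots> = ennreal (2 * pi) * (\<integral>\<^sup>+z. u z \<partial>lborel)"
    by (simp add: nn_integral_cmult mult.commute)
  finally show ?thesis ..
qed

lemma emeasure_ball_complex: "0 \<le> r \<Longrightarrow> emeasure lborel (ball (c::complex) r) = ennreal (pi * r\<^sup>2)"
  and emeasure_cball_complex: "0 \<le> r \<Longrightarrow> emeasure lborel (cball (c::complex) r) = ennreal (pi * r\<^sup>2)"
  by (simp_all add: emeasure_ball emeasure_cball DIM_complex unit_ball_vol_2)

text \<open>The image of area on the disc under z -> |z|^2 is \<pi> times Lebesgue measure on [0,1],
  because the annulus x < |z|^2 < 1 has area \<pi>(1 - x). The variable is the squared modulus so
  that the density is constant. Half-lines suffice to identify the two measures.\<close>

lemma nn_integral_radial:
  fixes v :: "real \<Rightarrow> ennreal"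
  assumes v [measurable]: "v \<in> borel_measurable borel"
  shows "(\<integral>\<^sup>+z\<in>ball 0 1. v ((cmod z)\<^sup>2) \<partial>lborel) = ennreal pi * (\<integral>\<^sup>+s\<in>{0..1}. v s \<partial>lborel)"
proof -
  define M where "M = distr (density lborel (indicator (ball 0 1))) borel (\<lambda>z::complex. (cmod z)\<^sup>2)"
  define N where "N = density lborel (\<lambda>s::real. ennreal pi * indicator {0..1} s)"
  have eN: "emeasure N {x<..} = (if x < 0 then ennreal pi else if x < 1 then ennreal (pi * (1 - x)) else 0)" for x
  proof -
    have "emeasure N {x<..} = (\<integral>\<^sup>+s. ennreal pi * indicator ({0..1} \<inter> {x<..}) s \<partial>lborel)"
      unfolding N_def by (subst emeasure_density) (auto intro!: nn_integral_cong simp: indicator_def)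
    also have "\<dots> = ennreal pi * emeasure lborel ({0..1} \<inter> {x<..})"
      by (subst nn_integral_cmult) auto
    also have "{0..1} \<inter> {x<..} = (if x < 0 then {0..1} else if x < 1 then {x<..1} else {})" by auto
    finally show ?thesis by (auto simp: ennreal_mult)
  qed
  have eM: "emeasure M {x<..} = (if x < 0 then ennreal pi else if x < 1 then ennreal (pi * (1 - x)) else 0)" for x
  proof -
    have [measurable]: "{z::complex. x < (cmod z)\<^sup>2} \<in> sets borel"
      by measurable
    have "emeasure M {x<..} = emeasure (density lborel (indicator (ball 0 1))) {z::complex. x < (cmod z)\<^sup>2}"
      unfolding M_def by (subst emeasure_distr) (auto simp: vimage_def)
    also have "\<dots> = (\<integral>\<^sup>+z. indicator (ball 0 1 \<inter> {z::complex. x < (cmod z)\<^sup>2}) z \<partial>lborel)"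
      unfolding indicator_inter_arith
      by (rule emeasure_density) (auto intro: borel_measurable_indicator)
    also have "\<dots> = emeasure lborel (ball 0 1 \<inter> {z::complex. x < (cmod z)\<^sup>2})"
      by (subst nn_integral_indicator) auto
    also have "\<dots> = (if x < 0 then ennreal pi else if x < 1 then ennreal (pi * (1 - x)) else 0)"
    proof -
      consider "x < 0" | "0 \<le> x" "x < 1" | "1 \<le> x" by linarith
      thus ?thesis
      proof cases
        case 1
        hence "ball 0 1 \<inter> {z::complex. x < (cmod z)\<^sup>2} = ball 0 1"
          by auto (smt (verit) zero_le_power2)
        thus ?thesis using 1 by (simp add: emeasure_ball_complex)
      next
        case 2
        have "ball 0 1 \<inter> {z::complex. x < (cmod z)\<^sup>2} = ball 0 1 - cball 0 (sqrt x)"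
          using 2 by (auto simp: not_le real_le_rsqrt real_less_lsqrt real_less_rsqrt)
             (metis norm_ge_zero not_less real_le_rsqrt real_sqrt_le_iff real_sqrt_unique sqrt_le_D)+
        moreover have "cball 0 (sqrt x) \<subseteq> ball (0::complex) 1"
          using real_sqrt_lt_1_iff[of x] 2 by (auto simp del: real_sqrt_lt_1_iff intro: le_less_trans[of _ "sqrt x"])
        ultimately have "emeasure lborel (ball 0 1 \<inter> {z::complex. x < (cmod z)\<^sup>2}) = ennreal (pi * 1\<^sup>2) - ennreal (pi * (sqrt x)\<^sup>2)"
          using 2 by (simp add: emeasure_Diff emeasure_ball_complex emeasure_cball_complex)
        also have "\<dots> = ennreal (pi * (1 - x))"
          using 2 by (subst ennreal_minus) (auto simp: algebra_simps)
        finally show ?thesis using 2 by simp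
      next
        case 3
        hence "ball 0 1 \<inter> {z::complex. x < (cmod z)\<^sup>2} = {}"
          by auto (smt (verit) norm_ge_zero power_le_one)
        thus ?thesis using 3 by simp
      qed
    qed
    finally show ?thesis .
  qed
  have "M = N"
    by (rule measure_eqI_lessThan) (auto simp: eM eN, auto simp: M_def N_def)
  have "(\<integral>\<^sup>+z\<in>ball 0 1. v ((cmod z)\<^sup>2) \<partial>lborel) = (\<integral>\<^sup>+s. v s \<partial>M)"
    unfolding M_def by (subst nn_integral_distr, simp, simp, subst nn_integral_density)
      (auto simp: mult.commute intro: borel_measurable_indicator)
  also have "\<dots> = (\<integral>\<^sup>+s. v s \<partial>N)" using \<open>M = N\<close> by simp
  also have "\<dots> = (\<integral>\<^sup>+s. ennreal pi * (v s * indicator {0..1} s) \<partial>lborel)"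
    unfolding N_def by (subst nn_integral_density) (auto simp: mult_ac)
  also have "\<dots> = ennreal pi * (\<integral>\<^sup>+s\<in>{0..1}. v s \<partial>lborel)"
    by (rule nn_integral_cmult) auto
  finally show ?thesis .
qed

section \<open>The Littlewood--Paley identity\<close>

lemma set_nn_integral_has_integral:
  fixes u :: "real \<Rightarrow> real"
  assumes "continuous_on {a..b} u" "\<And>t. t \<in> {a..b} \<Longrightarrow> 0 \<le> u t" "(u has_integral I) {a..b}"
  shows "(\<integral>\<^sup>+t\<in>{a..b}. ennreal (u t) \<partial>lborel) = ennreal I"
proof -
  have "(\<integral>\<^sup>+t. ennreal (indicator {a..b} t *\<^sub>R u t) \<partial>lborel) = ennreal I"
  proof (rule nn_integral_has_integral_lborel)
    show "(\<lambda>t. indicator {a..b} t *\<^sub>R u t) \<in> borel_measurable borel"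
      by (rule borel_measurable_continuous_on_indicator) (use assms in auto)
    show "0 \<le> indicator {a..b} t *\<^sub>R u t" for t
      using assms(2)[of t] by (auto simp: indicator_def)
    have "((\<lambda>t. if t \<in> {a..b} then u t else 0) has_integral I) UNIV"
      by (rule iffD2[OF has_integral_restrict_UNIV assms(3)])
    thus "((\<lambda>t. indicator {a..b} t *\<^sub>R u t) has_integral I) UNIV"
      by (rule has_integral_eq[rotated]) (auto simp: indicator_def)
  qed
  moreover have "(\<integral>\<^sup>+t\<in>{a..b}. ennreal (u t) \<partial>lborel) = (\<integral>\<^sup>+t. ennreal (indicator {a..b} t *\<^sub>R u t) \<partial>lborel)"
    by (intro nn_integral_cong) (auto simp: indicator_def)
  ultimately show ?thesis by simp
qed

lemma powser_abs_summable:
  fixes b :: "nat \<Rightarrow> complex"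
  assumes "\<And>z. cmod z < 1 \<Longrightarrow> (\<lambda>n. b n * z ^ n) sums h z" "cmod z < 1"
  shows "summable (\<lambda>n. cmod (b n * z ^ n))"
proof -
  define x where "x = complex_of_real ((1 + cmod z) / 2)"
  have x: "cmod x = (1 + cmod z) / 2" unfolding x_def norm_of_real by simp
  show ?thesis
    using assms(1)[of x] assms(2) x
    by (intro powser_insidea[of b x z]) (auto simp: sums_iff)
qed

lemma circle_mean_square:
  fixes b :: "nat \<Rightarrow> complex"
  assumes sums: "\<And>z. cmod z < 1 \<Longrightarrow> (\<lambda>n. b n * z ^ n) sums h z" and z: "cmod z < 1"
  shows "((\<lambda>t. (cmod (h (cis t * z)))\<^sup>2) has_integral (2*pi * (\<Sum>n. (cmod (b n))\<^sup>2 * (cmod z)\<^sup>2 ^ n))) {0..2*pi}"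
    and "summable (\<lambda>n. (cmod (b n))\<^sup>2 * (cmod z)\<^sup>2 ^ n)"
proof -
  have s: "summable (\<lambda>n. cmod (b n * z ^ n))" by (rule powser_abs_summable[OF sums z])
  have "(\<Sum>n. b n * (cis t * z) ^ n) = h (cis t * z)" for t
    using sums[of "cis t * z"] z by (simp add: sums_iff norm_mult)
  thus "((\<lambda>t. (cmod (h (cis t * z)))\<^sup>2) has_integral (2*pi * (\<Sum>n. (cmod (b n))\<^sup>2 * (cmod z)\<^sup>2 ^ n))) {0..2*pi}"
    using parseval[OF s] by simp
  have "(cmod (b n * z ^ n))\<^sup>2 = (cmod (b n))\<^sup>2 * (cmod z)\<^sup>2 ^ n" for n
    by (simp add: norm_mult norm_power power_mult_distrib flip: power_mult) (simp add: mult.commute)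
  thus "summable (\<lambda>n. (cmod (b n))\<^sup>2 * (cmod z)\<^sup>2 ^ n)"
    using summable_norm_square[OF s] by simp
qed

lemma nn_circle_mean_square:
  fixes b :: "nat \<Rightarrow> complex"
  assumes sums: "\<And>z. cmod z < 1 \<Longrightarrow> (\<lambda>n. b n * z ^ n) sums h z" and z: "cmod z < 1"
    and cont: "continuous_on (ball 0 1) h"
  shows "(\<integral>\<^sup>+t\<in>{0..2*pi}. ennreal ((cmod (h (cis t * z)))\<^sup>2) \<partial>lborel)
     = ennreal (2*pi) * (\<Sum>n. ennreal ((cmod (b n))\<^sup>2 * (cmod z)\<^sup>2 ^ n))"
proof -
  have "(\<integral>\<^sup>+t\<in>{0..2*pi}. ennreal ((cmod (h (cis t * z)))\<^sup>2) \<partial>lborel)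
     = ennreal (2*pi * (\<Sum>n. (cmod (b n))\<^sup>2 * (cmod z)\<^sup>2 ^ n))"
    by (rule set_nn_integral_has_integral[OF _ _ circle_mean_square(1)[OF sums z]])
       (use z in \<open>auto intro!: continuous_intros continuous_on_compose2[OF cont] simp: norm_mult\<close>)
  also have "\<dots> = ennreal (2*pi) * ennreal (\<Sum>n. (cmod (b n))\<^sup>2 * (cmod z)\<^sup>2 ^ n)"
    by (rule ennreal_mult) (auto intro!: suminf_nonneg circle_mean_square(2)[OF sums z])
  also have "ennreal (\<Sum>n. (cmod (b n))\<^sup>2 * (cmod z)\<^sup>2 ^ n) = (\<Sum>n. ennreal ((cmod (b n))\<^sup>2 * (cmod z)\<^sup>2 ^ n))"
    by (rule suminf_ennreal_eq[symmetric]) (auto intro!: summable_sums circle_mean_square(2)[OF sums z])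
  finally show ?thesis .
qed

text \<open>A holomorphic function on the disc is arbitrary outside it, so it can be measurable only
  after it is cut off; the cut-off is moved inside the square, where continuity on S
  applies.\<close>

lemma measurable_square_indicator:
  fixes f :: "complex \<Rightarrow> complex"
  assumes f: "continuous_on S f" and S: "S \<in> sets borel" and v [measurable]: "v \<in> borel_measurable borel"
  shows "(\<lambda>z. ennreal ((cmod (f z))\<^sup>2 * v z) * indicator S z) \<in> borel_measurable borel"
proof -
  have [measurable]: "(\<lambda>z. indicator S z *\<^sub>R f z) \<in> borel_measurable borel"
    by (rule borel_measurable_continuous_on_indicator[OF S f])
  have "(\<lambda>z. ennreal ((cmod (indicator S z *\<^sub>R f z))\<^sup>2 * v z)) \<in> borel_measurable borel" by measurable
  also have "(\<lambda>z. ennreal ((cmod (indicator S z *\<^sub>R f z))\<^sup>2 * v z)) = (\<lambda>z. ennreal ((cmod (f z))\<^sup>2 * v z) * indicator S z)"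
    by (auto simp: indicator_def)
  finally show ?thesis .
qed

text \<open>By circle averaging |h|^2 becomes the series of |b n|^2 |z|^(2n), and each term is
  radial. In extended nonnegative reals the sum and the integral commute without any convergence
  condition. The weight v is later 1 - s for Littlewood--Paley, an indicator for an annulus, and 1
  for the mean value inequality.\<close>

lemma nn_integral_disc_square:
  fixes b :: "nat \<Rightarrow> complex"
  assumes sums: "\<And>z. cmod z < 1 \<Longrightarrow> (\<lambda>n. b n * z ^ n) sums h z"
    and cont: "continuous_on (ball 0 1) h"
    and v [measurable]: "v \<in> borel_measurable borel" and vnn: "\<And>s. 0 \<le> v s"
  shows "(\<integral>\<^sup>+z\<in>ball 0 1. ennreal ((cmod (h z))\<^sup>2 * v ((cmod z)\<^sup>2)) \<partial>lborel)
     = (\<Sum>n. ennreal (pi * (cmod (b n))\<^sup>2) * (\<integral>\<^sup>+s\<in>{0..1}. ennreal (s ^ n * v s) \<partial>lborel))"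
proof -
  define u where "u z = ennreal ((cmod (h z))\<^sup>2 * v ((cmod z)\<^sup>2)) * indicator (ball 0 1) z" for z
  have u_alt: "u = (\<lambda>z. ennreal ((norm (indicator (ball 0 1) z *\<^sub>R h z))\<^sup>2 * v ((cmod z)\<^sup>2)))"
    unfolding u_def by (auto simp: indicator_def)
  have [measurable]: "(\<lambda>z. indicator (ball 0 1) z *\<^sub>R h z) \<in> borel_measurable borel"
    by (rule borel_measurable_continuous_on_indicator) (use cont in auto)
  have [measurable]: "u \<in> borel_measurable borel" unfolding u_alt by measurable
  have "ennreal (2*pi) * (\<integral>\<^sup>+z. u z \<partial>lborel) = (\<integral>\<^sup>+z. (\<integral>\<^sup>+t\<in>{0..2*pi}. u (cis t * z) \<partial>lborel) \<partial>lborel)"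
    by (rule nn_integral_circle_average) auto
  also have "\<dots> = (\<integral>\<^sup>+z. (\<Sum>n. ennreal (2*pi) * (ennreal ((cmod (b n))\<^sup>2) *
       (ennreal ((cmod z)\<^sup>2 ^ n * v ((cmod z)\<^sup>2)) * indicator (ball 0 1) z))) \<partial>lborel)"
  proof (intro nn_integral_cong)
    fix z :: complex
    show "(\<integral>\<^sup>+t\<in>{0..2*pi}. u (cis t * z) \<partial>lborel) = (\<Sum>n. ennreal (2*pi) * (ennreal ((cmod (b n))\<^sup>2) *
       (ennreal ((cmod z)\<^sup>2 ^ n * v ((cmod z)\<^sup>2)) * indicator (ball 0 1) z)))"
    proof (cases "cmod z < 1")
      case True
      have "(\<integral>\<^sup>+t\<in>{0..2*pi}. u (cis t * z) \<partial>lborel)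
        = (\<integral>\<^sup>+t. ennreal (v ((cmod z)\<^sup>2)) * (ennreal ((cmod (h (cis t * z)))\<^sup>2) * indicator {0..2*pi} t) \<partial>lborel)"
      proof (intro nn_integral_cong)
        fix t
        have "ennreal ((cmod (h (cis t * z)))\<^sup>2 * v ((cmod z)\<^sup>2)) = ennreal (v ((cmod z)\<^sup>2)) * ennreal ((cmod (h (cis t * z)))\<^sup>2)"
          by (subst ennreal_mult) (auto simp: vnn mult.commute)
        thus "u (cis t * z) * indicator {0..2*pi} t = ennreal (v ((cmod z)\<^sup>2)) * (ennreal ((cmod (h (cis t * z)))\<^sup>2) * indicator {0..2*pi} t)"
          unfolding u_def using True by (simp add: norm_mult mult.assoc)
      qed
      also have "\<dots> = ennreal (v ((cmod z)\<^sup>2)) * (\<integral>\<^sup>+t\<in>{0..2*pi}. ennreal ((cmod (h (cis t * z)))\<^sup>2) \<partial>lborel)"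
      proof (rule nn_integral_cmult)
        have "(\<lambda>t. ennreal ((cmod (h (cis t * z)))\<^sup>2) * indicator {0..2*pi} t) =
              (\<lambda>t. ennreal ((cmod (indicator (ball 0 1) (cis t * z) *\<^sub>R h (cis t * z)))\<^sup>2) * indicator {0..2*pi} t)"
          using True by (auto simp: indicator_def norm_mult)
        also have "\<dots> \<in> borel_measurable lborel" by measurable
        finally show "(\<lambda>t. ennreal ((cmod (h (cis t * z)))\<^sup>2) * indicator {0..2*pi} t) \<in> borel_measurable lborel" .
      qed
      also have "\<dots> = ennreal (2*pi) * (ennreal (v ((cmod z)\<^sup>2)) * (\<Sum>n. ennreal ((cmod (b n))\<^sup>2 * (cmod z)\<^sup>2 ^ n)))"
        by (subst nn_circle_mean_square[OF sums True cont]) (auto simp: mult.left_commute)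
      also have "\<dots> = (\<Sum>n. ennreal (2*pi) * (ennreal ((cmod (b n))\<^sup>2) *
       (ennreal ((cmod z)\<^sup>2 ^ n * v ((cmod z)\<^sup>2)) * indicator (ball 0 1) z)))"
      proof -
        have "ennreal (v ((cmod z)\<^sup>2)) * ennreal ((cmod (b n))\<^sup>2 * (cmod z)\<^sup>2 ^ n)
          = ennreal ((cmod (b n))\<^sup>2) * (ennreal ((cmod z)\<^sup>2 ^ n * v ((cmod z)\<^sup>2)) * indicator (ball 0 1) z)" for n
        proof -
          have "v ((cmod z)\<^sup>2) * ((cmod (b n))\<^sup>2 * (cmod z)\<^sup>2 ^ n) = (cmod (b n))\<^sup>2 * ((cmod z)\<^sup>2 ^ n * v ((cmod z)\<^sup>2))" by simp
          hence "ennreal (v ((cmod z)\<^sup>2)) * ennreal ((cmod (b n))\<^sup>2 * (cmod z)\<^sup>2 ^ n)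
             = ennreal ((cmod (b n))\<^sup>2) * ennreal ((cmod z)\<^sup>2 ^ n * v ((cmod z)\<^sup>2))"
            by (subst (1 2) ennreal_mult[symmetric]) (auto simp: vnn)
          thus ?thesis using True by simp
        qed
        thus ?thesis unfolding ennreal_suminf_cmult[symmetric] by simp
      qed
      finally show ?thesis .
    next
      case False
      thus ?thesis by (simp add: u_def norm_mult)
    qed
  qed
  also have "\<dots> = (\<Sum>n. ennreal (2*pi) * (ennreal ((cmod (b n))\<^sup>2) * (\<integral>\<^sup>+z\<in>ball 0 1. ennreal ((cmod z)\<^sup>2 ^ n * v ((cmod z)\<^sup>2)) \<partial>lborel)))"
  proof -
    have [measurable]: "ball (0::complex) 1 \<in> sets borel" by simp
    have m: "(\<lambda>z. ennreal ((cmod z)\<^sup>2 ^ n * v ((cmod z)\<^sup>2)) * indicator (ball 0 1) z) \<in> borel_measurable lborel" for n :: nat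
      by measurable
    show ?thesis
      by (subst nn_integral_suminf, intro borel_measurable_times_ennreal m borel_measurable_const)
         (simp only: nn_integral_cmult[OF borel_measurable_times_ennreal[OF borel_measurable_const m]] nn_integral_cmult[OF m])
  qed
  also have "\<dots> = (\<Sum>n. ennreal (2*pi) * (ennreal ((cmod (b n))\<^sup>2) * (ennreal pi * (\<integral>\<^sup>+s\<in>{0..1}. ennreal (s ^ n * v s) \<partial>lborel))))"
    by (subst nn_integral_radial) auto
  also have "\<dots> = ennreal (2*pi) * (\<Sum>n. ennreal (pi * (cmod (b n))\<^sup>2) * (\<integral>\<^sup>+s\<in>{0..1}. ennreal (s ^ n * v s) \<partial>lborel))"
  proof -
    have "ennreal ((cmod (b n))\<^sup>2) * (ennreal pi * X) = ennreal (pi * (cmod (b n))\<^sup>2) * X" for n X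
      by (subst ennreal_mult) (auto simp: mult_ac)
    thus ?thesis unfolding ennreal_suminf_cmult[symmetric] by simp
  qed
  finally have "(\<integral>\<^sup>+z. u z \<partial>lborel) = (\<Sum>n. ennreal (pi * (cmod (b n))\<^sup>2) * (\<integral>\<^sup>+s\<in>{0..1}. ennreal (s ^ n * v s) \<partial>lborel))"
    by (subst (asm) ennreal_mult_cancel_left) auto
  thus ?thesis unfolding u_def .
qed

lemma nn_integral_beta:
  "(\<integral>\<^sup>+s\<in>{0..1}. ennreal (s ^ n * (1 - s)) \<partial>lborel) = ennreal (1 / ((real n + 1) * (real n + 2)))"
proof -
  define F where "F s = s ^ Suc n / real (Suc n) - s ^ Suc (Suc n) / real (Suc (Suc n))" for s :: real
  have "((\<lambda>s. s ^ n * (1 - s)) has_integral (F 1 - F 0)) {0..1}"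
  proof (rule fundamental_theorem_of_calculus)
    fix s :: real
    have "(F has_real_derivative (s ^ n * (1 - s))) (at s within {0..1})"
      unfolding F_def
      by (rule derivative_eq_intros refl | simp del: of_nat_Suc power_Suc)+
         (simp add: algebra_simps del: of_nat_Suc)
    thus "(F has_vector_derivative (s ^ n * (1 - s))) (at s within {0..1})"
      by (simp add: has_real_derivative_iff_has_vector_derivative)
  qed auto
  moreover have "F 1 - F 0 = 1 / ((real n + 1) * (real n + 2))"
    unfolding F_def by (simp add: field_simps)
  ultimately have "((\<lambda>s. s ^ n * (1 - s)) has_integral (1 / ((real n + 1) * (real n + 2)))) {0..1}" by simp
  thus ?thesis
    by (rule set_nn_integral_has_integral[rotated 2]) (auto intro!: continuous_intros)
qed

lemma deriv_powser:
  fixes b :: "nat \<Rightarrow> complex"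
  assumes sums: "\<And>z. cmod z < 1 \<Longrightarrow> (\<lambda>n. b n * z ^ n) sums h z" and z: "cmod z < 1"
  shows "(\<lambda>n. (of_nat (Suc n) * b (Suc n)) * z ^ n) sums deriv h z"
proof -
  have s: "summable (\<lambda>n. b n * w ^ n)" if "norm w < 1" for w using sums[OF that] by (simp add: sums_iff)
  have d: "((\<lambda>w. \<Sum>n. b n * w ^ n) has_field_derivative (\<Sum>n. diffs b n * z ^ n)) (at z)"
    by (rule termdiffs_strong'[OF s z])
  have "(h has_field_derivative (\<Sum>n. diffs b n * z ^ n)) (at z)"
  proof (rule has_field_derivative_transform_within_open[OF d, of "ball 0 1"])
    show "(\<Sum>n. b n * w ^ n) = h w" if "w \<in> ball 0 1" for w
      using sums[of w] that by (simp add: sums_iff)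
  qed (use z in auto)
  hence "deriv h z = (\<Sum>n. diffs b n * z ^ n)" by (rule DERIV_imp_deriv)
  moreover have "summable (\<lambda>n. diffs b n * z ^ n)"
    by (rule termdiff_converges[OF z s])
  ultimately show ?thesis by (simp add: sums_iff diffs_def)
qed

abbreviation lp_density :: "(complex \<Rightarrow> complex) \<Rightarrow> complex \<Rightarrow> real" where
  "lp_density h z \<equiv> (cmod (deriv h z))\<^sup>2 * (1 - (cmod z)\<^sup>2)"

abbreviation lp_integral :: "complex set \<Rightarrow> (complex \<Rightarrow> complex) \<Rightarrow> ennreal" where
  "lp_integral S h \<equiv> (\<integral>\<^sup>+z\<in>S. ennreal (lp_density h z) \<partial>lborel)"

text \<open>The derivative has coefficients (n+1) b (n+1), and the n-th moment of the weight 1 - s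
  is 1 / ((n+1)(n+2)); the quotient (n+1)/(n+2) is what remains. It lies between 1/2 and 1, which
  gives the two comparisons with the sum of |b (n+1)|^2.\<close>

lemma littlewood_paley:
  fixes b :: "nat \<Rightarrow> complex"
  assumes hol: "h holomorphic_on ball 0 1"
    and sums: "\<And>z. cmod z < 1 \<Longrightarrow> (\<lambda>n. b n * z ^ n) sums h z"
  shows "lp_integral (ball 0 1) h
     = ennreal pi * (\<Sum>n. ennreal ((real n + 1) / (real n + 2) * (cmod (b (Suc n)))\<^sup>2))"
proof -
  \<comment> \<open>The weight must be nonnegative on the whole line, hence the truncation of 1 - s;
    on [0,1] nothing changes.\<close>
  have inner: "(\<integral>\<^sup>+s\<in>{0..1}. ennreal (s ^ n * max 0 (1 - s)) \<partial>lborel) = ennreal (1 / ((real n + 1) * (real n + 2)))" for n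
    unfolding nn_integral_beta[symmetric] by (intro nn_integral_cong) (auto simp: indicator_def max_def)
  have "lp_integral (ball 0 1) h
     = (\<integral>\<^sup>+z\<in>ball 0 1. ennreal ((cmod (deriv h z))\<^sup>2 * max 0 (1 - (cmod z)\<^sup>2)) \<partial>lborel)"
    by (intro nn_integral_cong) (auto simp: indicator_def max_def power_le_one)
  also have "\<dots> = (\<Sum>n. ennreal (pi * (cmod (of_nat (Suc n) * b (Suc n)))\<^sup>2) * (\<integral>\<^sup>+s\<in>{0..1}. ennreal (s ^ n * max 0 (1 - s)) \<partial>lborel))"
    by (rule nn_integral_disc_square[of "\<lambda>n. of_nat (Suc n) * b (Suc n)" "deriv h" "\<lambda>s. max 0 (1 - s)"])
       (use deriv_powser[OF sums] hol in \<open>auto intro!: holomorphic_on_imp_continuous_on holomorphic_deriv\<close>)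
  also have "\<dots> = (\<Sum>n. ennreal (pi * (cmod (of_nat (Suc n) * b (Suc n)))\<^sup>2) * ennreal (1 / ((real n + 1) * (real n + 2))))"
    unfolding inner ..
  also have "(\<Sum>n. ennreal (pi * (cmod (of_nat (Suc n) * b (Suc n)))\<^sup>2) * ennreal (1 / ((real n + 1) * (real n + 2))))
     = (\<Sum>n. ennreal pi * ennreal ((real n + 1) / (real n + 2) * (cmod (b (Suc n)))\<^sup>2))"
  proof (intro suminf_cong)
    fix n
    have "pi * (cmod (of_nat (Suc n) * b (Suc n)))\<^sup>2 * (1 / ((real n + 1) * (real n + 2)))
        = pi * ((real n + 1) / (real n + 2) * (cmod (b (Suc n)))\<^sup>2)"
      unfolding norm_mult norm_of_nat by (simp add: power2_eq_square divide_simps) (simp add: algebra_simps)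
    thus "ennreal (pi * (cmod (of_nat (Suc n) * b (Suc n)))\<^sup>2) * ennreal (1 / ((real n + 1) * (real n + 2)))
       = ennreal pi * ennreal ((real n + 1) / (real n + 2) * (cmod (b (Suc n)))\<^sup>2)"
      by (subst (1 2) ennreal_mult[symmetric]) auto
  qed
  finally show ?thesis by simp
qed

lemma littlewood_paley_le:
  fixes b :: "nat \<Rightarrow> complex"
  assumes hol: "h holomorphic_on ball 0 1"
    and sums: "\<And>z. cmod z < 1 \<Longrightarrow> (\<lambda>n. b n * z ^ n) sums h z"
  shows "lp_integral (ball 0 1) h
     \<le> ennreal pi * (\<Sum>n. ennreal ((cmod (b (Suc n)))\<^sup>2))"
proof -
  have le: "(real n + 1) / (real n + 2) * (cmod (b (Suc n)))\<^sup>2 \<le> 1 * (cmod (b (Suc n)))\<^sup>2" for n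
    by (intro mult_right_mono) auto
  have "lp_integral (ball 0 1) h
     = ennreal pi * (\<Sum>n. ennreal ((real n + 1) / (real n + 2) * (cmod (b (Suc n)))\<^sup>2))"
    by (rule littlewood_paley[OF hol sums])
  also have "\<dots> \<le> ennreal pi * (\<Sum>n. ennreal ((cmod (b (Suc n)))\<^sup>2))"
    using le by (intro mult_left_mono suminf_le ennreal_leI) auto
  finally show ?thesis .
qed

text \<open>The factor 2 is the loss at n = 0, where (n+1)/(n+2) equals 1/2.\<close>

lemma littlewood_paley_ge:
  fixes b :: "nat \<Rightarrow> complex"
  assumes hol: "h holomorphic_on ball 0 1"
    and sums: "\<And>z. cmod z < 1 \<Longrightarrow> (\<lambda>n. b n * z ^ n) sums h z"
  shows "ennreal pi * (\<Sum>n. ennreal ((cmod (b (Suc n)))\<^sup>2))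
    \<le> 2 * lp_integral (ball 0 1) h"
proof -
  have "(\<Sum>n. ennreal ((cmod (b (Suc n)))\<^sup>2)) \<le> (\<Sum>n. 2 * ennreal ((real n + 1) / (real n + 2) * (cmod (b (Suc n)))\<^sup>2))"
  proof (intro suminf_le)
    fix n
    have "1 * (cmod (b (Suc n)))\<^sup>2 \<le> (2 * ((real n + 1) / (real n + 2))) * (cmod (b (Suc n)))\<^sup>2"
      by (intro mult_right_mono) (auto simp: divide_simps)
    hence "ennreal ((cmod (b (Suc n)))\<^sup>2) \<le> ennreal (2 * ((real n + 1) / (real n + 2) * (cmod (b (Suc n)))\<^sup>2))"
      by (intro ennreal_leI) (simp only: mult.assoc mult_1_left)
    also have "\<dots> = 2 * ennreal ((real n + 1) / (real n + 2) * (cmod (b (Suc n)))\<^sup>2)"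
      by (subst ennreal_mult) auto
    finally show "ennreal ((cmod (b (Suc n)))\<^sup>2) \<le> 2 * ennreal ((real n + 1) / (real n + 2) * (cmod (b (Suc n)))\<^sup>2)" .
  qed auto
  also have "\<dots> = 2 * (\<Sum>n. ennreal ((real n + 1) / (real n + 2) * (cmod (b (Suc n)))\<^sup>2))"
    by simp
  finally have "ennreal pi * (\<Sum>n. ennreal ((cmod (b (Suc n)))\<^sup>2))
     \<le> ennreal pi * (2 * (\<Sum>n. ennreal ((real n + 1) / (real n + 2) * (cmod (b (Suc n)))\<^sup>2)))"
    by (rule mult_left_mono) simp
  also have "\<dots> = 2 * (ennreal pi * (\<Sum>n. ennreal ((real n + 1) / (real n + 2) * (cmod (b (Suc n)))\<^sup>2)))"
    by (rule mult.left_commute)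
  also have "\<dots> = 2 * lp_integral (ball 0 1) h"
    by (rule arg_cong[where f = "\<lambda>x. 2 * x"], rule littlewood_paley[OF hol sums, symmetric])
  finally show ?thesis .
qed

lemma holomorphic_power_series_0:
  assumes "f holomorphic_on ball 0 R"
  obtains c where "\<And>z. cmod z < R \<Longrightarrow> (\<lambda>n. c n * z ^ n) sums f z"
proof (rule that)
  show "(\<lambda>n. (deriv ^^ n) f 0 / fact n * z ^ n) sums f z" if "cmod z < R" for z
    using holomorphic_power_series[OF assms, of z] that by simp
qed

text \<open>A bound that is uniform for x < 1 passes to x = 1 in every finite partial sum, and the
  terms are nonnegative. In this way uniform mean-square bounds on circles become bounds on the
  coefficients.\<close>

lemma power_sum_bound:
  fixes c :: "nat \<Rightarrow> real"
  assumes nn: "\<And>n. 0 \<le> c n" and summ: "\<And>x. 0 < x \<Longrightarrow> x < 1 \<Longrightarrow> summable (\<lambda>n. c n * x ^ n)"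
    and le: "\<And>x. 0 < x \<Longrightarrow> x < 1 \<Longrightarrow> (\<Sum>n. c n * x ^ n) \<le> B"
  shows "summable c" "suminf c \<le> B" "(\<Sum>n. ennreal (c n)) \<le> ennreal B"
proof -
  have fin: "(\<Sum>n<N. c n) \<le> B" for N
  proof (rule tendsto_upperbound)
    show "((\<lambda>x. \<Sum>n<N. c n * x ^ n) \<longlongrightarrow> (\<Sum>n<N. c n)) (at_left (1::real))"
      by (rule tendsto_eq_intros refl | simp)+
    have "\<forall>\<^sub>F x in at_left (1::real). x \<in> {0<..<1}"
      by (rule eventually_at_left_real) simp
    thus "\<forall>\<^sub>F x in at_left 1. (\<Sum>n<N. c n * x ^ n) \<le> B"
    proof eventually_elim
      case (elim x)
      have "(\<Sum>n<N. c n * x ^ n) \<le> (\<Sum>n. c n * x ^ n)"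
        using elim nn by (intro sum_le_suminf summ) auto
      thus ?case using le[of x] elim by simp
    qed
  qed simp
  show s: "summable c"
  proof (rule bounded_imp_summable)
    show "(\<Sum>n\<le>N. c n) \<le> B" for N using fin[of "Suc N"] unfolding lessThan_Suc_atMost .
  qed (rule nn)
  show B: "suminf c \<le> B" using fin by (intro suminf_le_const s)
  have "(\<Sum>n. ennreal (c n)) = ennreal (suminf c)"
    by (rule suminf_ennreal_eq[OF nn summable_sums[OF s]])
  thus "(\<Sum>n. ennreal (c n)) \<le> ennreal B" using ennreal_leI[OF B] by (simp only:)
qed

section \<open>Conformal invariance\<close>

definition mobius :: "complex \<Rightarrow> complex \<Rightarrow> complex" where
  "mobius a z = (a - z) / (1 - cnj a * z)"

lemma norm_mobius_cis:
  assumes "cmod a < 1" shows "cmod (mobius a (cis t)) = 1"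
proof -
  have nz: "1 - cnj a * cis t \<noteq> 0" using one_minus_cnj_mult_nonzero[OF assms] by simp
  have "cmod (a - cis t) = cmod (cnj (a - cis t))" by (simp only: complex_mod_cnj)
  also have "\<dots> = cmod (cis t * cnj (a - cis t))" by (simp add: norm_mult)
  also have "cis t * cnj (a - cis t) = - (1 - cnj a * cis t)"
    by (simp add: algebra_simps cis_cnj cis_mult)
  finally show ?thesis unfolding mobius_def using nz by (simp add: norm_divide norm_minus_commute)
qed

lemma norm_mobius_less_1:
  assumes "cmod a < 1" "cmod z < 1" shows "cmod (mobius a z) < 1"
proof -
  have nz: "1 - cnj a * z \<noteq> 0" using one_minus_cnj_mult_nonzero[OF assms(1)] assms(2) by simp
  have "(cmod (1 - cnj a * z))\<^sup>2 - (cmod (a - z))\<^sup>2 = (1 - (cmod a)\<^sup>2) * (1 - (cmod z)\<^sup>2)"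
    unfolding cmod_power2 by (simp add: power2_eq_square algebra_simps)
  moreover have "0 < (1 - (cmod a)\<^sup>2) * (1 - (cmod z)\<^sup>2)"
    using assms by (intro mult_pos_pos) (simp_all add: power_less_one_iff abs_square_less_1)
  ultimately have "(cmod (a - z))\<^sup>2 < (cmod (1 - cnj a * z))\<^sup>2" by linarith
  hence "cmod (a - z) < cmod (1 - cnj a * z)" by (rule power2_less_imp_less) simp
  thus ?thesis unfolding mobius_def using nz by (simp add: norm_divide)
qed

lemma mobius_0 [simp]: "mobius a 0 = a" by (simp add: mobius_def)

lemma mobius_self [simp]: "mobius a a = 0" by (simp add: mobius_def)

lemma mobius_mobius:
  assumes "cmod a < 1" "cmod z \<le> 1" shows "mobius a (mobius a z) = z"
proof -
  have nz: "1 - cnj a * z \<noteq> 0" using one_minus_cnj_mult_nonzero[OF assms] .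
  have nza: "1 - cnj a * a \<noteq> 0" using one_minus_cnj_mult_nonzero[OF assms(1), of a] assms(1) by simp
  have 1: "a - (a - z) / (1 - cnj a * z) = z * (1 - cnj a * a) / (1 - cnj a * z)"
    using nz by (simp add: field_simps)
  have 2: "1 - cnj a * ((a - z) / (1 - cnj a * z)) = (1 - cnj a * a) / (1 - cnj a * z)"
    using nz by (simp add: field_simps)
  show ?thesis unfolding mobius_def 1 2 using nz nza by simp
qed

lemma mobius_holomorphic:
  assumes "cmod a < 1" "S \<subseteq> {z. 1 - cnj a * z \<noteq> 0}" shows "mobius a holomorphic_on S"
  unfolding mobius_def using assms(2) by (auto intro!: holomorphic_intros)

text \<open>Compactness gives a uniform margin around the closed disc. The purpose is to expand a
  composition with a disc automorphism in a power series that converges absolutely on the unit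
  circle.\<close>

lemma disc_in_open:
  assumes "open U" "cball (0::complex) 1 \<subseteq> U"
  obtains R where "1 < R" "ball 0 R \<subseteq> U"
proof -
  obtain e where e: "e > 0" "(\<Union>x\<in>cball (0::complex) 1. ball x e) \<subseteq> U"
    using compact_subset_open_imp_ball_epsilon_subset[OF compact_cball assms] .
  have "ball 0 (1 + e) \<subseteq> (\<Union>x\<in>cball (0::complex) 1. ball x e)"
  proof
    fix z :: complex assume z: "z \<in> ball 0 (1 + e)"
    show "z \<in> (\<Union>x\<in>cball (0::complex) 1. ball x e)"
    proof (cases "cmod z \<le> 1")
      case True thus ?thesis using e by (intro UN_I[of z]) auto
    next
      \<comment> \<open>The nearest point of the closed disc is \<open>sgn z\<close>, at distance
        |z| - 1.\<close>
      case False
      have e: "of_real (cmod z) * sgn z = z" using False by (auto simp: sgn_eq)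
      have "of_real (1 - cmod z) * sgn z = sgn z - of_real (cmod z) * sgn z" by (simp add: algebra_simps)
      hence "dist (sgn z) z = cmod (of_real (1 - cmod z) * sgn z)"
        unfolding e dist_norm by (rule arg_cong[where f=cmod, symmetric])
      also have "\<dots> = cmod z - 1"
        unfolding norm_mult norm_of_real using False by (auto simp: norm_sgn)
      also have "\<dots> < e" using z by simp
      finally show ?thesis using False by (intro UN_I[of "sgn z"]) (auto simp: norm_sgn)
    qed
  qed
  thus ?thesis using that[of "1 + e"] e by auto
qed

text \<open>A change of variables on the circle, carried out through coefficients. The automorphism
  \<phi> is an involution, so G (cis t) is the power series of G \<circ> \<phi> evaluated at \<phi>
  (cis t); the powers of \<phi> are orthogonal for the Poisson kernel of a because the Poisson
  integral of \<phi>^n is \<phi> a ^ n = 0. The constant coefficient is G a, which is why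
  subtracting G a is harmless later.\<close>

lemma mobius_parseval:
  assumes hol: "G holomorphic_on ball 0 R" and R: "1 < R" and a: "cmod a < 1"
  obtains c :: "nat \<Rightarrow> complex" where
    "\<And>z. cmod z < 1 \<Longrightarrow> (\<lambda>n. c n * z ^ n) sums G (mobius a z)"
    "((\<lambda>t. (cmod (G (cis t)))\<^sup>2 * pker a t) has_integral (2 * pi * (\<Sum>n. (cmod (c n))\<^sup>2))) {0..2*pi}"
    "summable (\<lambda>n. (cmod (c n))\<^sup>2)" "c 0 = G a"
proof -
  \<comment> \<open>The first condition keeps z away from the pole of the automorphism, the second
    says that its value lies in the disc of radius R; both are open and hold on the closed unit
    disc.\<close>
  define U where "U = {z. cmod (cnj a * z) < 1} \<inter> {z. cmod (a - z) < R * cmod (1 - cnj a * z)}"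
  have "open U" unfolding U_def by (intro open_Int open_Collect_less continuous_intros)
  have nzU: "1 - cnj a * z \<noteq> 0" if "z \<in> U" for z
  proof
    assume "1 - cnj a * z = 0"
    hence "cmod (cnj a * z) = 1" by simp
    thus False using that unfolding U_def by simp
  qed
  have mU: "cmod (mobius a z) < R" if "z \<in> U" for z
    using that nzU[OF that] unfolding U_def mobius_def by (simp add: norm_divide divide_less_eq)
  have le1: "cmod (mobius a z) \<le> 1" if "cmod z \<le> 1" for z
  proof (cases "cmod z = 1")
    case True
    hence "z \<noteq> 0" by auto
    hence "cis (Arg z) = z" using True cis_Arg[of z] by (simp add: sgn_eq)
    thus ?thesis using norm_mobius_cis[OF a, of "Arg z"] by (simp only: order_refl)
  next
    case False thus ?thesis using norm_mobius_less_1[OF a, of z] that by simp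
  qed
  have "cball 0 1 \<subseteq> U"
  proof
    fix z :: complex assume "z \<in> cball 0 1"
    hence z: "cmod z \<le> 1" by simp
    have "cmod a * cmod z \<le> cmod a * 1" using z by (intro mult_left_mono) auto
    hence 1: "cmod (cnj a * z) < 1" using a by (simp add: norm_mult)
    have nz: "1 - cnj a * z \<noteq> 0" using one_minus_cnj_mult_nonzero[OF a z] .
    have "cmod (mobius a z) < R" using le1[OF z] R by simp
    hence "cmod (a - z) < R * cmod (1 - cnj a * z)"
      using nz unfolding mobius_def by (simp add: norm_divide divide_less_eq)
    thus "z \<in> U" using 1 unfolding U_def by simp
  qed
  then obtain R' where R': "1 < R'" "ball 0 R' \<subseteq> U" using disc_in_open[OF \<open>open U\<close>] by blast
  have holm: "mobius a holomorphic_on ball 0 R'"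
    by (rule mobius_holomorphic[OF a]) (use nzU R' in auto)
  have "(G \<circ> mobius a) holomorphic_on ball 0 R'"
    by (rule holomorphic_on_compose_gen[OF holm hol]) (use mU R' in auto)
  from holomorphic_power_series_0[OF this]
  obtain c where c: "\<And>z. cmod z < R' \<Longrightarrow> (\<lambda>n. c n * z ^ n) sums G (mobius a z)"
    unfolding o_def by metis
  have sumc: "summable (\<lambda>n. cmod (c n))"
  proof -
    define x where "x = complex_of_real ((1 + R') / 2)"
    have x: "cmod x = (1 + R') / 2" unfolding x_def norm_of_real using R' by simp
    have "summable (\<lambda>n. cmod (c n * 1 ^ n))"
      using c[of x] R' x by (intro powser_insidea[of c x]) (auto simp: sums_iff)
    thus ?thesis by simp
  qed
  have "((\<lambda>t. (cmod (\<Sum>n. c n * mobius a (cis t) ^ n))\<^sup>2 * pker a t) has_integral (2*pi * (\<Sum>n. (cmod (c n))\<^sup>2))) {0..2*pi}"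
  proof (rule parseval_weighted[OF _ _ _ _ _ sumc])
    show "continuous_on {0..2*pi} (\<lambda>t. mobius a (cis t))"
      unfolding mobius_def using one_minus_cnj_mult_nonzero[OF a] by (auto intro!: continuous_intros)
    show "continuous_on {0..2*pi} (pker a)"
      by (intro continuous_on_pker a continuous_on_id)
    show "((\<lambda>t. mobius a (cis t) ^ n * of_real (pker a t)) has_integral 0) {0..2*pi}" if "n \<ge> 1" for n
    proof -
      have "(\<lambda>z. mobius a z ^ n) holomorphic_on ball 0 R'" by (intro holomorphic_on_power holm)
      from poisson_integral[OF this R'(1) a] show ?thesis using that by (simp add: zero_power)
    qed
  qed (use norm_mobius_cis[OF a] poisson_kernel_integral[OF a] in auto)
  moreover have "(\<Sum>n. c n * mobius a (cis t) ^ n) = G (cis t)" for t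
    using c[of "mobius a (cis t)"] norm_mobius_cis[OF a, of t] R' mobius_mobius[OF a, of "cis t"]
    by (simp add: sums_iff)
  ultimately have "((\<lambda>t. (cmod (G (cis t)))\<^sup>2 * pker a t) has_integral (2 * pi * (\<Sum>n. (cmod (c n))\<^sup>2))) {0..2*pi}" by simp
  moreover have "c 0 = G a" using c[of 0] R' by (simp add: powser_sums_zero_iff)
  moreover have "(\<lambda>n. c n * z ^ n) sums G (mobius a z)" if "cmod z < 1" for z
    using c[of z] that R' by simp
  ultimately show ?thesis using summable_norm_square[OF sumc] by (intro that[of c]) auto
qed

text \<open>Composition with the automorphism multiplies both derivatives by the same factor, so the
  pointwise domination survives with the same K. Littlewood--Paley is used from below for F, at the
  cost of the factor 2, and from above for f, at no cost. Subtracting F a removes the constant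
  coefficient on the left; on the right |f a|^2 is simply added.\<close>

lemma poisson_oscillation_le:
  assumes F: "F holomorphic_on ball 0 R" and f: "f holomorphic_on ball 0 R" and R: "1 < R"
    and K: "0 \<le> K" and a: "cmod a < 1"
    and dom: "\<And>z. cmod z < 1 \<Longrightarrow> cmod (deriv F z) \<le> K * cmod (deriv f z)"
  shows "integral {0..2*pi} (\<lambda>t. (cmod (F (cis t) - F a))\<^sup>2 * pker a t)
     \<le> 2 * K\<^sup>2 * integral {0..2*pi} (\<lambda>t. (cmod (f (cis t)))\<^sup>2 * pker a t)"
proof -
  let ?h = "\<lambda>z. f (mobius a z)" and ?H = "\<lambda>z. F (mobius a z) - F a"
  obtain b where b: "\<And>z. cmod z < 1 \<Longrightarrow> (\<lambda>n. b n * z ^ n) sums f (mobius a z)"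
    "((\<lambda>t. (cmod (f (cis t)))\<^sup>2 * pker a t) has_integral (2 * pi * (\<Sum>n. (cmod (b n))\<^sup>2))) {0..2*pi}"
    "summable (\<lambda>n. (cmod (b n))\<^sup>2)" "b 0 = f a"
    by (rule mobius_parseval[OF f R a], rule that)
  have F': "(\<lambda>z. F z - F a) holomorphic_on ball 0 R" using F by (intro holomorphic_intros)
  obtain c where c: "\<And>z. cmod z < 1 \<Longrightarrow> (\<lambda>n. c n * z ^ n) sums (F (mobius a z) - F a)"
    "((\<lambda>t. (cmod (F (cis t) - F a))\<^sup>2 * pker a t) has_integral (2 * pi * (\<Sum>n. (cmod (c n))\<^sup>2))) {0..2*pi}"
    "summable (\<lambda>n. (cmod (c n))\<^sup>2)" "c 0 = F a - F a"
    by (rule mobius_parseval[OF F' R a], rule that)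
  have holm: "mobius a holomorphic_on ball 0 1"
    by (rule mobius_holomorphic[OF a]) (use one_minus_cnj_mult_nonzero[OF a] in auto)
  have mb: "mobius a z \<in> ball 0 R" if "z \<in> ball 0 1" for z
    using norm_mobius_less_1[OF a, of z] that R by simp
  have im: "mobius a ` ball 0 1 \<subseteq> ball 0 R" using mb by blast
  have holh: "?h holomorphic_on ball 0 1"
    using holomorphic_on_compose_gen[OF holm f im] by (simp only: o_def)
  have holH: "?H holomorphic_on ball 0 1"
    using holomorphic_on_compose_gen[OF holm F' im] by (simp only: o_def)
  have der: "cmod (deriv ?H z) \<le> K * cmod (deriv ?h z)" if z: "z \<in> ball 0 1" for z
  proof -
    have m: "(mobius a has_field_derivative deriv (mobius a) z) (at z)"
      using holm z by (intro holomorphic_derivI[of _ "ball 0 1"]) auto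
    have df: "(f has_field_derivative deriv f (mobius a z)) (at (mobius a z))"
      using mb[OF z] by (intro holomorphic_derivI[OF f]) auto
    have dF: "(F has_field_derivative deriv F (mobius a z)) (at (mobius a z))"
      using mb[OF z] by (intro holomorphic_derivI[OF F]) auto
    have 1: "deriv ?h z = deriv f (mobius a z) * deriv (mobius a) z"
      by (rule DERIV_imp_deriv) (rule DERIV_chain2[OF df m])
    have "(?H has_field_derivative (deriv F (mobius a z) * deriv (mobius a) z - 0)) (at z)"
      by (intro DERIV_diff DERIV_chain2[OF dF m] DERIV_const)
    hence 2: "deriv ?H z = deriv F (mobius a z) * deriv (mobius a) z"
      by (simp add: DERIV_imp_deriv)
    have "cmod (deriv F (mobius a z)) * cmod (deriv (mobius a) z) \<le> K * cmod (deriv f (mobius a z)) * cmod (deriv (mobius a) z)"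
      by (rule mult_right_mono[OF dom]) (use norm_mobius_less_1[OF a] z in auto)
    thus ?thesis unfolding 1 2 by (simp add: norm_mult mult.assoc)
  qed
  have i1: "ennreal pi * (\<Sum>n. ennreal ((cmod (c (Suc n)))\<^sup>2))
    \<le> 2 * lp_integral (ball 0 1) ?H"
    by (rule littlewood_paley_ge[OF holH c(1)])
  have "lp_integral (ball 0 1) ?H
     \<le> (\<integral>\<^sup>+z. ennreal (K\<^sup>2) * (ennreal (lp_density ?h z) * indicator (ball 0 1) z) \<partial>lborel)"
  proof (rule nn_integral_mono)
    fix z
    show "ennreal (lp_density ?H z) * indicator (ball 0 1) z
      \<le> ennreal (K\<^sup>2) * (ennreal (lp_density ?h z) * indicator (ball 0 1) z)"
    proof (cases "z \<in> ball 0 1")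
      case True
      have nn: "0 \<le> 1 - (cmod z)\<^sup>2" using True by (simp add: power_le_one)
      have "(cmod (deriv ?H z))\<^sup>2 \<le> K\<^sup>2 * (cmod (deriv ?h z))\<^sup>2"
        using power_mono[OF der[OF True], of 2] by (simp add: power_mult_distrib)
      from mult_right_mono[OF this nn] show ?thesis
        using True nn by (simp add: ennreal_mult'[symmetric] mult.assoc ennreal_leI)
    qed simp
  qed
  also have "\<dots> = ennreal (K\<^sup>2) * lp_integral (ball 0 1) ?h"
  proof (rule nn_integral_cmult)
    have "(\<lambda>z. ennreal (lp_density ?h z) * indicator (ball 0 1) z) \<in> borel_measurable borel"
      by (rule measurable_square_indicator) (auto intro!: holomorphic_on_imp_continuous_on holomorphic_deriv holh)
    thus "(\<lambda>z. ennreal (lp_density ?h z) * indicator (ball 0 1) z) \<in> borel_measurable lborel" by simp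
  qed
  finally have i2: "lp_integral (ball 0 1) ?H
     \<le> ennreal (K\<^sup>2) * lp_integral (ball 0 1) ?h" .
  have i3: "lp_integral (ball 0 1) ?h
     \<le> ennreal pi * (\<Sum>n. ennreal ((cmod (b (Suc n)))\<^sup>2))"
    by (rule littlewood_paley_le[OF holh b(1)])
  have sb: "summable (\<lambda>n. (cmod (b (Suc n)))\<^sup>2)" "summable (\<lambda>n. (cmod (c (Suc n)))\<^sup>2)"
    using b(3) c(3) summable_Suc_iff[of "\<lambda>n. (cmod (b n))\<^sup>2"] summable_Suc_iff[of "\<lambda>n. (cmod (c n))\<^sup>2"] by blast+
  have e1: "(\<Sum>n. ennreal ((cmod (b (Suc n)))\<^sup>2)) = ennreal (\<Sum>n. (cmod (b (Suc n)))\<^sup>2)"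
    by (rule suminf_ennreal_eq[OF _ summable_sums[OF sb(1)]]) simp
  have e2: "(\<Sum>n. ennreal ((cmod (c (Suc n)))\<^sup>2)) = ennreal (\<Sum>n. (cmod (c (Suc n)))\<^sup>2)"
    by (rule suminf_ennreal_eq[OF _ summable_sums[OF sb(2)]]) simp
  have nn: "0 \<le> (\<Sum>n. (cmod (b (Suc n)))\<^sup>2)" "0 \<le> (\<Sum>n. (cmod (c (Suc n)))\<^sup>2)"
    by (intro suminf_nonneg sb zero_le_power2)+
  have "ennreal (pi * (\<Sum>n. (cmod (c (Suc n)))\<^sup>2)) = ennreal pi * (\<Sum>n. ennreal ((cmod (c (Suc n)))\<^sup>2))"
    unfolding e2 by (rule ennreal_mult) (use nn in auto)
  also have "\<dots> \<le> 2 * (ennreal (K\<^sup>2) * (ennreal pi * (\<Sum>n. ennreal ((cmod (b (Suc n)))\<^sup>2))))"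
    by (rule order_trans[OF i1 mult_left_mono[OF order_trans[OF i2 mult_left_mono[OF i3]]]]) auto
  also have "\<dots> = ennreal 2 * (ennreal (K\<^sup>2) * ennreal (pi * (\<Sum>n. (cmod (b (Suc n)))\<^sup>2)))"
    unfolding e1 using ennreal_mult[of pi "\<Sum>n. (cmod (b (Suc n)))\<^sup>2"] nn by (simp only: pi_ge_zero ennreal_numeral)
  also have "\<dots> = ennreal (2 * (K\<^sup>2 * (pi * (\<Sum>n. (cmod (b (Suc n)))\<^sup>2))))"
    by (simp only: ennreal_mult' zero_le_numeral zero_le_power2 pi_ge_zero)
  finally have "ennreal (pi * (\<Sum>n. (cmod (c (Suc n)))\<^sup>2)) \<le> ennreal (2 * (K\<^sup>2 * (pi * (\<Sum>n. (cmod (b (Suc n)))\<^sup>2))))" .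
  hence "pi * (\<Sum>n. (cmod (c (Suc n)))\<^sup>2) \<le> 2 * (K\<^sup>2 * (pi * (\<Sum>n. (cmod (b (Suc n)))\<^sup>2)))"
    by (subst (asm) ennreal_le_iff) (auto intro!: mult_nonneg_nonneg suminf_nonneg sb)
  hence "(\<Sum>n. (cmod (c (Suc n)))\<^sup>2) \<le> 2 * K\<^sup>2 * (\<Sum>n. (cmod (b (Suc n)))\<^sup>2)"
    by (simp only: mult.left_commute[of _ pi] mult_le_cancel_left_pos[OF pi_gt_zero] mult.assoc)
  also have "\<dots> \<le> 2 * K\<^sup>2 * (\<Sum>n. (cmod (b n))\<^sup>2)"
    using suminf_split_head[OF b(3)] by (intro mult_left_mono) auto
  finally have "(\<Sum>n. (cmod (c n))\<^sup>2) \<le> 2 * K\<^sup>2 * (\<Sum>n. (cmod (b n))\<^sup>2)"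
    using suminf_split_head[OF c(3)] c(4) by simp
  hence "2 * pi * (\<Sum>n. (cmod (c n))\<^sup>2) \<le> 2 * pi * (2 * K\<^sup>2 * (\<Sum>n. (cmod (b n))\<^sup>2))"
    by (intro mult_left_mono) auto
  thus ?thesis unfolding integral_unique[OF b(2)] integral_unique[OF c(2)]
    by (simp only: mult.assoc mult.left_commute[of pi])
qed

section \<open>The Carleson box estimate\<close>

text \<open>A Hardy bound without suprema: A is a positive upper bound for the norm, and
  \<open>q = 0\<close> stands for the bounded functions. The means are Henstock integrals, the form
  in which the circle estimates are made.\<close>

definition hardy_le :: "real \<Rightarrow> real \<Rightarrow> (complex \<Rightarrow> complex) \<Rightarrow> bool" where
  "hardy_le q A f \<longleftrightarrow> f holomorphic_on ball 0 1 \<and> 0 < A \<and>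
     (if q = 0 then \<forall>z\<in>ball 0 1. cmod (f z) \<le> A
      else 2 < q \<and> (\<forall>r\<in>{0<..<1}. integral {0..2*pi} (\<lambda>t. cmod (f (of_real r * cis t)) powr q) \<le> 2 * pi * A powr q))"

text \<open>Above the threshold N the factor x^(2-q) is at most N^(2-q), since the exponent is
  negative; below it the first term is enough.\<close>

lemma square_le_powr:
  fixes x N q :: real
  assumes "0 \<le> x" "0 < N" "2 < q"
  shows "x\<^sup>2 \<le> N\<^sup>2 + N powr (2 - q) * x powr q"
proof (cases "x \<le> N")
  case True
  thus ?thesis using assms power_mono[of x N 2] by (simp add: add_increasing2)
next
  case False
  hence x: "0 < x" "N \<le> x" using assms by auto
  have "x\<^sup>2 = x powr (2 - q) * x powr q"
    using x by (simp flip: powr_add)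
  also have "\<dots> \<le> N powr (2 - q) * x powr q"
    using x assms by (intro mult_right_mono powr_mono2') auto
  finally show ?thesis by (simp add: add_increasing)
qed

lemma continuous_on_circle:
  assumes "continuous_on (ball 0 1) f" "0 < r" "r < 1"
  shows "continuous_on S (\<lambda>t. f (complex_of_real r * cis t))"
  by (rule continuous_on_compose2[OF assms(1)]) (use assms in \<open>auto intro!: continuous_intros simp: norm_mult\<close>)

text \<open>This plays the part of Hoelder's inequality with exponent q/2. Below the threshold the
  mass of the weight is used, above it the supremum W of the weight together with the q-th mean of
  f.\<close>

lemma hardy_le_weighted:
  assumes f: "hardy_le q A f" and r: "0 < r" "r < 1" and W: "0 < W"
    and w: "continuous_on {0..2*pi} w" "\<And>t. t \<in> {0..2*pi} \<Longrightarrow> 0 \<le> w t" "\<And>t. t \<in> {0..2*pi} \<Longrightarrow> w t \<le> W"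
      "integral {0..2*pi} w \<le> 2 * pi"
  shows "integral {0..2*pi} (\<lambda>t. (cmod (f (of_real r * cis t)))\<^sup>2 * w t) \<le> 4 * pi * A\<^sup>2 * W powr (2 / q)"
proof -
  have A: "0 < A" and hol: "f holomorphic_on ball 0 1" using f unfolding hardy_le_def by auto
  have cf: "continuous_on {0..2*pi} (\<lambda>t. f (of_real r * cis t))"
    by (intro continuous_on_circle holomorphic_on_imp_continuous_on hol r)
  have i1: "(\<lambda>t. (cmod (f (of_real r * cis t)))\<^sup>2 * w t) integrable_on {0..2*pi}"
    by (intro integrable_continuous_interval continuous_intros cf w)
  have iw: "w integrable_on {0..2*pi}" by (intro integrable_continuous_interval w)
  show ?thesis
  proof (cases "q = 0")
    case True
    have "integral {0..2*pi} (\<lambda>t. (cmod (f (of_real r * cis t)))\<^sup>2 * w t) \<le> integral {0..2*pi} (\<lambda>t. A\<^sup>2 * w t)"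
    proof (rule integral_le[OF i1])
      show "(\<lambda>t. A\<^sup>2 * w t) integrable_on {0..2*pi}" by (intro integrable_on_mult_right iw)
      fix t :: real assume t: "t \<in> {0..2*pi}"
      have "cmod (f (of_real r * cis t)) \<le> A"
        using f True r unfolding hardy_le_def by (auto simp: norm_mult)
      thus "(cmod (f (of_real r * cis t)))\<^sup>2 * w t \<le> A\<^sup>2 * w t"
        using w(2)[OF t] by (intro mult_right_mono power_mono) auto
    qed
    also have "\<dots> \<le> A\<^sup>2 * (2 * pi)" using w(4) by (simp add: mult_left_mono)
    also have "\<dots> \<le> 4 * pi * A\<^sup>2" by simp
    finally show ?thesis using True W by simp
  next
    case False
    hence q: "2 < q" and mean: "integral {0..2*pi} (\<lambda>t. cmod (f (of_real r * cis t)) powr q) \<le> 2 * pi * A powr q"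
      using f r unfolding hardy_le_def by auto
    \<comment> \<open>The threshold that balances the two parts: both N^2 * (2 \<pi>) and N^(2-q) *
      W * (2 \<pi> A^q) become 2 \<pi> A^2 W^(2/q).\<close>
    define N where "N = A * W powr (1 / q)"
    have N: "0 < N" unfolding N_def using A W by simp
    have Nq: "N powr q = A powr q * W"
      unfolding N_def using A W q by (simp add: powr_mult powr_powr)
    have N2: "N\<^sup>2 = A\<^sup>2 * W powr (2 / q)"
      unfolding N_def using W by (simp add: power_mult_distrib power2_eq_square powr_add[symmetric])
    have N2q: "N powr (2 - q) * (W * A powr q) = N\<^sup>2"
    proof -
      have "N powr (2 - q) * (W * A powr q) = N powr (2 - q) * N powr q" using Nq by (simp add: mult.commute)
      also have "\<dots> = N\<^sup>2" using N by (simp flip: powr_add)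
      finally show ?thesis .
    qed
    have ip: "(\<lambda>t. cmod (f (of_real r * cis t)) powr q) integrable_on {0..2*pi}"
      using q by (intro integrable_continuous_interval continuous_on_powr' continuous_intros cf) auto
    have "integral {0..2*pi} (\<lambda>t. (cmod (f (of_real r * cis t)))\<^sup>2 * w t)
      \<le> integral {0..2*pi} (\<lambda>t. N\<^sup>2 * w t + N powr (2 - q) * W * cmod (f (of_real r * cis t)) powr q)"
    proof (rule integral_le[OF i1])
      show "(\<lambda>t. N\<^sup>2 * w t + N powr (2 - q) * W * cmod (f (of_real r * cis t)) powr q) integrable_on {0..2*pi}"
        by (intro integrable_add integrable_on_mult_right iw ip)
      fix t :: real assume t: "t \<in> {0..2*pi}"
      have "(cmod (f (of_real r * cis t)))\<^sup>2 * w t \<le> (N\<^sup>2 + N powr (2 - q) * cmod (f (of_real r * cis t)) powr q) * w t"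
        by (intro mult_right_mono square_le_powr N q w(2)[OF t]) auto
      also have "\<dots> = N\<^sup>2 * w t + N powr (2 - q) * cmod (f (of_real r * cis t)) powr q * w t" by (simp add: algebra_simps)
      also have "\<dots> \<le> N\<^sup>2 * w t + N powr (2 - q) * cmod (f (of_real r * cis t)) powr q * W"
        by (intro add_left_mono mult_left_mono w(3)[OF t]) auto
      finally show "(cmod (f (of_real r * cis t)))\<^sup>2 * w t \<le> N\<^sup>2 * w t + N powr (2 - q) * W * cmod (f (of_real r * cis t)) powr q"
        by (simp add: mult_ac)
    qed
    also have "\<dots> = N\<^sup>2 * integral {0..2*pi} w + N powr (2 - q) * W * integral {0..2*pi} (\<lambda>t. cmod (f (of_real r * cis t)) powr q)"
      by (subst integral_add) (auto intro!: integrable_on_mult_right iw ip)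
    also have "\<dots> \<le> N\<^sup>2 * (2 * pi) + N powr (2 - q) * W * (2 * pi * A powr q)"
      using w(4) mean W by (intro add_mono mult_left_mono) auto
    also have "\<dots> = N\<^sup>2 * (2 * pi) + (2 * pi) * (N powr (2 - q) * (W * A powr q))" by simp
    also have "\<dots> = 4 * pi * A\<^sup>2 * W powr (2 / q)" unfolding N2q N2 by simp
    finally show ?thesis .
  qed
qed

text \<open>By periodicity the integral over [x, x + 2 \<pi>] has derivative zero in x. One
  antiderivative is taken on an interval that contains both periods.\<close>

lemma integral_periodic_shift:
  fixes u :: "real \<Rightarrow> real"
  assumes cont: "continuous_on UNIV u" and per: "\<And>t. u (t + 2*pi) = u t"
  shows "integral {\<alpha>..\<alpha> + 2*pi} u = integral {0..2*pi} u"
proof -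
  define lo hi where "lo = min 0 \<alpha>" and "hi = max 0 \<alpha> + 2*pi"
  have cont': "continuous_on {lo..hi} u" using cont continuous_on_subset by blast
  have "\<exists>g. \<forall>x\<in>{lo..hi}. (g has_vector_derivative u x) (at x within {lo..hi})"
    using antiderivative_continuous[OF cont'] by metis
  then obtain g where g: "\<And>x. x \<in> {lo..hi} \<Longrightarrow> (g has_vector_derivative u x) (at x within {lo..hi})" by blast
  have int: "integral {x..x+2*pi} u = g (x + 2*pi) - g x" if "lo \<le> x" "x + 2*pi \<le> hi" for x
  proof (rule integral_unique, rule fundamental_theorem_of_calculus)
    fix y assume "y \<in> {x..x+2*pi}"
    hence "(g has_vector_derivative u y) (at y within {lo..hi})" using that by (intro g) auto
    thus "(g has_vector_derivative u y) (at y within {x..x+2*pi})"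
      by (rule has_vector_derivative_within_subset) (use that in auto)
  qed simp
  define G where "G x = g (x + 2*pi) - g x" for x
  have "(G has_vector_derivative 0) (at x within {lo..hi - 2*pi})" if x: "x \<in> {lo..hi - 2*pi}" for x
  proof -
    have sub: "{lo..hi - 2*pi} \<subseteq> {lo..hi}" "x \<in> {lo..hi}" "x + 2*pi \<in> {lo..hi}"
      using x pi_gt_zero by (unfold subset_eq atLeastAtMost_iff Ball_def, linarith+)
    have 1: "(g has_vector_derivative u x) (at x within {lo..hi - 2*pi})"
      by (rule has_vector_derivative_within_subset[OF g[OF sub(2)] sub(1)])
    have sh: "((\<lambda>x. x + 2*pi) has_vector_derivative 1) (at x within {lo..hi - 2*pi})"
      by (auto intro!: derivative_eq_intros)
    have "(g has_vector_derivative u (x + 2*pi)) (at (x + 2*pi) within (\<lambda>x. x + 2*pi) ` {lo..hi - 2*pi})"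
      by (rule has_vector_derivative_within_subset[OF g[OF sub(3)]]) (use x pi_ge_zero in \<open>auto simp del: pi_ge_zero\<close>)
    from vector_diff_chain_within[OF sh this]
    have 2: "((\<lambda>x. g (x + 2*pi)) has_vector_derivative u (x + 2*pi)) (at x within {lo..hi - 2*pi})" by (simp add: o_def)
    show ?thesis unfolding G_def using has_vector_derivative_diff[OF 2 1] per[of x] by simp
  qed
  hence dG: "(G has_derivative (\<lambda>h. 0)) (at x within {lo..hi - 2*pi})" if "x \<in> {lo..hi - 2*pi}" for x
    using that by (simp add: has_vector_derivative_def)
  have "\<exists>c. \<forall>x\<in>{lo..hi - 2*pi}. G x = c"
    by (rule has_derivative_zero_constant[OF convex_real_interval(5) dG])
  moreover have "\<alpha> \<in> {lo..hi - 2*pi}" "0 \<in> {lo..hi - 2*pi}" by (simp_all add: lo_def hi_def)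
  ultimately have "G \<alpha> = G 0" by metis
  thus ?thesis using int[of \<alpha>] int[of 0] unfolding G_def by (simp add: lo_def hi_def)
qed

text \<open>Here the exponent 1 - 2/q appears: a kernel of height 2/L costs (2/L)^(2/q), and the
  length of the arc contributes the factor L.\<close>

lemma powr_scale:
  fixes q L :: real
  assumes q: "q = 0 \<or> 2 < q" and L: "0 < L"
  shows "(2 / L) powr (2 / q) * L \<le> 2 * L powr (1 - 2 / q)"
proof -
  have "0 \<le> 2 / q" "2 / q \<le> 1" using q by auto
  hence "(2::real) powr (2 / q) \<le> 2 powr 1" by (intro powr_mono) auto
  thus ?thesis using L by (simp add: powr_divide powr_diff field_simps)
qed

text \<open>From f = h * (1 - cnj a * z) follows f' = h' * (1 - cnj a * z) - cnj a * h. On S the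
  first term carries the small factor \<kappa> * L, and the second is small because 1 - |z|^2 is at
  most 2L and the annulus is thin. Both are then controlled by the sum of the squared coefficients
  of h, that is, by the mean of |f|^2 against a Poisson-type weight.\<close>

lemma carleson_estimate:
  assumes f: "hardy_le q A f" and q: "q = 0 \<or> 2 < q" and L: "0 < L" "L \<le> 1" and a: "cmod a = 1 - L" and \<kappa>: "0 \<le> \<kappa>"
    and S: "\<And>z. z \<in> S \<Longrightarrow> cmod z < 1 \<and> 1 - L \<le> cmod z \<and> cmod (1 - cnj a * z) \<le> \<kappa> * L"
  shows "lp_integral S f
    \<le> ennreal (4 * pi * (2 * \<kappa>\<^sup>2 + 8) * A\<^sup>2 * L powr (1 - 2 / q))"
proof -
  have A: "0 < A" and hol: "f holomorphic_on ball 0 1" using f unfolding hardy_le_def by auto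
  have a1: "cmod a < 1" using a L by simp
  have nz: "1 - cnj a * z \<noteq> 0" if "cmod z \<le> 1" for z using one_minus_cnj_mult_nonzero[OF a1 that] .
  define h where "h z = f z / (1 - cnj a * z)" for z
  have holh: "h holomorphic_on ball 0 1"
    unfolding h_def using nz by (intro holomorphic_intros hol) auto
  obtain b where b: "\<And>z. cmod z < 1 \<Longrightarrow> (\<lambda>n. b n * z ^ n) sums h z"
    using holomorphic_power_series_0[OF holh] by metis
  \<comment> \<open>The weighted bound with W = 2/L, divided by 2 \<pi> and by the lower bound L for
    1 - |a|^2.\<close>
  define B where "B = 2 * A\<^sup>2 * (2 / L) powr (2 / q) / L"
  have La: "L \<le> 1 - (cmod a)\<^sup>2"
    using mult_left_le[of "1 - L" "1 - L"] L unfolding a power2_eq_square by simp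
  have La2: "1 - (cmod a)\<^sup>2 \<le> 2 * L"
    unfolding a by (simp add: power2_eq_square algebra_simps)
  have coeff: "(\<Sum>n. (cmod (b n))\<^sup>2 * x ^ n) \<le> B" "summable (\<lambda>n. (cmod (b n))\<^sup>2 * x ^ n)" if x: "0 < x" "x < 1" for x
  proof -
    define r where "r = sqrt x"
    have r: "0 < r" "r < 1" "r\<^sup>2 = x" unfolding r_def using x by auto
    define w where "w t = (1 - (cmod a)\<^sup>2) / (cmod (1 - cnj a * (of_real r * cis t)))\<^sup>2" for t
    have "cmod (a * of_real r) = (1 - L) * r" using a r by (simp add: norm_mult)
    also have "\<dots> \<le> 1 - L" using L r by (simp add: mult_left_le)
    finally have ar: "cmod (a * of_real r) < 1" using L by simp
    \<comment> \<open>On the circle of radius r the weight is a multiple of the Poisson kernel of a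
      * r. The factor is at most 1, so its mass is at most 2 \<pi>.\<close>
    have w_eq: "w = (\<lambda>t. (1 - (cmod a)\<^sup>2) / (1 - (cmod (a * of_real r))\<^sup>2) * pker (a * of_real r) t)"
    proof
      fix t
      have "1 - (cmod (a * of_real r))\<^sup>2 \<noteq> 0" using ar abs_square_less_1[of "cmod (a * of_real r)"] by simp
      thus "w t = (1 - (cmod a)\<^sup>2) / (1 - (cmod (a * of_real r))\<^sup>2) * pker (a * of_real r) t"
        unfolding w_def pker_def by (simp add: mult.assoc)
    qed
    have lower: "L \<le> cmod (1 - cnj a * (of_real r * cis t))" for t
    proof -
      have "cmod (cnj a * (of_real r * cis t)) = (1 - L) * r" using a r by (simp add: norm_mult)
      also have "\<dots> \<le> 1 - L" using L r by (simp add: mult_left_le)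
      finally show ?thesis using norm_triangle_ineq2[of 1 "cnj a * (of_real r * cis t)"] by simp
    qed
    have wle: "w t \<le> 2 / L" for t
    proof -
      have "w t \<le> (2 * L) / L\<^sup>2"
        unfolding w_def using La La2 L lower[of t] by (intro frac_le power_mono) auto
      thus ?thesis using L by (simp add: power2_eq_square)
    qed
    have wnn: "0 \<le> w t" for t unfolding w_def using La L by simp
    have contw: "continuous_on {0..2*pi} w"
      unfolding w_eq by (intro continuous_intros continuous_on_pker ar)
    have "integral {0..2*pi} w = (1 - (cmod a)\<^sup>2) / (1 - (cmod (a * of_real r))\<^sup>2) * (2 * pi)"
      unfolding w_eq using integral_unique[OF poisson_kernel_integral[OF ar]] by simp
    also have "\<dots> \<le> 1 * (2 * pi)"
    proof (intro mult_right_mono)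
      have "(cmod (a * of_real r))\<^sup>2 \<le> (cmod a)\<^sup>2" using r by (intro power_mono) (auto simp: norm_mult mult_left_le)
      thus "(1 - (cmod a)\<^sup>2) / (1 - (cmod (a * of_real r))\<^sup>2) \<le> 1"
        using ar abs_square_less_1[of "cmod (a * of_real r)"] by (subst divide_le_eq_1_pos) auto
    qed auto
    finally have intw: "integral {0..2*pi} w \<le> 2 * pi" by simp
    have "integral {0..2*pi} (\<lambda>t. (cmod (f (of_real r * cis t)))\<^sup>2 * w t) \<le> 4 * pi * A\<^sup>2 * (2 / L) powr (2 / q)"
      using L by (intro hardy_le_weighted[OF f r(1,2)] contw wnn wle intw) auto
    also have "(\<lambda>t. (cmod (f (of_real r * cis t)))\<^sup>2 * w t) = (\<lambda>t. (1 - (cmod a)\<^sup>2) * (cmod (h (cis t * of_real r)))\<^sup>2)"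
      unfolding w_def h_def by (auto simp: norm_divide power_divide mult.commute)
    also have "integral {0..2*pi} (\<lambda>t. (1 - (cmod a)\<^sup>2) * (cmod (h (cis t * of_real r)))\<^sup>2)
       = (1 - (cmod a)\<^sup>2) * (2*pi * (\<Sum>n. (cmod (b n))\<^sup>2 * (cmod (of_real r))\<^sup>2 ^ n))"
      using integral_unique[OF circle_mean_square(1)[OF b, of "of_real r"]] r by simp
    finally have 1: "(1 - (cmod a)\<^sup>2) * (2*pi * (\<Sum>n. (cmod (b n))\<^sup>2 * x ^ n)) \<le> 4 * pi * A\<^sup>2 * (2 / L) powr (2 / q)"
      using r by simp
    show s: "summable (\<lambda>n. (cmod (b n))\<^sup>2 * x ^ n)"
      using circle_mean_square(2)[OF b, of "of_real r"] r by simp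
    have "L * (2*pi * (\<Sum>n. (cmod (b n))\<^sup>2 * x ^ n)) \<le> (1 - (cmod a)\<^sup>2) * (2*pi * (\<Sum>n. (cmod (b n))\<^sup>2 * x ^ n))"
      using La x by (intro mult_right_mono mult_nonneg_nonneg suminf_nonneg s) auto
    with 1 have "L * (2*pi * (\<Sum>n. (cmod (b n))\<^sup>2 * x ^ n)) \<le> 4 * pi * A\<^sup>2 * (2 / L) powr (2 / q)" by linarith
    hence "2 * pi * (L * (\<Sum>n. (cmod (b n))\<^sup>2 * x ^ n)) \<le> 2 * pi * (2 * A\<^sup>2 * (2 / L) powr (2 / q))" by (simp add: algebra_simps)
    hence "L * (\<Sum>n. (cmod (b n))\<^sup>2 * x ^ n) \<le> 2 * A\<^sup>2 * (2 / L) powr (2 / q)"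
      by (subst (asm) mult_le_cancel_left_pos) auto
    thus "(\<Sum>n. (cmod (b n))\<^sup>2 * x ^ n) \<le> B" unfolding B_def using L by (simp add: field_simps)
  qed
  have sumB: "(\<Sum>n. ennreal ((cmod (b n))\<^sup>2)) \<le> ennreal B"
    by (rule power_sum_bound(3)[OF _ coeff(2) coeff(1)]) auto
  have B0: "0 \<le> B" unfolding B_def using L by simp
  have sumB': "(\<Sum>n. ennreal ((cmod (b (Suc n)))\<^sup>2)) \<le> ennreal B"
  proof (rule order_trans[OF _ sumB])
    have "(\<Sum>n. ennreal ((cmod (b n))\<^sup>2)) = (\<Sum>n. ennreal ((cmod (b (n + 1)))\<^sup>2)) + (\<Sum>n<1. ennreal ((cmod (b n))\<^sup>2))"
      by (rule suminf_offset) (rule summableI)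
    thus "(\<Sum>n. ennreal ((cmod (b (Suc n)))\<^sup>2)) \<le> (\<Sum>n. ennreal ((cmod (b n))\<^sup>2))" by simp
  qed
  \<comment> \<open>In the variable s = |z|^2 this marks the annulus 1 - L \<le> |z|. Its length in
    s is at most 2L, which supplies the second power of L for the term without derivative.\<close>
  define v where "v s = (indicator {(1 - L)\<^sup>2..} s :: real)" for s
  have [measurable]: "v \<in> borel_measurable borel" unfolding v_def by measurable
  have LP: "lp_integral (ball 0 1) h \<le> ennreal (pi * B)"
  proof -
    have "lp_integral (ball 0 1) h
      \<le> ennreal pi * (\<Sum>n. ennreal ((cmod (b (Suc n)))\<^sup>2))"
      by (rule littlewood_paley_le[OF holh b])
    also have "\<dots> \<le> ennreal pi * ennreal B" by (rule mult_left_mono[OF sumB']) simp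
    also have "\<dots> = ennreal (pi * B)" by (simp only: ennreal_mult' pi_ge_zero)
    finally show ?thesis .
  qed
  have annulus: "(\<integral>\<^sup>+z\<in>ball 0 1. ennreal ((cmod (h z))\<^sup>2 * v ((cmod z)\<^sup>2)) \<partial>lborel) \<le> ennreal (2 * L * (pi * B))"
  proof -
    have "(\<integral>\<^sup>+z\<in>ball 0 1. ennreal ((cmod (h z))\<^sup>2 * v ((cmod z)\<^sup>2)) \<partial>lborel)
     = (\<Sum>n. ennreal (pi * (cmod (b n))\<^sup>2) * (\<integral>\<^sup>+s\<in>{0..1}. ennreal (s ^ n * v s) \<partial>lborel))"
      by (rule nn_integral_disc_square[OF b]) (auto intro: holomorphic_on_imp_continuous_on holh simp: v_def)
    also have "\<dots> \<le> (\<Sum>n. ennreal (pi * (cmod (b n))\<^sup>2) * ennreal (2 * L))"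
    proof (intro suminf_le mult_left_mono)
      fix n :: nat
      have "(\<integral>\<^sup>+s\<in>{0..1}. ennreal (s ^ n * v s) \<partial>lborel) \<le> (\<integral>\<^sup>+s. indicator {(1-L)\<^sup>2..1} s \<partial>lborel)"
        unfolding v_def by (intro nn_integral_mono) (auto simp: indicator_def power_le_one)
      also have "\<dots> = ennreal (1 - (1 - L)\<^sup>2)"
        using L by (simp add: power_le_one)
      also have "\<dots> \<le> ennreal (2 * L)" by (intro ennreal_leI) (simp add: power2_eq_square algebra_simps)
      finally show "(\<integral>\<^sup>+s\<in>{0..1}. ennreal (s ^ n * v s) \<partial>lborel) \<le> ennreal (2 * L)" .
    qed auto
    also have "\<dots> = ennreal (2 * L) * (ennreal pi * (\<Sum>n. ennreal ((cmod (b n))\<^sup>2)))"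
      unfolding ennreal_suminf_cmult[symmetric] by (intro suminf_cong) (simp add: ennreal_mult mult_ac)
    also have "\<dots> \<le> ennreal (2 * L) * (ennreal pi * ennreal B)"
      by (intro mult_left_mono sumB) auto
    also have "\<dots> = ennreal (2 * L * (pi * B))"
      using L ennreal_mult'[of "2 * L" "pi * B"] by (simp only: ennreal_mult'[OF pi_ge_zero] mult_nonneg_nonneg zero_le_numeral less_imp_le)
    finally show ?thesis .
  qed
  have [measurable]: "(\<lambda>z. ennreal ((cmod (h z))\<^sup>2 * v ((cmod z)\<^sup>2)) * indicator (ball 0 1) z) \<in> borel_measurable borel"
    by (rule measurable_square_indicator) (use holh holomorphic_on_imp_continuous_on in auto)
  have [measurable]: "(\<lambda>z. ennreal (lp_density h z) * indicator (ball 0 1) z) \<in> borel_measurable borel"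
    by (rule measurable_square_indicator) (auto intro!: holomorphic_on_imp_continuous_on holomorphic_deriv holh)
  have "lp_integral S f
    \<le> (\<integral>\<^sup>+z. ennreal (2 * \<kappa>\<^sup>2 * L\<^sup>2) * (ennreal (lp_density h z) * indicator (ball 0 1) z)
        + ennreal (4 * L) * (ennreal ((cmod (h z))\<^sup>2 * v ((cmod z)\<^sup>2)) * indicator (ball 0 1) z) \<partial>lborel)"
  proof (rule nn_integral_mono)
    fix z
    show "ennreal (lp_density f z) * indicator S z
      \<le> ennreal (2 * \<kappa>\<^sup>2 * L\<^sup>2) * (ennreal (lp_density h z) * indicator (ball 0 1) z)
        + ennreal (4 * L) * (ennreal ((cmod (h z))\<^sup>2 * v ((cmod z)\<^sup>2)) * indicator (ball 0 1) z)"
    proof (cases "z \<in> S")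
      case True
      have z: "cmod z < 1" "1 - L \<le> cmod z" "cmod (1 - cnj a * z) \<le> \<kappa> * L" using S[OF True] by auto
      have vz: "v ((cmod z)\<^sup>2) = 1" unfolding v_def using z L power_mono[of "1 - L" "cmod z" 2] by simp
      have dh: "(h has_field_derivative deriv h z) (at z)"
        using z by (intro holomorphic_derivI[OF holh]) auto
      have dd: "((\<lambda>z. h z * (1 - cnj a * z)) has_field_derivative (deriv h z * (1 - cnj a * z) - cnj a * h z)) (at z)"
        by (rule derivative_eq_intros dh refl | simp)+
      have eq: "h w * (1 - cnj a * w) = f w" if "w \<in> ball 0 1" for w
        unfolding h_def using nz[of w] that by simp
      have "(f has_field_derivative (deriv h z * (1 - cnj a * z) - cnj a * h z)) (at z)"
        by (rule has_field_derivative_transform_within_open[OF dd open_ball[of 0 1] _ eq]) (use z in auto)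
      hence df: "deriv f z = deriv h z * (1 - cnj a * z) - cnj a * h z" by (rule DERIV_imp_deriv)
      have "cmod (deriv f z) \<le> cmod (deriv h z) * (\<kappa> * L) + 1 * cmod (h z)"
        unfolding df by (rule order_trans[OF norm_triangle_ineq4])
          (use z a1 in \<open>auto simp: norm_mult intro!: add_mono mult_left_mono mult_left_le_one_le\<close>)
      hence "(cmod (deriv f z))\<^sup>2 \<le> (cmod (deriv h z) * (\<kappa> * L) + cmod (h z))\<^sup>2" by (intro power_mono) auto
      also have "\<dots> \<le> 2 * (cmod (deriv h z) * (\<kappa> * L))\<^sup>2 + 2 * (cmod (h z))\<^sup>2"
        using sum_squares_bound[of "cmod (deriv h z) * (\<kappa> * L)" "cmod (h z)"] by (simp add: power2_sum)
      finally have d2: "(cmod (deriv f z))\<^sup>2 \<le> 2 * \<kappa>\<^sup>2 * L\<^sup>2 * (cmod (deriv h z))\<^sup>2 + 2 * (cmod (h z))\<^sup>2"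
        by (simp add: power_mult_distrib mult_ac)
      have nn: "0 \<le> 1 - (cmod z)\<^sup>2" using z by (simp add: power_le_one)
      have "1 - (cmod z)\<^sup>2 = (1 - cmod z) * (1 + cmod z)" by (simp add: power2_eq_square algebra_simps)
      also have "\<dots> \<le> L * 2" using z L by (intro mult_mono) auto
      finally have u: "1 - (cmod z)\<^sup>2 \<le> 2 * L" by simp
      have "lp_density f z \<le> (2 * \<kappa>\<^sup>2 * L\<^sup>2 * (cmod (deriv h z))\<^sup>2 + 2 * (cmod (h z))\<^sup>2) * (1 - (cmod z)\<^sup>2)"
        by (rule mult_right_mono[OF d2 nn])
      also have "\<dots> = 2 * \<kappa>\<^sup>2 * L\<^sup>2 * lp_density h z + 2 * (cmod (h z))\<^sup>2 * (1 - (cmod z)\<^sup>2)"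
        by (simp add: algebra_simps)
      also have "\<dots> \<le> 2 * \<kappa>\<^sup>2 * L\<^sup>2 * lp_density h z + 2 * (cmod (h z))\<^sup>2 * (2 * L)"
        by (intro add_left_mono mult_left_mono u) auto
      also have "\<dots> = 2 * \<kappa>\<^sup>2 * L\<^sup>2 * lp_density h z + 4 * L * (cmod (h z))\<^sup>2" by simp
      finally have "ennreal (lp_density f z)
        \<le> ennreal (2 * \<kappa>\<^sup>2 * L\<^sup>2 * lp_density h z + 4 * L * (cmod (h z))\<^sup>2)" by (rule ennreal_leI)
      also have "\<dots> = ennreal (2 * \<kappa>\<^sup>2 * L\<^sup>2 * lp_density h z) + ennreal (4 * L * (cmod (h z))\<^sup>2)"
        using nn L by (intro ennreal_plus) auto
      also have "\<dots> = ennreal (2 * \<kappa>\<^sup>2 * L\<^sup>2) * ennreal (lp_density h z) + ennreal (4 * L) * ennreal ((cmod (h z))\<^sup>2)"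
        using nn L by (intro arg_cong2[where f="(+)"] ennreal_mult) auto
      finally show ?thesis using True z vz by simp
    qed simp
  qed
  also have "\<dots> = ennreal (2 * \<kappa>\<^sup>2 * L\<^sup>2) * lp_integral (ball 0 1) h
     + ennreal (4 * L) * (\<integral>\<^sup>+z\<in>ball 0 1. ennreal ((cmod (h z))\<^sup>2 * v ((cmod z)\<^sup>2)) \<partial>lborel)"
    by (subst nn_integral_add, measurable, measurable) (subst nn_integral_cmult, measurable, subst nn_integral_cmult, measurable)
  also have "\<dots> \<le> ennreal (2 * \<kappa>\<^sup>2 * L\<^sup>2) * ennreal (pi * B) + ennreal (4 * L) * ennreal (2 * L * (pi * B))"
    by (intro add_mono mult_left_mono LP annulus) auto
  also have "\<dots> = ennreal (2 * \<kappa>\<^sup>2 * L\<^sup>2 * (pi * B)) + ennreal (4 * L * (2 * L * (pi * B)))"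
    using L B0 by (intro arg_cong2[where f="(+)"] ennreal_mult[symmetric]) auto
  also have "\<dots> = ennreal (2 * \<kappa>\<^sup>2 * L\<^sup>2 * (pi * B) + 4 * L * (2 * L * (pi * B)))"
    using L B0 by (intro ennreal_plus[symmetric]) auto
  also have "\<dots> \<le> ennreal (4 * pi * (2 * \<kappa>\<^sup>2 + 8) * A\<^sup>2 * L powr (1 - 2 / q))"
  proof (rule ennreal_leI)
    have m: "(2 * A\<^sup>2 * (pi * (2 * \<kappa>\<^sup>2 + 8))) * ((2 / L) powr (2 / q) * L) \<le> (2 * A\<^sup>2 * (pi * (2 * \<kappa>\<^sup>2 + 8))) * (2 * L powr (1 - 2 / q))"
      by (intro mult_left_mono powr_scale q L) auto
    have "2 * \<kappa>\<^sup>2 * L\<^sup>2 * (pi * B) + 4 * L * (2 * L * (pi * B)) = (L * B) * L * (pi * (2 * \<kappa>\<^sup>2 + 8))"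
      by (simp add: algebra_simps power2_eq_square)
    also have "L * B = 2 * A\<^sup>2 * (2 / L) powr (2 / q)" unfolding B_def using L by simp
    also have "2 * A\<^sup>2 * (2 / L) powr (2 / q) * L * (pi * (2 * \<kappa>\<^sup>2 + 8)) = (2 * A\<^sup>2 * (pi * (2 * \<kappa>\<^sup>2 + 8))) * ((2 / L) powr (2 / q) * L)"
      by (simp only: mult_ac)
    also note m
    also have "(2 * A\<^sup>2 * (pi * (2 * \<kappa>\<^sup>2 + 8))) * (2 * L powr (1 - 2 / q)) = 4 * pi * (2 * \<kappa>\<^sup>2 + 8) * A\<^sup>2 * L powr (1 - 2 / q)"
      by simp
    finally show "2 * \<kappa>\<^sup>2 * L\<^sup>2 * (pi * B) + 4 * L * (2 * L * (pi * B)) \<le> 4 * pi * (2 * \<kappa>\<^sup>2 + 8) * A\<^sup>2 * L powr (1 - 2 / q)" .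
  qed
  finally show ?thesis .
qed

section \<open>The radial maximal inequality\<close>

text \<open>The \<open>T T\<^sup>*\<close> argument: if \<open>T T\<^sup>*\<close> is dominated by \<open>C (T + T\<^sup>*)\<close>, then any a priori bound
  on the norm of \<open>T\<close> improves itself, with fixed point \<open>2 C\<close>.\<close>

locale positive_kernel = finite_measure M for M :: "'a measure" +
  fixes k :: "'a \<Rightarrow> 'a \<Rightarrow> ennreal" and C K :: real
  assumes k_measurable [measurable]: "case_prod k \<in> borel_measurable (M \<Otimes>\<^sub>M M)"
    and C_pos: "0 < C" and K_nonneg: "0 \<le> K"
    and k_bounded: "\<And>x y. x \<in> space M \<Longrightarrow> y \<in> space M \<Longrightarrow> k x y \<le> ennreal K"
    and k_compose: "\<And>x x'. x \<in> space M \<Longrightarrow> x' \<in> space M \<Longrightarrow>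
      (\<integral>\<^sup>+y. k x y * k x' y \<partial>M) \<le> ennreal C * (k x x' + k x' x)"
begin

sublocale pair_sigma_finite M M ..

definition T :: "('a \<Rightarrow> ennreal) \<Rightarrow> 'a \<Rightarrow> ennreal" where
  "T u x = (\<integral>\<^sup>+y. k x y * u y \<partial>M)"

definition T_adj :: "('a \<Rightarrow> ennreal) \<Rightarrow> 'a \<Rightarrow> ennreal" where
  "T_adj h y = (\<integral>\<^sup>+x. k x y * h x \<partial>M)"

lemma k_measurable' [measurable]:
  assumes "f \<in> measurable N M" "g \<in> measurable N M"
  shows "(\<lambda>x. k (f x) (g x)) \<in> borel_measurable N"
  using measurable_compose[OF measurable_Pair[OF assms] k_measurable] by simp

lemma T_measurable [measurable]:
  assumes [measurable]: "u \<in> borel_measurable M" shows "T u \<in> borel_measurable M"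
  unfolding T_def by measurable

lemma T_adj_measurable [measurable]:
  assumes [measurable]: "u \<in> borel_measurable M" shows "T_adj u \<in> borel_measurable M"
  unfolding T_adj_def by measurable

lemma T_adj_duality:
  assumes [measurable]: "u \<in> borel_measurable M" "h \<in> borel_measurable M"
  shows "(\<integral>\<^sup>+x. T u x * h x \<partial>M) = (\<integral>\<^sup>+y. u y * T_adj h y \<partial>M)"
proof -
  have "(\<integral>\<^sup>+x. T u x * h x \<partial>M) = (\<integral>\<^sup>+x. \<integral>\<^sup>+y. k x y * u y * h x \<partial>M \<partial>M)"
    unfolding T_def by (intro nn_integral_cong nn_integral_multc[symmetric]) measurable
  also have "\<dots> = (\<integral>\<^sup>+y. \<integral>\<^sup>+x. k x y * u y * h x \<partial>M \<partial>M)"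
    by (rule Fubini'[symmetric]) measurable
  also have "\<dots> = (\<integral>\<^sup>+y. u y * T_adj h y \<partial>M)"
    unfolding T_adj_def
    by (intro nn_integral_cong, subst nn_integral_cmult[symmetric]) (measurable, simp add: mult_ac)
  finally show ?thesis .
qed

text \<open>The left side is the quadratic form of T composed with its adjoint. That operator has
  kernel \<open>\<integral>\<^sup>+y. k x y * k x' y \<partial>M\<close>, dominated by C times k
  plus its transpose, and both parts give the same quadratic form.\<close>

lemma T_adj_norm:
  assumes [measurable]: "h \<in> borel_measurable M"
  shows "(\<integral>\<^sup>+y. (T_adj h y)\<^sup>2 \<partial>M) \<le> ennreal (2 * C) * (\<integral>\<^sup>+x. h x * T h x \<partial>M)"
proof -
  have "(\<integral>\<^sup>+y. (T_adj h y)\<^sup>2 \<partial>M) = (\<integral>\<^sup>+y. T_adj h y * T_adj h y \<partial>M)"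
    by (simp add: power2_eq_square)
  also have "\<dots> = (\<integral>\<^sup>+x. T (T_adj h) x * h x \<partial>M)"
    by (rule T_adj_duality[symmetric]) measurable
  also have "\<dots> = (\<integral>\<^sup>+x. (\<integral>\<^sup>+x'. (\<integral>\<^sup>+y. k x y * k x' y \<partial>M) * h x' \<partial>M) * h x \<partial>M)"
  proof (intro nn_integral_cong arg_cong2[where f="(*)"] refl)
    fix x assume [measurable]: "x \<in> space M"
    have "T (T_adj h) x = (\<integral>\<^sup>+y. \<integral>\<^sup>+x'. k x y * (k x' y * h x') \<partial>M \<partial>M)"
      unfolding T_def T_adj_def by (intro nn_integral_cong nn_integral_cmult[symmetric]) measurable
    also have "\<dots> = (\<integral>\<^sup>+x'. \<integral>\<^sup>+y. k x y * (k x' y * h x') \<partial>M \<partial>M)"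
      by (rule Fubini') measurable
    also have "\<dots> = (\<integral>\<^sup>+x'. (\<integral>\<^sup>+y. k x y * k x' y \<partial>M) * h x' \<partial>M)"
      by (intro nn_integral_cong, subst nn_integral_multc[symmetric]) (measurable, simp add: mult_ac)
    finally show "T (T_adj h) x = (\<integral>\<^sup>+x'. (\<integral>\<^sup>+y. k x y * k x' y \<partial>M) * h x' \<partial>M)" .
  qed
  also have "\<dots> \<le> (\<integral>\<^sup>+x. (\<integral>\<^sup>+x'. ennreal C * (k x x' + k x' x) * h x' \<partial>M) * h x \<partial>M)"
    by (intro nn_integral_mono mult_right_mono k_compose) auto
  also have "\<dots> = (\<integral>\<^sup>+x. ennreal C * (T h x * h x + T_adj h x * h x) \<partial>M)"
  proof (intro nn_integral_cong)
    fix x assume [measurable]: "x \<in> space M"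
    have "(\<integral>\<^sup>+x'. ennreal C * (k x x' + k x' x) * h x' \<partial>M) = (\<integral>\<^sup>+x'. ennreal C * (k x x' * h x') + ennreal C * (k x' x * h x') \<partial>M)"
      by (intro nn_integral_cong) (simp add: algebra_simps)
    also have "\<dots> = ennreal C * T h x + ennreal C * T_adj h x"
      unfolding T_def T_adj_def
      by (subst nn_integral_add, measurable, measurable) (subst nn_integral_cmult, measurable, subst nn_integral_cmult, measurable)
    finally show "(\<integral>\<^sup>+x'. ennreal C * (k x x' + k x' x) * h x' \<partial>M) * h x = ennreal C * (T h x * h x + T_adj h x * h x)"
      by (simp add: algebra_simps)
  qed
  also have "\<dots> = ennreal C * ((\<integral>\<^sup>+x. T h x * h x \<partial>M) + (\<integral>\<^sup>+x. T_adj h x * h x \<partial>M))"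
    by (subst nn_integral_cmult, measurable, subst nn_integral_add) measurable
  also have "(\<integral>\<^sup>+x. T_adj h x * h x \<partial>M) = (\<integral>\<^sup>+x. T h x * h x \<partial>M)"
    using T_adj_duality[of h h] by (simp add: mult.commute)
  also have "ennreal C * ((\<integral>\<^sup>+x. T h x * h x \<partial>M) + (\<integral>\<^sup>+x. T h x * h x \<partial>M)) = ennreal (2 * C) * (\<integral>\<^sup>+x. h x * T h x \<partial>M)"
    using C_pos by (simp add: ennreal_mult mult_2[symmetric] mult_ac)
  finally show ?thesis .
qed

text \<open>The constant c bounds the square of the operator norm; the fixed point 2C of the norm
  therefore appears as 4 C^2.\<close>

definition bounded_by :: "real \<Rightarrow> bool" where
  "bounded_by c \<longleftrightarrow> (\<forall>u\<in>borel_measurable M. (\<integral>\<^sup>+x. (T u x)\<^sup>2 \<partial>M) \<le> ennreal c * (\<integral>\<^sup>+x. (u x)\<^sup>2 \<partial>M))"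

text \<open>Boundedness of the kernel on a finite measure space and Cauchy--Schwarz. The value
  depends on K and is useless as an estimate; its finiteness is what starts the improvement. The
  summand 1 makes it positive.\<close>

lemma bounded_by_apriori: "\<exists>c>0. bounded_by c"
proof (intro exI conjI)
  define m where "m = measure M (space M)"
  have m: "emeasure M (space M) = ennreal m" "0 \<le> m" unfolding m_def by (auto simp: emeasure_eq_measure)
  show "0 < K\<^sup>2 * m\<^sup>2 + 1" by (simp add: add_nonneg_pos)
  show "bounded_by (K\<^sup>2 * m\<^sup>2 + 1)"
    unfolding bounded_by_def
  proof
    fix u :: "'a \<Rightarrow> ennreal" assume [measurable]: "u \<in> borel_measurable M"
    have "(\<integral>\<^sup>+x. (T u x)\<^sup>2 \<partial>M) \<le> (\<integral>\<^sup>+x. ennreal (K\<^sup>2) * (ennreal m * (\<integral>\<^sup>+y. (u y)\<^sup>2 \<partial>M)) \<partial>M)"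
    proof (intro nn_integral_mono)
      fix x assume x: "x \<in> space M"
      have "T u x \<le> (\<integral>\<^sup>+y. ennreal K * u y \<partial>M)"
        unfolding T_def using k_bounded[OF x] by (intro nn_integral_mono mult_right_mono) auto
      also have "\<dots> = ennreal K * (\<integral>\<^sup>+y. 1 * u y \<partial>M)" by (simp add: nn_integral_cmult)
      finally have "(T u x)\<^sup>2 \<le> (ennreal K * (\<integral>\<^sup>+y. 1 * u y \<partial>M))\<^sup>2" by (intro power_mono) auto
      also have "\<dots> = ennreal (K\<^sup>2) * (\<integral>\<^sup>+y. 1 * u y \<partial>M)\<^sup>2"
        using K_nonneg by (simp add: power_mult_distrib ennreal_power)
      also have "\<dots> \<le> ennreal (K\<^sup>2) * ((\<integral>\<^sup>+y. 1\<^sup>2 \<partial>M) * (\<integral>\<^sup>+y. (u y)\<^sup>2 \<partial>M))"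
        by (intro mult_left_mono Cauchy_Schwarz_nn_integral) auto
      finally show "(T u x)\<^sup>2 \<le> ennreal (K\<^sup>2) * (ennreal m * (\<integral>\<^sup>+y. (u y)\<^sup>2 \<partial>M))"
        by (simp add: m)
    qed
    also have "\<dots> = ennreal (K\<^sup>2) * (ennreal m * (\<integral>\<^sup>+y. (u y)\<^sup>2 \<partial>M)) * ennreal m"
      by (simp add: m)
    also have "\<dots> = ennreal (K\<^sup>2 * m\<^sup>2) * (\<integral>\<^sup>+y. (u y)\<^sup>2 \<partial>M)"
    proof -
      have "ennreal (m\<^sup>2) = ennreal m * ennreal m" using m(2) by (simp add: power2_eq_square ennreal_mult)
      moreover have "ennreal (K\<^sup>2 * m\<^sup>2) = ennreal (K\<^sup>2) * ennreal (m\<^sup>2)" by (rule ennreal_mult) auto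
      ultimately show ?thesis by (simp only: mult_ac)
    qed
    also have "\<dots> \<le> ennreal (K\<^sup>2 * m\<^sup>2 + 1) * (\<integral>\<^sup>+y. (u y)\<^sup>2 \<partial>M)"
      by (intro mult_right_mono ennreal_leI) auto
    finally show "(\<integral>\<^sup>+x. (T u x)\<^sup>2 \<partial>M) \<le> ennreal (K\<^sup>2 * m\<^sup>2 + 1) * (\<integral>\<^sup>+y. (u y)\<^sup>2 \<partial>M)" .
  qed
qed

text \<open>With n the squared norm of T u and U that of u: n is the pairing of u with
  \<open>T_adj (T u)\<close>, so n^2 is at most U times the squared norm of
  \<open>T_adj (T u)\<close>, which is at most 2C times the pairing X of T u with T (T u). The old
  bound gives X \<le> sqrt c * n. One factor n cancels.\<close>

lemma bounded_by_improve:
  assumes c: "0 < c" "bounded_by c"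
  shows "bounded_by (2 * C * sqrt c)"
  unfolding bounded_by_def
proof
  fix u :: "'a \<Rightarrow> ennreal" assume [measurable]: "u \<in> borel_measurable M"
  define U where "U = (\<integral>\<^sup>+x. (u x)\<^sup>2 \<partial>M)"
  define n where "n = (\<integral>\<^sup>+x. (T u x)\<^sup>2 \<partial>M)"
  define X where "X = (\<integral>\<^sup>+x. T u x * T (T u) x \<partial>M)"
  have "n \<le> ennreal (2 * C * sqrt c) * U"
  proof (cases "U = \<infinity>")
    case True
    thus ?thesis using C_pos c by (simp add: ennreal_mult_top)
  next
    case False
    then obtain U' where U': "U = ennreal U'" "0 \<le> U'" by (cases U) auto
    \<comment> \<open>Finiteness of n, without which the final cancellation would be
      illegal.\<close>
    have "n \<le> ennreal c * U" using c(2) unfolding bounded_by_def n_def U_def by auto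
    hence "n < \<infinity>" using U' by (simp add: ennreal_mult_less_top le_less_trans)
    then obtain n' where n': "n = ennreal n'" "0 \<le> n'" by (cases n) auto
    have "X\<^sup>2 \<le> n * (\<integral>\<^sup>+x. (T (T u) x)\<^sup>2 \<partial>M)"
      unfolding X_def n_def by (rule Cauchy_Schwarz_nn_integral) measurable
    also have "\<dots> \<le> n * (ennreal c * n)"
      using c(2) unfolding bounded_by_def n_def by (intro mult_left_mono) auto
    also have "\<dots> = ennreal (c * n'\<^sup>2)"
      unfolding n' using c n' by (simp add: ennreal_mult[symmetric] power2_eq_square mult_ac)
    finally have X2: "X\<^sup>2 \<le> ennreal (c * n'\<^sup>2)" .
    have "X < \<infinity>"
    proof (rule ccontr)
      assume "\<not> X < \<infinity>"
      hence "X = top" by (metis infinity_ennreal_def less_top)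
      thus False using X2 by (simp add: top_unique power2_eq_square)
    qed
    then obtain X' where X': "X = ennreal X'" "0 \<le> X'" by (cases X) auto
    have "X'\<^sup>2 \<le> c * n'\<^sup>2"
      using X2 unfolding X' using X'(2) c by (simp add: ennreal_power)
    also have "\<dots> = (sqrt c * n')\<^sup>2" using c by (simp add: power_mult_distrib)
    finally have X'le: "X' \<le> sqrt c * n'" by (rule power2_le_imp_le) (use c n' in auto)
    have "n = (\<integral>\<^sup>+x. T u x * T u x \<partial>M)" unfolding n_def by (simp add: power2_eq_square)
    also have "\<dots> = (\<integral>\<^sup>+y. u y * T_adj (T u) y \<partial>M)" by (rule T_adj_duality) measurable
    finally have "n\<^sup>2 \<le> U * (\<integral>\<^sup>+y. (T_adj (T u) y)\<^sup>2 \<partial>M)"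
      unfolding U_def using Cauchy_Schwarz_nn_integral[of u M "T_adj (T u)"] by simp
    also have "\<dots> \<le> U * (ennreal (2 * C) * X)"
      unfolding X_def by (intro mult_left_mono T_adj_norm) auto
    also have "\<dots> = ennreal (U' * (2 * C * X'))"
      unfolding U' X' using U' X' C_pos by (simp add: ennreal_mult)
    finally have "n'\<^sup>2 \<le> U' * (2 * C * X')"
      unfolding n' using n' U' X' C_pos by (simp add: ennreal_power)
    also have "\<dots> \<le> U' * (2 * C * (sqrt c * n'))"
      using X'le U' C_pos by (intro mult_left_mono) auto
    finally have "n' * n' \<le> (2 * C * sqrt c * U') * n'" by (simp add: power2_eq_square mult_ac)
    hence "n' \<le> 2 * C * sqrt c * U'"
      using n'(2) C_pos c U' by (cases "n' = 0") (auto simp: mult_le_cancel_right)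
    thus ?thesis unfolding n' U' using C_pos c U' by (simp add: ennreal_mult[symmetric] ennreal_leI)
  qed
  thus "(\<integral>\<^sup>+x. (T u x)\<^sup>2 \<partial>M) \<le> ennreal (2 * C * sqrt c) * (\<integral>\<^sup>+x. (u x)\<^sup>2 \<partial>M)"
    unfolding n_def U_def .
qed

text \<open>Let c0 be the infimum of the admissible constants. Improving any admissible c gives c0
  \<le> 2C sqrt c, hence c0^2 \<le> 4 C^2 c0. The summand 1 leaves room to pick an admissible
  constant without attaining the infimum.\<close>

lemma bounded_by_kernel: "bounded_by (4 * C\<^sup>2 + 1)"
proof -
  define S where "S = {c. 0 < c \<and> bounded_by c}"
  have ne: "S \<noteq> {}" using bounded_by_apriori unfolding S_def by auto
  have bdd: "bdd_below S" unfolding S_def by (rule bdd_belowI[of _ 0]) auto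
  define c0 where "c0 = Inf S"
  have c0: "0 \<le> c0" unfolding c0_def by (rule cInf_greatest[OF ne]) (auto simp: S_def)
  have "c0\<^sup>2 \<le> 4 * C\<^sup>2 * c" if "c \<in> S" for c
  proof -
    have c: "0 < c" "bounded_by c" using that by (auto simp: S_def)
    have "2 * C * sqrt c \<in> S" unfolding S_def using bounded_by_improve[OF c] C_pos c by auto
    hence "c0 \<le> 2 * C * sqrt c" unfolding c0_def by (rule cInf_lower[OF _ bdd])
    hence "c0\<^sup>2 \<le> (2 * C * sqrt c)\<^sup>2" using c0 by (intro power_mono) auto
    thus ?thesis using c by (simp add: power_mult_distrib)
  qed
  hence "c0\<^sup>2 / (4 * C\<^sup>2) \<le> c0"
    unfolding c0_def[symmetric] using C_pos unfolding c0_def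
    by (intro cInf_greatest[OF ne]) (simp add: field_simps c0_def)
  hence "c0 * c0 \<le> 4 * C\<^sup>2 * c0" using C_pos by (simp add: field_simps power2_eq_square)
  hence "c0 \<le> 4 * C\<^sup>2" using c0 by (cases "c0 = 0") (auto simp: mult_le_cancel_right)
  hence "Inf S < 4 * C\<^sup>2 + 1" unfolding c0_def by linarith
  then obtain c where c: "c \<in> S" "c < 4 * C\<^sup>2 + 1" using cInf_lessD[OF ne] by blast
  show ?thesis
    unfolding bounded_by_def
  proof
    fix u :: "'a \<Rightarrow> ennreal" assume u: "u \<in> borel_measurable M"
    have "(\<integral>\<^sup>+x. (T u x)\<^sup>2 \<partial>M) \<le> ennreal c * (\<integral>\<^sup>+x. (u x)\<^sup>2 \<partial>M)"
      using c(1) u unfolding S_def bounded_by_def by auto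
    also have "\<dots> \<le> ennreal (4 * C\<^sup>2 + 1) * (\<integral>\<^sup>+x. (u x)\<^sup>2 \<partial>M)"
      using c(2) by (intro mult_right_mono ennreal_leI) auto
    finally show "(\<integral>\<^sup>+x. (T u x)\<^sup>2 \<partial>M) \<le> ennreal (4 * C\<^sup>2 + 1) * (\<integral>\<^sup>+x. (u x)\<^sup>2 \<partial>M)" .
  qed
qed

end

section \<open>The Poisson kernel with a radius depending on the point\<close>

lemma norm_one_minus_rotate: "cmod (1 - cnj (of_real r * cis x) * cis y) = cmod (1 - of_real r * cis (y - x))"
proof -
  have "cnj (of_real r * cis x) * cis y = of_real r * cis (y - x)"
    by (simp add: cis_cnj cis_mult mult.assoc)
  thus ?thesis by (simp only:)
qed

lemma pker_swap: "pker (of_real r * cis x) y = pker (of_real r * cis y) x"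
proof -
  have "cmod (1 - of_real r * cis (y - x)) = cmod (cnj (1 - of_real r * cis (y - x)))" by (simp only: complex_mod_cnj)
  also have "cnj (1 - of_real r * cis (y - x)) = 1 - of_real r * cis (x - y)" by (simp add: cis_cnj)
  finally show ?thesis unfolding pker_def norm_one_minus_rotate by (simp add: norm_mult)
qed

lemma pker_bound:
  assumes "0 \<le> r" "r < 1" shows "pker (of_real r * cis x) y \<le> 1 / (1 - r)\<^sup>2"
proof -
  have "1 - r \<le> cmod (1 - of_real r * cis (y - x))"
    using norm_triangle_ineq2[of 1 "of_real r * cis (y - x)"] assms by (simp add: norm_mult)
  hence "(1 - r)\<^sup>2 \<le> (cmod (1 - of_real r * cis (y - x)))\<^sup>2" using assms by (intro power_mono) auto
  thus ?thesis unfolding pker_def norm_one_minus_rotate using assms by (intro frac_le) auto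
qed

text \<open>The second kernel is the boundary value of the real part of G w = (1 + s cis (-x') w) /
  (1 - s cis (-x') w), which is holomorphic beyond the closed disc. Integrating it against the first
  kernel evaluates that real part at r * cis x, where it is the kernel with radius r * s.\<close>

lemma pker_semigroup:
  assumes r: "0 < r" "r < 1" and s: "0 < s" "s < 1"
  shows "((\<lambda>y. pker (of_real r * cis x) y * pker (of_real s * cis x') y)
     has_integral (2 * pi * pker (of_real (r * s) * cis x) x')) {0..2*pi}"
proof -
  define G where "G w = (1 + of_real s * cis (-x') * w) / (1 - of_real s * cis (-x') * w)" for w
  have nz: "1 - of_real s * cis (-x') * w \<noteq> 0" if "cmod w < 1 / s" for w
  proof
    assume "1 - of_real s * cis (-x') * w = 0"
    hence "of_real s * cis (-x') * w = 1" by simp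
    hence "cmod (of_real s * cis (-x') * w) = 1" by (simp only: norm_one)
    hence "s * cmod w = 1" using s by (simp add: norm_mult)
    thus False using that s by (simp add: field_simps)
  qed
  have ReG: "Re (G (of_real \<rho> * cis \<theta>)) = pker (of_real (\<rho> * s) * cis \<theta>) x'" if "0 \<le> \<rho>" "\<rho> \<le> 1" for \<rho> \<theta>
  proof -
    define v where "v = of_real (\<rho> * s) * cis (\<theta> - x')"
    have v: "of_real s * cis (-x') * (of_real \<rho> * cis \<theta>) = v"
      unfolding v_def by (simp add: cis_mult algebra_simps)
    have "Re ((1 + v) / (1 - v)) = (1 - (cmod v)\<^sup>2) / (cmod (1 - v))\<^sup>2"
      unfolding Re_divide cmod_power2 by (simp add: power2_eq_square algebra_simps)
    moreover have "cmod v = cmod (of_real (\<rho> * s) * cis x')" unfolding v_def by (simp add: norm_mult)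
    ultimately have "Re ((1 + v) / (1 - v)) = pker (of_real (\<rho> * s) * cis x') \<theta>"
      unfolding pker_def norm_one_minus_rotate v_def by simp
    thus ?thesis unfolding G_def v pker_swap[of "\<rho> * s" \<theta> x'] .
  qed
  have "G holomorphic_on ball 0 (1 / s)"
    unfolding G_def using nz by (intro holomorphic_intros) auto
  hence int: "((\<lambda>t. G (cis t) * of_real (pker (of_real r * cis x) t)) has_integral (2 * of_real pi * G (of_real r * cis x))) {0..2*pi}"
    by (rule poisson_integral) (use r s in \<open>auto simp: norm_mult\<close>)
  have "((\<lambda>t. Re (G (cis t)) * pker (of_real r * cis x) t) has_integral (2 * pi * Re (G (of_real r * cis x)))) {0..2*pi}"
  proof -
    have "Re (2 * of_real pi * z) = 2 * pi * Re z" for z by simp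
    thus ?thesis
      using has_integral_linear[OF int bounded_linear_Re] by (simp only: o_def Re_mult_real)
  qed
  moreover have "Re (G (cis t)) = pker (of_real s * cis x') t" for t
    using ReG[of 1 t] pker_swap[of s t x'] by simp
  ultimately show ?thesis
    using ReG[of r x] r by (simp add: mult.commute)
qed

text \<open>The kernel of the smaller radius alone dominates. For r \<le> s the product satisfies
  r^2 \<le> r * s \<le> r, so the numerators compare within a factor 2; the denominators before
  squaring also compare within a factor 2, which gives 2 * 4 = 8.\<close>

lemma pker_product_le:
  assumes r: "0 < r" "r < 1" and s: "0 < s" "s < 1"
  shows "pker (of_real (r * s) * cis x) y \<le> 8 * (pker (of_real r * cis x) y + pker (of_real s * cis x) y)"
proof -
  have main: "pker (of_real (r * s) * cis x) y \<le> 8 * pker (of_real r * cis x) y"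
    if r: "0 < r" "r < 1" and s: "s < 1" and rs: "r \<le> s" for r s :: real
  proof -
    define D where "D = cmod (1 - of_real r * cis (y - x))"
    define E where "E = cmod (1 - of_real (r * s) * cis (y - x))"
    have rs1: "r * s < r" using r s by simp
    have Dpos: "1 - r \<le> D"
      unfolding D_def using norm_triangle_ineq2[of 1 "of_real r * cis (y - x)"] r by (simp add: norm_mult)
    have Epos: "1 - r * s \<le> E"
      unfolding E_def using norm_triangle_ineq2[of 1 "of_real (r * s) * cis (y - x)"] r rs by (simp add: norm_mult)
    have "D \<le> E + r * (1 - s)"
    proof -
      have e: "1 - of_real r * cis (y - x) = (1 - of_real (r * s) * cis (y - x)) - of_real (r * (1 - s)) * cis (y - x)"
        by (simp add: algebra_simps)
      have "D \<le> E + cmod (of_real (r * (1 - s)) * cis (y - x))"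
        unfolding D_def E_def e by (rule norm_triangle_ineq4)
      also have "cmod (of_real (r * (1 - s)) * cis (y - x)) = r * (1 - s)"
        unfolding norm_mult norm_of_real norm_cis using r s by simp
      finally show ?thesis .
    qed
    also have "r * (1 - s) \<le> 1 - r * s" using r by (simp add: algebra_simps)
    finally have DE: "D \<le> 2 * E" using Epos by simp
    have D0: "0 < D" using Dpos r by simp
    have "r\<^sup>2 \<le> r * s" using r rs by (simp add: power2_eq_square)
    hence "(r\<^sup>2)\<^sup>2 \<le> (r * s)\<^sup>2" using r by (intro power_mono) auto
    hence "1 - (r * s)\<^sup>2 \<le> (1 - r\<^sup>2) * (1 + r\<^sup>2)" by (simp add: algebra_simps power2_eq_square)
    also have "\<dots> \<le> (1 - r\<^sup>2) * 2" using r by (intro mult_left_mono) (auto simp: power_le_one)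
    finally have num: "1 - (r * s)\<^sup>2 \<le> 2 * (1 - r\<^sup>2)" by simp
    have "D\<^sup>2 \<le> (2 * E)\<^sup>2" using DE D0 by (intro power_mono) auto
    hence den: "D\<^sup>2 / 4 \<le> E\<^sup>2" by (simp add: power_mult_distrib)
    have "(1 - (r * s)\<^sup>2) / E\<^sup>2 \<le> (2 * (1 - r\<^sup>2)) / (D\<^sup>2 / 4)"
      using num den D0 r by (intro frac_le) (auto simp: power_le_one)
    also have "\<dots> = 8 * ((1 - r\<^sup>2) / D\<^sup>2)" by simp
    finally show ?thesis
      unfolding pker_def norm_one_minus_rotate D_def E_def by (simp add: norm_mult power_mult_distrib)
  qed
  have nn: "0 \<le> pker (of_real r * cis x) y" "0 \<le> pker (of_real s * cis x) y"
    using r s by (auto intro!: pker_nonneg simp: norm_mult)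
  show ?thesis
  proof (cases "r \<le> s")
    case True
    thus ?thesis using main[OF r s(2) True] nn by (simp add: algebra_simps)
  next
    case False
    thus ?thesis using main[OF s r(2)] nn by (simp add: algebra_simps)
  qed
qed

lemma measurable_cnj [measurable]: "cnj \<in> borel_measurable borel"
  by (intro borel_measurable_continuous_onI continuous_intros)

lemma measurable_pker [measurable]:
  assumes [measurable]: "f \<in> borel_measurable M" "g \<in> borel_measurable M"
  shows "(\<lambda>x. pker (f x) (g x)) \<in> borel_measurable M"
  unfolding pker_def by measurable

text \<open>The radius may vary with x, so this is the linearised radial maximal operator. The
  semigroup law turns the composition with the adjoint into a kernel of radius \<rho> x * \<rho> x',
  which the product estimate splits into the two original kernels. The bound R < 1 enters only the a
  priori constant; the decisive constant 8 is uniform.\<close>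

lemma poisson_positive_kernel:
  assumes \<rho>: "\<rho> \<in> borel_measurable borel" and R: "R < 1" and \<rho>R: "\<And>x. 0 < \<rho> x \<and> \<rho> x \<le> R"
  shows "positive_kernel (restrict_space lborel {0..2*pi})
     (\<lambda>x y. ennreal (pker (of_real (\<rho> x) * cis x) y / (2*pi))) 8 (1 / (1 - R)\<^sup>2)"
proof (intro positive_kernel.intro positive_kernel_axioms.intro finite_measureI)
  let ?M = "restrict_space lborel {0..2*pi} :: real measure"
  have \<rho>1: "0 < \<rho> x" "\<rho> x < 1" for x using \<rho>R[of x] R by auto
  note \<rho>[measurable]
  show "emeasure ?M (space ?M) \<noteq> \<infinity>"
    by (simp add: space_restrict_space emeasure_restrict_space)
  have idm: "(\<lambda>x. x) \<in> borel_measurable ?M"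
    by (rule measurable_restrict_space1) simp
  have [measurable]: "fst \<in> borel_measurable (?M \<Otimes>\<^sub>M ?M)" "snd \<in> borel_measurable (?M \<Otimes>\<^sub>M ?M)"
    using measurable_compose[OF measurable_fst[of ?M ?M] idm] measurable_compose[OF measurable_snd[of ?M ?M] idm] by simp_all
  show "(\<lambda>(x, y). ennreal (pker (of_real (\<rho> x) * cis x) y / (2*pi))) \<in> borel_measurable (?M \<Otimes>\<^sub>M ?M)"
    unfolding case_prod_beta by measurable
  show "ennreal (pker (of_real (\<rho> x) * cis x) y / (2*pi)) \<le> ennreal (1 / (1 - R)\<^sup>2)" for x y
  proof (rule ennreal_leI)
    have nn: "0 \<le> pker (of_real (\<rho> x) * cis x) y"
      using \<rho>1[of x] by (auto intro!: pker_nonneg simp: norm_mult)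
    have "pker (of_real (\<rho> x) * cis x) y / (2*pi) \<le> pker (of_real (\<rho> x) * cis x) y / 1"
      using pi_ge_two nn by (intro divide_left_mono) auto
    also have "\<dots> \<le> 1 / (1 - \<rho> x)\<^sup>2" using pker_bound[of "\<rho> x" x y] \<rho>1[of x] by simp
    also have "\<dots> \<le> 1 / (1 - R)\<^sup>2" using \<rho>R[of x] R by (intro divide_left_mono power_mono mult_pos_pos) auto
    finally show "pker (of_real (\<rho> x) * cis x) y / (2*pi) \<le> 1 / (1 - R)\<^sup>2" .
  qed
  show "(\<integral>\<^sup>+y. ennreal (pker (of_real (\<rho> x) * cis x) y / (2*pi)) * ennreal (pker (of_real (\<rho> x') * cis x') y / (2*pi)) \<partial>?M)
     \<le> ennreal 8 * (ennreal (pker (of_real (\<rho> x) * cis x) x' / (2*pi)) + ennreal (pker (of_real (\<rho> x') * cis x') x / (2*pi)))" for x x'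
  proof -
    have nn: "0 \<le> pker (of_real (\<rho> x) * cis x) y" for x y
      using \<rho>1[of x] by (auto intro!: pker_nonneg simp: norm_mult)
    have n1: "cmod (of_real (\<rho> x) * cis x) < 1" for x using \<rho>1[of x] by (simp add: norm_mult)
    have "(\<integral>\<^sup>+y. ennreal (pker (of_real (\<rho> x) * cis x) y / (2*pi)) * ennreal (pker (of_real (\<rho> x') * cis x') y / (2*pi)) \<partial>?M)
      = (\<integral>\<^sup>+y\<in>{0..2*pi}. ennreal (pker (of_real (\<rho> x) * cis x) y * pker (of_real (\<rho> x') * cis x') y / (4*pi\<^sup>2)) \<partial>lborel)"
      by (subst nn_integral_restrict_space)
         (auto simp: nn ennreal_mult[symmetric] power2_eq_square intro!: nn_integral_cong)
    also have "\<dots> = ennreal (2 * pi * pker (of_real (\<rho> x * \<rho> x') * cis x) x' / (4*pi\<^sup>2))"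
    proof (rule set_nn_integral_has_integral)
      show "continuous_on {0..2*pi} (\<lambda>y. pker (of_real (\<rho> x) * cis x) y * pker (of_real (\<rho> x') * cis x') y / (4*pi\<^sup>2))"
        by (intro continuous_intros continuous_on_pker n1) auto
      show "0 \<le> pker (of_real (\<rho> x) * cis x) y * pker (of_real (\<rho> x') * cis x') y / (4*pi\<^sup>2)" for y
        by (intro divide_nonneg_nonneg mult_nonneg_nonneg nn) auto
      show "((\<lambda>y. pker (of_real (\<rho> x) * cis x) y * pker (of_real (\<rho> x') * cis x') y / (4*pi\<^sup>2))
          has_integral (2 * pi * pker (of_real (\<rho> x * \<rho> x') * cis x) x' / (4*pi\<^sup>2))) {0..2*pi}"
        by (intro has_integral_divide pker_semigroup \<rho>1)
    qed
    also have "\<dots> \<le> ennreal (8 * (pker (of_real (\<rho> x) * cis x) x' / (2*pi) + pker (of_real (\<rho> x') * cis x') x / (2*pi)))"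
    proof (rule ennreal_leI)
      have "pker (of_real (\<rho> x * \<rho> x') * cis x) x' \<le> 8 * (pker (of_real (\<rho> x) * cis x) x' + pker (of_real (\<rho> x') * cis x) x')"
        by (rule pker_product_le) (use \<rho>1 in auto)
      also have "pker (of_real (\<rho> x') * cis x) x' = pker (of_real (\<rho> x') * cis x') x" by (rule pker_swap)
      finally have "pker (of_real (\<rho> x * \<rho> x') * cis x) x' / (2 * pi) \<le> 8 * (pker (of_real (\<rho> x) * cis x) x' + pker (of_real (\<rho> x') * cis x') x) / (2 * pi)"
        by (intro divide_right_mono) auto
      thus "2 * pi * pker (of_real (\<rho> x * \<rho> x') * cis x) x' / (4*pi\<^sup>2)
         \<le> 8 * (pker (of_real (\<rho> x) * cis x) x' / (2*pi) + pker (of_real (\<rho> x') * cis x') x / (2*pi))"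
        by (simp add: power2_eq_square add_divide_distrib)
    qed
    also have "\<dots> = ennreal 8 * (ennreal (pker (of_real (\<rho> x) * cis x) x' / (2*pi)) + ennreal (pker (of_real (\<rho> x') * cis x') x / (2*pi)))"
      using nn by (subst ennreal_mult) (auto simp: ennreal_plus)
    finally show ?thesis .
  qed
qed (auto simp: zero_le_divide_iff)

text \<open>Over a finite set of radii the maximum is attained, and a measurable selector is built
  by comparing one new candidate at a time. It linearises the maximal function.\<close>

lemma measurable_argmax:
  fixes F :: "real \<Rightarrow> real \<Rightarrow> real"
  assumes "finite Q" "Q \<noteq> {}" and F: "\<And>q. q \<in> Q \<Longrightarrow> F q \<in> borel_measurable borel"
  shows "\<exists>\<rho>\<in>borel_measurable borel. (\<forall>x. \<rho> x \<in> Q \<and> (\<forall>q\<in>Q. F q x \<le> F (\<rho> x) x)) \<and> (\<lambda>x. F (\<rho> x) x) \<in> borel_measurable borel"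
  using assms
proof (induction rule: finite_ne_induct)
  case (singleton q)
  thus ?case by (intro bexI[of _ "\<lambda>_. q"]) auto
next
  case (insert q Q)
  then obtain \<rho> where \<rho>: "\<rho> \<in> borel_measurable borel" "\<And>x. \<rho> x \<in> Q" "\<And>x q. q \<in> Q \<Longrightarrow> F q x \<le> F (\<rho> x) x"
    "(\<lambda>x. F (\<rho> x) x) \<in> borel_measurable borel" by auto
  note [measurable] = \<rho>(1,4)
  have [measurable]: "F q \<in> borel_measurable borel" using insert.prems by simp
  define \<rho>' where "\<rho>' x = (if F (\<rho> x) x \<le> F q x then q else \<rho> x)" for x
  have m1: "\<rho>' \<in> borel_measurable borel" unfolding \<rho>'_def by measurable
  have "(\<lambda>x. F (\<rho>' x) x) = (\<lambda>x. if F (\<rho> x) x \<le> F q x then F q x else F (\<rho> x) x)"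
    by (auto simp: \<rho>'_def)
  hence m2: "(\<lambda>x. F (\<rho>' x) x) \<in> borel_measurable borel" by simp
  have "\<rho>' x \<in> insert q Q" "F q' x \<le> F (\<rho>' x) x" if "q' \<in> insert q Q" for x q'
    using \<rho>(2)[of x] \<rho>(3)[of q' x] that unfolding \<rho>'_def by auto
  thus ?case using m1 m2 by (intro bexI[of _ \<rho>']) auto
qed

lemma norm_le_poisson:
  assumes G: "G holomorphic_on ball 0 1" and R: "0 < R" "R < 1" and q: "0 < q" "q < 1"
  shows "ennreal (cmod (G (of_real (q * R) * cis x))) \<le>
    (\<integral>\<^sup>+y\<in>{0..2*pi}. ennreal (pker (of_real q * cis x) y / (2*pi) * cmod (G (of_real R * cis y))) \<partial>lborel)"
proof -
  define H where "H z = G (of_real R * z)" for z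
  have qx: "cmod (of_real q * cis x) < 1" using q by (simp add: norm_mult)
  have nn: "0 \<le> pker (of_real q * cis x) y" for y by (rule pker_nonneg) (use qx in auto)
  have H: "H holomorphic_on ball 0 (1 / R)"
  proof -
    have "(\<lambda>z. complex_of_real R * z) ` ball 0 (1 / R) \<subseteq> ball 0 1"
      using R by (auto simp: norm_mult field_simps)
    thus ?thesis unfolding H_def
      using holomorphic_on_compose_gen[of "\<lambda>z. of_real R * z" "ball 0 (1/R)" G "ball 0 1"] G
      by (auto simp: o_def intro!: holomorphic_intros)
  qed
  have i: "((\<lambda>t. H (cis t) * of_real (pker (of_real q * cis x) t)) has_integral (2 * of_real pi * H (of_real q * cis x))) {0..2*pi}"
    by (rule poisson_integral[OF H _ qx]) (use R in auto)
  have cont: "continuous_on {0..2*pi} (\<lambda>t. G (of_real R * cis t))"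
    by (intro continuous_on_circle holomorphic_on_imp_continuous_on G R)
  have "2 * pi * cmod (H (of_real q * cis x)) = cmod (integral {0..2*pi} (\<lambda>t. H (cis t) * of_real (pker (of_real q * cis x) t)))"
    unfolding integral_unique[OF i] by (simp add: norm_mult)
  also have "\<dots> \<le> integral {0..2*pi} (\<lambda>t. pker (of_real q * cis x) t * cmod (G (of_real R * cis t)))"
  proof (rule integral_norm_bound_integral)
    show "(\<lambda>t. pker (of_real q * cis x) t * cmod (G (of_real R * cis t))) integrable_on {0..2*pi}"
      by (intro integrable_continuous_interval continuous_intros continuous_on_pker cont qx)
    show "cmod (H (cis t) * of_real (pker (of_real q * cis x) t)) \<le> pker (of_real q * cis x) t * cmod (G (of_real R * cis t))" for t
      unfolding norm_mult norm_of_real H_def using nn[of t] by simp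
  qed (use i in auto)
  finally have le: "cmod (G (of_real (q * R) * cis x)) \<le> integral {0..2*pi} (\<lambda>t. pker (of_real q * cis x) t * cmod (G (of_real R * cis t))) / (2*pi)"
    unfolding H_def by (simp add: field_simps)
  have "((\<lambda>t. pker (of_real q * cis x) t * cmod (G (of_real R * cis t)) / (2*pi)) has_integral
     integral {0..2*pi} (\<lambda>t. pker (of_real q * cis x) t * cmod (G (of_real R * cis t))) / (2*pi)) {0..2*pi}"
    by (intro has_integral_divide integrable_integral integrable_continuous_interval continuous_intros continuous_on_pker cont qx)
  hence "((\<lambda>t. pker (of_real q * cis x) t / (2*pi) * cmod (G (of_real R * cis t))) has_integral
     integral {0..2*pi} (\<lambda>t. pker (of_real q * cis x) t * cmod (G (of_real R * cis t))) / (2*pi)) {0..2*pi}"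
    by simp
  hence "(\<integral>\<^sup>+y\<in>{0..2*pi}. ennreal (pker (of_real q * cis x) y / (2*pi) * cmod (G (of_real R * cis y))) \<partial>lborel)
     = ennreal (integral {0..2*pi} (\<lambda>t. pker (of_real q * cis x) t * cmod (G (of_real R * cis t))) / (2*pi))"
  proof (rule set_nn_integral_has_integral[rotated 2])
    show "continuous_on {0..2*pi} (\<lambda>t. pker (of_real q * cis x) t / (2*pi) * cmod (G (of_real R * cis t)))"
      by (intro continuous_intros continuous_on_pker cont qx) auto
    show "0 \<le> pker (of_real q * cis x) t / (2*pi) * cmod (G (of_real R * cis t))" for t
      by (intro mult_nonneg_nonneg divide_nonneg_nonneg nn) auto
  qed
  thus ?thesis using ennreal_leI[OF le] by simp
qed

text \<open>With the maximising radius \<rho> t selected, the Poisson formula on the circle of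
  radius R bounds |G (\<rho> t * cis t)| by T applied to |G| on that circle, for the kernel with
  radius \<rho> t / R. The constant is 4 * 8^2 + 1 = 257, whatever the set Q.\<close>

lemma radial_maximal_finite:
  assumes G: "G holomorphic_on ball 0 1" and B: "0 \<le> B"
    and mean: "\<And>r. 0 < r \<Longrightarrow> r < 1 \<Longrightarrow> integral {0..2*pi} (\<lambda>t. (cmod (G (of_real r * cis t)))\<^sup>2) \<le> B"
    and Q: "finite Q" "Q \<noteq> {}" "Q \<subseteq> {0<..<1}"
  shows "(\<integral>\<^sup>+t\<in>{0..2*pi}. (SUP q\<in>Q. ennreal ((cmod (G (of_real q * cis t)))\<^sup>2)) \<partial>lborel) \<le> ennreal (257 * B)"
proof -
  \<comment> \<open>Strictly between the largest radius and 1, so that the ratios \<rho> t / R stay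
    away from 1.\<close>
  define R where "R = (1 + Max Q) / 2"
  have "Max Q \<in> Q" by (rule Max_in[OF Q(1,2)])
  hence MaxQ: "0 < Max Q" "Max Q < 1" using Q(3) by (auto dest: subsetD)
  have R: "0 < R" "R < 1" "Max Q < R" unfolding R_def using MaxQ by auto
  have contG: "continuous_on UNIV (\<lambda>t. G (of_real r * cis t))" if "0 < r" "r < 1" for r
    by (intro continuous_on_circle holomorphic_on_imp_continuous_on G that)
  define F where "F q t = (cmod (G (of_real q * cis t)))\<^sup>2" for q t
  have F: "F q \<in> borel_measurable borel" if "0 < q" "q < 1" for q
    unfolding F_def by (intro borel_measurable_continuous_onI continuous_intros contG that)
  obtain \<rho> where \<rho>: "\<rho> \<in> borel_measurable borel" "\<And>x. \<rho> x \<in> Q" "\<And>x q. q \<in> Q \<Longrightarrow> F q x \<le> F (\<rho> x) x"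
    "(\<lambda>x. F (\<rho> x) x) \<in> borel_measurable borel"
  proof -
    have "F q \<in> borel_measurable borel" if "q \<in> Q" for q
      using F[of q] Q(3) that by (auto dest: subsetD)
    from measurable_argmax[of Q F, OF Q(1,2) this] show ?thesis using that by blast
  qed
  note [measurable] = \<rho>(1,4)
  have \<rho>1: "0 < \<rho> x" "\<rho> x \<le> Max Q" for x
    using \<rho>(2)[of x] Q by auto
  let ?M = "restrict_space lborel {0..2*pi} :: real measure"
  define k where "k x y = ennreal (pker (of_real (\<rho> x / R) * cis x) y / (2*pi))" for x y
  interpret positive_kernel ?M k 8 "1 / (1 - Max Q / R)\<^sup>2"
    unfolding k_def
  proof (rule poisson_positive_kernel)
    show "(\<lambda>x. \<rho> x / R) \<in> borel_measurable borel" by measurable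
    show "Max Q / R < 1" using R by simp
    show "0 < \<rho> x / R \<and> \<rho> x / R \<le> Max Q / R" for x
      using \<rho>1[of x] R by (auto intro: divide_right_mono)
  qed
  define u where "u y = ennreal (cmod (G (of_real R * cis y)))" for y
  have [measurable]: "(\<lambda>y. cmod (G (of_real R * cis y))) \<in> borel_measurable borel"
    by (intro borel_measurable_continuous_onI continuous_on_norm contG R)
  have "u \<in> borel_measurable lborel" unfolding u_def by measurable
  hence u: "u \<in> borel_measurable ?M" by (rule measurable_restrict_space1)
  have "(\<integral>\<^sup>+t\<in>{0..2*pi}. (SUP q\<in>Q. ennreal ((cmod (G (of_real q * cis t)))\<^sup>2)) \<partial>lborel)
     \<le> (\<integral>\<^sup>+t\<in>{0..2*pi}. ennreal (F (\<rho> t) t) \<partial>lborel)"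
    using \<rho>(3) unfolding F_def by (intro nn_integral_mono mult_right_mono SUP_least ennreal_leI) auto
  also have "\<dots> = (\<integral>\<^sup>+t. ennreal (F (\<rho> t) t) \<partial>?M)"
    by (subst nn_integral_restrict_space) auto
  also have "\<dots> \<le> (\<integral>\<^sup>+t. (T u t)\<^sup>2 \<partial>?M)"
  proof (intro nn_integral_mono)
    fix t
    have "ennreal (cmod (G (of_real (\<rho> t / R * R) * cis t))) \<le>
       (\<integral>\<^sup>+y\<in>{0..2*pi}. ennreal (pker (of_real (\<rho> t / R) * cis t) y / (2*pi) * cmod (G (of_real R * cis y))) \<partial>lborel)"
      using \<rho>1[of t] R by (intro norm_le_poisson G) auto
    also have "\<dots> = T u t"
      unfolding T_def k_def u_def
      by (subst nn_integral_restrict_space, simp, intro nn_integral_cong, subst ennreal_mult''[OF norm_ge_zero], rule refl)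
    finally have "(ennreal (cmod (G (of_real (\<rho> t) * cis t))))\<^sup>2 \<le> (T u t)\<^sup>2"
      using R by (intro power_mono) auto
    thus "ennreal (F (\<rho> t) t) \<le> (T u t)\<^sup>2" unfolding F_def by (simp add: ennreal_power)
  qed
  also have "\<dots> \<le> ennreal (4 * 8\<^sup>2 + 1) * (\<integral>\<^sup>+t. (u t)\<^sup>2 \<partial>?M)"
    using bounded_by_kernel u unfolding bounded_by_def by blast
  also have "(\<integral>\<^sup>+t. (u t)\<^sup>2 \<partial>?M) = (\<integral>\<^sup>+t\<in>{0..2*pi}. ennreal (F R t) \<partial>lborel)"
    unfolding u_def F_def by (subst nn_integral_restrict_space) (auto simp: ennreal_power)
  also have "\<dots> = ennreal (integral {0..2*pi} (F R))"
  proof (rule set_nn_integral_has_integral)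
    show c: "continuous_on {0..2*pi} (F R)"
      unfolding F_def by (intro continuous_intros continuous_on_subset[OF contG] R) auto
    show "(F R has_integral integral {0..2*pi} (F R)) {0..2*pi}"
      by (intro integrable_integral integrable_continuous_interval c)
  qed (simp add: F_def)
  also have "ennreal (4 * 8\<^sup>2 + 1) * \<dots> \<le> ennreal (4 * 8\<^sup>2 + 1) * ennreal B"
    using mean[OF R(1,2)] unfolding F_def by (intro mult_left_mono ennreal_leI) auto
  also have "\<dots> = ennreal (257 * B)" using B by (subst ennreal_mult[symmetric]) auto
  finally show ?thesis .
qed

text \<open>Countable, so that suprema over it are measurable; dense, so that continuity recovers
  every radius.\<close>

abbreviation radii :: "real set" where "radii \<equiv> \<rat> \<inter> {0<..<1}"

lemma radial_maximal:
  assumes G: "G holomorphic_on ball 0 1" and B: "0 \<le> B"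
    and mean: "\<And>r. 0 < r \<Longrightarrow> r < 1 \<Longrightarrow> integral {0..2*pi} (\<lambda>t. (cmod (G (of_real r * cis t)))\<^sup>2) \<le> B"
  shows "(\<integral>\<^sup>+t\<in>{0..2*pi}. (SUP q\<in>radii. ennreal ((cmod (G (of_real q * cis t)))\<^sup>2)) \<partial>lborel) \<le> ennreal (257 * B)"
proof -
  have cnt: "countable radii" using countable_rat by auto
  have "1 / 2 \<in> radii" by auto
  hence ne: "radii \<noteq> {}" by blast
  define e where "e = from_nat_into radii"
  have e: "range e = radii" unfolding e_def by (rule range_from_nat_into[OF ne cnt])
  define Q where "Q n = e ` {..n}" for n
  have Q: "finite (Q n)" "Q n \<noteq> {}" "Q n \<subseteq> {0<..<1}" for n
    unfolding Q_def using e by auto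
  define W where "W n t = (SUP q\<in>Q n. ennreal ((cmod (G (of_real q * cis t)))\<^sup>2)) * indicator {0..2*pi} t" for n t
  have contG: "continuous_on UNIV (\<lambda>t. G (of_real r * cis t))" if "0 < r" "r < 1" for r
    by (intro continuous_on_circle holomorphic_on_imp_continuous_on G that)
  have [measurable]: "W n \<in> borel_measurable lborel" for n
    unfolding W_def
  proof (intro borel_measurable_times_ennreal borel_measurable_SUP countable_finite Q)
    fix q assume "q \<in> Q n"
    hence "0 < q" "q < 1" using Q(3)[of n] by auto
    hence [measurable]: "(\<lambda>t. (cmod (G (of_real q * cis t)))\<^sup>2) \<in> borel_measurable borel"
      by (intro borel_measurable_continuous_onI continuous_on_power continuous_on_norm contG)
    show "(\<lambda>t. ennreal ((cmod (G (of_real q * cis t)))\<^sup>2)) \<in> borel_measurable lborel"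
      by measurable
  qed auto
  have "incseq W"
    unfolding W_def by (intro incseq_SucI le_funI mult_right_mono SUP_subset_mono) (auto simp: Q_def)
  have "(\<integral>\<^sup>+t\<in>{0..2*pi}. (SUP q\<in>radii. ennreal ((cmod (G (of_real q * cis t)))\<^sup>2)) \<partial>lborel) = (\<integral>\<^sup>+t. (SUP n. W n t) \<partial>lborel)"
  proof (intro nn_integral_cong)
    fix t
    have "(SUP q\<in>radii. ennreal ((cmod (G (of_real q * cis t)))\<^sup>2)) = (SUP n. SUP q\<in>Q n. ennreal ((cmod (G (of_real q * cis t)))\<^sup>2))"
    proof (rule antisym)
      show "(SUP q\<in>radii. ennreal ((cmod (G (of_real q * cis t)))\<^sup>2)) \<le> (SUP n. SUP q\<in>Q n. ennreal ((cmod (G (of_real q * cis t)))\<^sup>2))"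
      proof (rule SUP_least)
        fix q assume "q \<in> radii"
        then obtain n where "q = e n" using e by (metis rangeE)
        hence "q \<in> Q n" by (auto simp: Q_def)
        thus "ennreal ((cmod (G (of_real q * cis t)))\<^sup>2) \<le> (SUP n. SUP q\<in>Q n. ennreal ((cmod (G (of_real q * cis t)))\<^sup>2))"
          by (intro SUP_upper2[of n] SUP_upper) auto
      qed
      show "(SUP n. SUP q\<in>Q n. ennreal ((cmod (G (of_real q * cis t)))\<^sup>2)) \<le> (SUP q\<in>radii. ennreal ((cmod (G (of_real q * cis t)))\<^sup>2))"
        using e by (intro SUP_least SUP_upper) (auto simp: Q_def)
    qed
    thus "(SUP q\<in>radii. ennreal ((cmod (G (of_real q * cis t)))\<^sup>2)) * indicator {0..2*pi} t = (SUP n. W n t)"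
      unfolding W_def by (simp add: SUP_mult_right_ennreal)
  qed
  also have "\<dots> = (SUP n. \<integral>\<^sup>+t. W n t \<partial>lborel)"
    by (rule nn_integral_monotone_convergence_SUP) (use \<open>incseq W\<close> in auto)
  also have "\<dots> \<le> ennreal (257 * B)"
    unfolding W_def by (intro SUP_least radial_maximal_finite G B mean Q)
  finally show ?thesis .
qed

section \<open>Radial limits\<close>

lemma radii_dense:
  assumes "0 < r" "r < (1::real)" "0 < e"
  obtains q where "q \<in> radii" "\<bar>q - r\<bar> < e"
proof -
  obtain q where q: "q \<in> \<rat>" "max 0 (r - e) < q" "q < r"
    using Rats_dense_in_real[of "max 0 (r - e)" r] assms by auto
  thus ?thesis using that[of q] assms by auto
qed

text \<open>A function that is within every \<epsilon>, near 1, of some function with a limit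
  satisfies the Cauchy condition at 1. The fifths make the oscillation at most 4/5 of
  \<epsilon>.\<close>

lemma radial_limit_exists:
  assumes approx: "\<And>\<epsilon>. 0 < \<epsilon> \<Longrightarrow> \<exists>P L. (P \<longlongrightarrow> L) (at_left 1) \<and> (\<forall>\<^sub>F r in at_left 1. cmod (f r - P r) \<le> \<epsilon>)"
  shows "\<exists>L. (f \<longlongrightarrow> L) (at_left (1::real))"
proof -
  have osc: "\<exists>\<delta>>0. \<forall>r s. 1 - \<delta> < r \<and> r < 1 \<and> 1 - \<delta> < s \<and> s < 1 \<longrightarrow> cmod (f r - f s) < \<epsilon>" if \<epsilon>: "0 < \<epsilon>" for \<epsilon>
  proof -
    obtain P L where P: "(P \<longlongrightarrow> L) (at_left 1)" "\<forall>\<^sub>F r in at_left 1. cmod (f r - P r) \<le> \<epsilon> / 5"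
      using approx[of "\<epsilon> / 5"] \<epsilon> by auto
    have "\<forall>\<^sub>F r in at_left 1. dist (P r) L < \<epsilon> / 5" using P(1) by (rule tendstoD) (use \<epsilon> in simp)
    with P(2) have "\<forall>\<^sub>F r in at_left 1. cmod (f r - L) < 2 * \<epsilon> / 5"
    proof eventually_elim
      case (elim r)
      thus ?case using norm_triangle_ineq[of "f r - P r" "P r - L"] by (simp add: dist_norm)
    qed
    then obtain b where b: "b < 1" "\<And>r. b < r \<Longrightarrow> r < 1 \<Longrightarrow> cmod (f r - L) < 2 * \<epsilon> / 5"
      unfolding eventually_at_left[of 0 1, OF zero_less_one] by auto
    show ?thesis
    proof (intro exI conjI allI impI)
      show "0 < 1 - b" using b by simp
      fix r s :: real assume rs: "1 - (1 - b) < r \<and> r < 1 \<and> 1 - (1 - b) < s \<and> s < 1"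
      have "cmod (f r - f s) \<le> cmod (f r - L) + cmod (f s - L)"
        using norm_triangle_ineq4[of "f r - L" "f s - L"] by simp
      thus "cmod (f r - f s) < \<epsilon>" using b(2)[of r] b(2)[of s] rs \<epsilon> by simp
    qed
  qed
  define x where "x n = f (1 - inverse (real (Suc n)))" for n
  have small: "\<exists>N. \<forall>n\<ge>N. 1 - \<delta> < 1 - inverse (real (Suc n)) \<and> 1 - inverse (real (Suc n)) < 1" if "0 < \<delta>" for \<delta>
  proof -
    have "\<forall>\<^sub>F n in sequentially. inverse (real (Suc n)) < \<delta>"
      using LIMSEQ_inverse_real_of_nat that by (rule order_tendstoD)
    thus ?thesis unfolding eventually_sequentially by auto
  qed
  have "Cauchy x"
  proof (rule CauchyI)
    fix \<epsilon> :: real assume "0 < \<epsilon>"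
    from osc[OF this] obtain \<delta> where \<delta>: "0 < \<delta>" "\<And>r s. 1 - \<delta> < r \<Longrightarrow> r < 1 \<Longrightarrow> 1 - \<delta> < s \<Longrightarrow> s < 1 \<Longrightarrow> cmod (f r - f s) < \<epsilon>" by blast
    from small[OF \<delta>(1)] obtain N where "\<And>n. n \<ge> N \<Longrightarrow> 1 - \<delta> < 1 - inverse (real (Suc n)) \<and> 1 - inverse (real (Suc n)) < 1" by blast
    thus "\<exists>M. \<forall>m\<ge>M. \<forall>n\<ge>M. cmod (x m - x n) < \<epsilon>" unfolding x_def using \<delta>(2) by blast
  qed
  then obtain L where L: "x \<longlonglongrightarrow> L" using Cauchy_convergent_iff convergent_def by blast
  have "(f \<longlongrightarrow> L) (at_left 1)"
  proof (rule tendstoI)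
    fix \<epsilon> :: real assume \<epsilon>: "0 < \<epsilon>"
    from osc[of "\<epsilon>/2"] \<epsilon> obtain \<delta> where \<delta>: "0 < \<delta>" "\<And>r s. 1 - \<delta> < r \<Longrightarrow> r < 1 \<Longrightarrow> 1 - \<delta> < s \<Longrightarrow> s < 1 \<Longrightarrow> cmod (f r - f s) < \<epsilon>/2" by auto
    from small[OF \<delta>(1)] obtain N where N: "\<And>n. n \<ge> N \<Longrightarrow> 1 - \<delta> < 1 - inverse (real (Suc n)) \<and> 1 - inverse (real (Suc n)) < 1" by blast
    have le: "cmod (f r - L) \<le> \<epsilon>/2" if r: "1 - \<delta> < r" "r < 1" for r
    proof (rule tendsto_upperbound)
      show "(\<lambda>n. cmod (f r - x n)) \<longlonglongrightarrow> cmod (f r - L)" by (intro tendsto_intros L)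
      show "\<forall>\<^sub>F n in sequentially. cmod (f r - x n) \<le> \<epsilon>/2"
        unfolding eventually_sequentially x_def using N \<delta>(2) r by (intro exI[of _ N]) (auto intro!: less_imp_le)
    qed simp
    have "\<forall>\<^sub>F r in at_left 1. r \<in> {1 - \<delta><..<1}" by (rule eventually_at_left_real) (use \<delta> in simp)
    thus "\<forall>\<^sub>F r in at_left 1. dist (f r) L < \<epsilon>"
    proof eventually_elim
      case (elim r)
      thus ?case using le[of r] \<epsilon> by (auto simp: dist_norm)
    qed
  qed
  thus ?thesis by blast
qed

text \<open>The polynomials are dense in the Hardy space of order two, and the radial maximal function
  of the remainder controls the oscillation.\<close>

lemma AE_radial_limit:
  assumes F: "F holomorphic_on ball 0 1"
    and mean: "\<And>r. 0 < r \<Longrightarrow> r < 1 \<Longrightarrow> integral {0..2*pi} (\<lambda>t. (cmod (F (of_real r * cis t)))\<^sup>2) \<le> B"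
  shows "AE t in lborel. t \<in> {0..2*pi} \<longrightarrow> (\<exists>L. ((\<lambda>r. F (of_real r * cis t)) \<longlongrightarrow> L) (at_left 1))"
proof -
  obtain b where b: "\<And>z. cmod z < 1 \<Longrightarrow> (\<lambda>n. b n * z ^ n) sums F z"
    using holomorphic_power_series_0[OF F] by metis
  have summ: "summable (\<lambda>n. (cmod (b n))\<^sup>2)"
  proof (rule power_sum_bound(1)[where B = "B / (2 * pi)"])
    fix x :: real assume x: "0 < x" "x < 1"
    have r: "0 < sqrt x" "sqrt x < 1" using x by auto
    have eq: "(cmod (complex_of_real (sqrt x)))\<^sup>2 = x" using x by simp
    show "summable (\<lambda>n. (cmod (b n))\<^sup>2 * x ^ n)"
      using circle_mean_square(2)[OF b, of "of_real (sqrt x)"] r unfolding eq by simp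
    have "2 * pi * (\<Sum>n. (cmod (b n))\<^sup>2 * x ^ n) = integral {0..2*pi} (\<lambda>t. (cmod (F (cis t * of_real (sqrt x))))\<^sup>2)"
      using integral_unique[OF circle_mean_square(1)[OF b, of "of_real (sqrt x)"]] r unfolding eq by simp
    also have "\<dots> \<le> B" using mean[OF r] by (simp add: mult.commute)
    finally show "(\<Sum>n. (cmod (b n))\<^sup>2 * x ^ n) \<le> B / (2 * pi)" by (simp add: field_simps)
  qed simp
  define P where "P N z = (\<Sum>n<N. b n * z ^ n)" for N z
  define G where "G N z = F z - P N z" for N z
  \<comment> \<open>The tail of the square-summable coefficients; 2 \<pi> times it bounds the mean
    square of the remainder after N terms on every circle.\<close>
  define \<tau> where "\<tau> N = (\<Sum>n. (cmod (b (n + N)))\<^sup>2)" for N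
  have \<tau>0: "\<tau> \<longlonglongrightarrow> 0"
    unfolding \<tau>_def by (rule suminf_exist_split2[OF summ])
  have \<tau>nn: "0 \<le> \<tau> N" for N
    unfolding \<tau>_def by (intro suminf_nonneg summable_ignore_initial_segment summ) auto
  have G: "G N holomorphic_on ball 0 1" for N
    unfolding G_def P_def by (intro holomorphic_intros F)
  have Gmean: "integral {0..2*pi} (\<lambda>t. (cmod (G N (of_real r * cis t)))\<^sup>2) \<le> 2 * pi * \<tau> N" if r: "0 < r" "r < 1" for N r
  proof -
    define c where "c n = (if n < N then 0 else b n)" for n
    have c: "(\<lambda>n. c n * z ^ n) sums G N z" if "cmod z < 1" for z
    proof -
      have "(\<lambda>n. if n < N then b n * z ^ n else 0) sums (\<Sum>n<N. b n * z ^ n)"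
        using sums_If_finite_set[of "{..<N}" "\<lambda>n. b n * z ^ n"] by simp
      from sums_diff[OF b[OF that] this]
      have "(\<lambda>n. b n * z ^ n - (if n < N then b n * z ^ n else 0)) sums G N z"
        unfolding G_def P_def .
      moreover have "(\<lambda>n. b n * z ^ n - (if n < N then b n * z ^ n else 0)) = (\<lambda>n. c n * z ^ n)"
        unfolding c_def by auto
      ultimately show ?thesis by simp
    qed
    have sc: "summable (\<lambda>n. (cmod (c n))\<^sup>2)"
      by (rule summable_comparison_test_ev[OF _ summ]) (auto simp: c_def)
    have "integral {0..2*pi} (\<lambda>t. (cmod (G N (of_real r * cis t)))\<^sup>2) = 2 * pi * (\<Sum>n. (cmod (c n))\<^sup>2 * (cmod (of_real r))\<^sup>2 ^ n)"
      using integral_unique[OF circle_mean_square(1)[OF c, of "of_real r"]] r by (simp add: mult.commute)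
    also have "\<dots> \<le> 2 * pi * (\<Sum>n. (cmod (c n))\<^sup>2)"
    proof (intro mult_left_mono suminf_le sc)
      show "summable (\<lambda>n. (cmod (c n))\<^sup>2 * (cmod (of_real r))\<^sup>2 ^ n)"
        by (rule circle_mean_square(2)[OF c]) (use r in auto)
      show "(cmod (c n))\<^sup>2 * (cmod (of_real r))\<^sup>2 ^ n \<le> (cmod (c n))\<^sup>2" for n
        using r by (intro mult_right_le_one_le) (auto simp: power_le_one)
    qed auto
    also have "(\<Sum>n. (cmod (c n))\<^sup>2) = \<tau> N"
      using suminf_split_initial_segment[OF sc, of N] unfolding \<tau>_def by (simp add: c_def)
    finally show ?thesis .
  qed
  define W where "W N t = (SUP q\<in>radii. ennreal ((cmod (G N (of_real q * cis t)))\<^sup>2)) * indicator {0..2*pi} t" for N t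
  have W: "(\<integral>\<^sup>+t. W N t \<partial>lborel) \<le> ennreal (257 * (2 * pi * \<tau> N))" for N
    unfolding W_def by (rule radial_maximal[OF G]) (use \<tau>nn Gmean in auto)
  have cr: "countable radii" using countable_rat by auto
  have [measurable]: "W N \<in> borel_measurable lborel" for N
    unfolding W_def
  proof (intro borel_measurable_times_ennreal borel_measurable_SUP cr)
    fix q assume q: "q \<in> radii"
    have [measurable]: "(\<lambda>t. (cmod (G N (of_real q * cis t)))\<^sup>2) \<in> borel_measurable borel"
      using q by (intro borel_measurable_continuous_onI continuous_on_power continuous_on_norm continuous_on_circle
        holomorphic_on_imp_continuous_on[OF G]) auto
    show "(\<lambda>t. ennreal ((cmod (G N (of_real q * cis t)))\<^sup>2)) \<in> borel_measurable lborel" by measurable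
  qed auto
  \<comment> \<open>The integral of W N is at most a constant times the tail, so W' has integral
    zero. Off its null set, at an angle t in the interval, every \<epsilon> admits an N whose
    remainder stays below \<epsilon> along the whole radius.\<close>
  define W' where "W' t = (INF N. W N t)" for t
  have [measurable]: "W' \<in> borel_measurable lborel" unfolding W'_def by measurable
  have "(\<integral>\<^sup>+t. W' t \<partial>lborel) \<le> 0"
  proof (rule tendsto_lowerbound)
    have "(\<lambda>N. ennreal (257 * (2 * pi * \<tau> N))) \<longlonglongrightarrow> ennreal (257 * (2 * pi * 0))"
      by (intro tendsto_ennrealI tendsto_intros \<tau>0)
    thus "(\<lambda>N. ennreal (257 * (2 * pi * \<tau> N))) \<longlonglongrightarrow> 0" by simp
    show "\<forall>\<^sub>F N in sequentially. (\<integral>\<^sup>+t. W' t \<partial>lborel) \<le> ennreal (257 * (2 * pi * \<tau> N))"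
    proof (intro always_eventually allI)
      fix N
      have "(\<integral>\<^sup>+t. W' t \<partial>lborel) \<le> (\<integral>\<^sup>+t. W N t \<partial>lborel)"
        unfolding W'_def by (intro nn_integral_mono INF_lower) auto
      thus "(\<integral>\<^sup>+t. W' t \<partial>lborel) \<le> ennreal (257 * (2 * pi * \<tau> N))" using W[of N] by (rule order_trans)
    qed
  qed simp
  hence "AE t in lborel. W' t = 0" by (simp add: nn_integral_0_iff_AE)
  thus ?thesis
  proof eventually_elim
    case (elim t)
    show ?case
    proof
      assume t: "t \<in> {0..2*pi}"
      show "\<exists>L. ((\<lambda>r. F (of_real r * cis t)) \<longlongrightarrow> L) (at_left 1)"
      proof (rule radial_limit_exists)
        fix \<epsilon> :: real assume \<epsilon>: "0 < \<epsilon>"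
        have "(INF N. W N t) < ennreal (\<epsilon>\<^sup>2)" using elim \<epsilon> unfolding W'_def by simp
        then obtain N where N: "W N t < ennreal (\<epsilon>\<^sup>2)" by (auto simp: INF_less_iff)
        have le: "cmod (G N (of_real q * cis t)) \<le> \<epsilon>" if q: "q \<in> radii" for q
        proof -
          have "ennreal ((cmod (G N (of_real q * cis t)))\<^sup>2) \<le> W N t"
            using t q unfolding W_def by (auto intro!: SUP_upper)
          hence "ennreal ((cmod (G N (of_real q * cis t)))\<^sup>2) \<le> ennreal (\<epsilon>\<^sup>2)" using N by (meson less_imp_le order_trans)
          hence "(cmod (G N (of_real q * cis t)))\<^sup>2 \<le> \<epsilon>\<^sup>2" by simp
          thus ?thesis by (rule power2_le_imp_le) (use \<epsilon> in simp)
        qed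
        \<comment> \<open>Continuity along the radius extends the bound from rational radii to all
          radii.\<close>
        have "cmod (G N (of_real r * cis t)) \<le> \<epsilon>" if r: "0 < r" "r < 1" for r
        proof (rule field_le_epsilon)
          fix e :: real assume e: "0 < e"
          have "continuous_on {0<..<1} (\<lambda>r. G N (of_real r * cis t))"
            by (rule continuous_on_compose2[OF holomorphic_on_imp_continuous_on[OF G]])
               (auto intro!: continuous_intros simp: norm_mult)
          then obtain d where d: "0 < d" "\<And>q. q \<in> {0<..<1} \<Longrightarrow> \<bar>q - r\<bar> < d \<Longrightarrow> cmod (G N (of_real q * cis t) - G N (of_real r * cis t)) < e"
            using r e unfolding continuous_on_iff dist_norm real_norm_def by (metis greaterThanLessThan_iff)
          obtain q where q: "q \<in> radii" "\<bar>q - r\<bar> < d" using radii_dense[OF r d(1)] .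
          have "cmod (G N (of_real r * cis t)) \<le> cmod (G N (of_real q * cis t)) + cmod (G N (of_real q * cis t) - G N (of_real r * cis t))"
            using norm_triangle_ineq4[of "G N (of_real q * cis t)" "G N (of_real q * cis t) - G N (of_real r * cis t)"] by simp
          thus "cmod (G N (of_real r * cis t)) \<le> \<epsilon> + e"
            using le[OF q(1)] d(2)[of q] q by auto
        qed
        note le1 = this
        have "\<forall>\<^sub>F r in at_left (1::real). r \<in> {0<..<1}" by (rule eventually_at_left_real) simp
        hence "\<forall>\<^sub>F r in at_left 1. cmod (F (of_real r * cis t) - P N (of_real r * cis t)) \<le> \<epsilon>"
          by eventually_elim (use le1 in \<open>auto simp: G_def\<close>)
        moreover have "((\<lambda>r. P N (complex_of_real r * cis t)) \<longlongrightarrow> P N (of_real 1 * cis t)) (at_left 1)"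
          unfolding P_def by (intro tendsto_intros)
        ultimately show "\<exists>P L. (P \<longlongrightarrow> L) (at_left 1) \<and> (\<forall>\<^sub>F r in at_left 1. cmod (F (of_real r * cis t) - P r) \<le> \<epsilon>)"
          by blast
      qed
    qed
  qed
qed

section \<open>Oscillation over arcs\<close>

lemma holomorphic_scale:
  assumes F: "F holomorphic_on ball 0 1" and r: "0 < r" "r < 1"
  shows "(\<lambda>z. F (of_real r * z)) holomorphic_on ball 0 (1 / r)"
    and "\<And>z. cmod z < 1 \<Longrightarrow> deriv (\<lambda>z. F (of_real r * z)) z = of_real r * deriv F (of_real r * z)"
proof -
  have "(\<lambda>z. complex_of_real r * z) ` ball 0 (1 / r) \<subseteq> ball 0 1"
    using r by (auto simp: norm_mult field_simps)
  thus "(\<lambda>z. F (of_real r * z)) holomorphic_on ball 0 (1 / r)"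
    using holomorphic_on_compose_gen[of "\<lambda>z. of_real r * z" "ball 0 (1/r)" F "ball 0 1"] F
    by (auto simp: o_def intro!: holomorphic_intros)
  fix z assume z: "cmod z < 1"
  have "r * cmod z < 1" using r z by (meson less_trans mult_less_cancel_left2 not_less order.strict_trans1 mult_le_one norm_ge_zero less_imp_le mult_left_le_one_le)
  hence "(F has_field_derivative deriv F (of_real r * z)) (at (of_real r * z))"
    using r by (intro holomorphic_derivI[OF F]) (auto simp: norm_mult)
  moreover have "((\<lambda>z. complex_of_real r * z) has_field_derivative of_real r) (at z)"
    by (auto intro!: derivative_eq_intros)
  ultimately have "((\<lambda>z. F (of_real r * z)) has_field_derivative (deriv F (of_real r * z) * of_real r)) (at z)"
    by (rule DERIV_chain2)
  thus "deriv (\<lambda>z. F (of_real r * z)) z = of_real r * deriv F (of_real r * z)"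
    by (simp add: DERIV_imp_deriv mult.commute)
qed

text \<open>After dilation by r both functions are holomorphic past the closed disc. The Poisson
  kernel has mass 2 \<pi> and height at most 2/L, so the bound does not depend on r. The case L = 1,
  a = 0 is the plain mean-square bound for F - F 0.\<close>

lemma poisson_oscillation_hardy:
  assumes f: "hardy_le q A f" and F: "F holomorphic_on ball 0 1" and K: "0 \<le> K"
    and dom: "\<And>z. cmod z < 1 \<Longrightarrow> cmod (deriv F z) \<le> K * cmod (deriv f z)"
    and r: "0 < r" "r < 1" and L: "0 < L" "L \<le> 1" and a: "cmod a = 1 - L"
  shows "integral {0..2*pi} (\<lambda>t. (cmod (F (of_real r * cis t) - F (of_real r * a)))\<^sup>2 * pker a t)
    \<le> 8 * pi * K\<^sup>2 * A\<^sup>2 * (2 / L) powr (2 / q)"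
proof -
  have hol: "f holomorphic_on ball 0 1" using f unfolding hardy_le_def by auto
  have a1: "cmod a < 1" using a L by simp
  have nn: "0 \<le> pker a t" for t by (rule pker_nonneg) (use a1 in auto)
  have "integral {0..2*pi} (\<lambda>t. (cmod (F (of_real r * cis t) - F (of_real r * a)))\<^sup>2 * pker a t)
     \<le> 2 * K\<^sup>2 * integral {0..2*pi} (\<lambda>t. (cmod (f (of_real r * cis t)))\<^sup>2 * pker a t)"
  proof (rule poisson_oscillation_le[OF holomorphic_scale(1)[OF F r] holomorphic_scale(1)[OF hol r] _ K a1])
    show "1 < 1 / r" using r by simp
    fix z assume z: "cmod z < 1"
    have "r * cmod z \<le> 1 * cmod z" using r by (intro mult_right_mono) auto
    hence "cmod (of_real r * z) < 1" using r z by (simp add: norm_mult)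
    hence "r * cmod (deriv F (of_real r * z)) \<le> r * (K * cmod (deriv f (of_real r * z)))"
      using r by (intro mult_left_mono dom) auto
    thus "cmod (deriv (\<lambda>z. F (of_real r * z)) z) \<le> K * cmod (deriv (\<lambda>z. f (of_real r * z)) z)"
      unfolding holomorphic_scale(2)[OF F r z] holomorphic_scale(2)[OF hol r z] using r
      by (simp add: norm_mult mult.left_commute)
  qed
  also have "\<dots> \<le> 2 * K\<^sup>2 * (4 * pi * A\<^sup>2 * (2 / L) powr (2 / q))"
  proof (intro mult_left_mono hardy_le_weighted[OF f r])
    show "continuous_on {0..2*pi} (pker a)" by (intro continuous_on_pker a1 continuous_on_id)
    show "integral {0..2*pi} (pker a) \<le> 2 * pi"
      using integral_unique[OF poisson_kernel_integral[OF a1]] by simp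
    show "pker a t \<le> 2 / L" for t
    proof -
      have lower: "L \<le> cmod (1 - cnj a * cis t)"
        using norm_triangle_ineq2[of 1 "cnj a * cis t"] a by (simp add: norm_mult)
      have "1 - (cmod a)\<^sup>2 \<le> 2 * L" unfolding a by (simp add: power2_eq_square algebra_simps)
      hence "pker a t \<le> (2 * L) / L\<^sup>2"
        unfolding pker_def using L a1 lower by (intro frac_le power_mono) (auto simp: power_le_one)
      thus ?thesis using L by (simp add: power2_eq_square)
    qed
  qed (use L nn in auto)
  finally show ?thesis by (simp add: mult_ac)
qed

text \<open>On the arc the Poisson kernel is at least 1 / (\<kappa>^2 L), so dropping it costs
  \<kappa>^2 L. This factor L combines with (2/L)^(2/q) to give the exponent 1 - 2/q.\<close>

lemma arc_oscillation:
  assumes f: "hardy_le q A f" and q: "q = 0 \<or> 2 < q" and F: "F holomorphic_on ball 0 1" and K: "0 \<le> K"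
    and dom: "\<And>z. cmod z < 1 \<Longrightarrow> cmod (deriv F z) \<le> K * cmod (deriv f z)"
    and r: "0 < r" "r < 1" and L: "0 < L" "L \<le> 1" and a: "cmod a = 1 - L" and \<kappa>: "0 < \<kappa>"
    and J: "0 \<le> \<alpha>" "\<beta> \<le> 2 * pi" "\<And>t. t \<in> {\<alpha>..\<beta>} \<Longrightarrow> cmod (1 - cnj a * cis t) \<le> \<kappa> * L"
  shows "integral {\<alpha>..\<beta>} (\<lambda>t. (cmod (F (of_real r * cis t) - F (of_real r * a)))\<^sup>2) \<le> 16 * pi * \<kappa>\<^sup>2 * K\<^sup>2 * A\<^sup>2 * L powr (1 - 2 / q)"
proof -
  have a1: "cmod a < 1" using a L by simp
  have nn: "0 \<le> pker a t" for t by (rule pker_nonneg) (use a1 in auto)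
  define u where "u t = (cmod (F (of_real r * cis t) - F (of_real r * a)))\<^sup>2" for t
  have contu: "continuous_on S u" for S
    unfolding u_def by (intro continuous_intros continuous_on_circle holomorphic_on_imp_continuous_on F r)
  have contup: "continuous_on S (\<lambda>t. u t * pker a t)" for S
    by (intro continuous_intros contu continuous_on_pker a1)
  have lower: "1 \<le> \<kappa>\<^sup>2 * L * pker a t" if t: "t \<in> {\<alpha>..\<beta>}" for t
  proof -
    have nz: "0 < cmod (1 - cnj a * cis t)" using one_minus_cnj_mult_nonzero[OF a1, of "cis t"] by simp
    have "L \<le> 1 - (cmod a)\<^sup>2"
      using mult_left_le[of "1 - L" "1 - L"] L unfolding a power2_eq_square by simp
    moreover have "(cmod (1 - cnj a * cis t))\<^sup>2 \<le> (\<kappa> * L)\<^sup>2" by (intro power_mono J t) auto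
    ultimately have "L / (\<kappa> * L)\<^sup>2 \<le> pker a t"
      unfolding pker_def using nz L by (intro frac_le) auto
    hence "\<kappa>\<^sup>2 * L * (L / (\<kappa> * L)\<^sup>2) \<le> \<kappa>\<^sup>2 * L * pker a t" using L \<kappa> by (intro mult_left_mono) auto
    thus ?thesis using L \<kappa> by (simp add: power_mult_distrib power2_eq_square)
  qed
  have "integral {\<alpha>..\<beta>} u \<le> integral {\<alpha>..\<beta>} (\<lambda>t. \<kappa>\<^sup>2 * L * (u t * pker a t))"
  proof (rule integral_le)
    show "u integrable_on {\<alpha>..\<beta>}" by (intro integrable_continuous_interval contu)
    show "(\<lambda>t. \<kappa>\<^sup>2 * L * (u t * pker a t)) integrable_on {\<alpha>..\<beta>}"
      by (intro integrable_continuous_interval continuous_intros contup)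
    fix t assume t: "t \<in> {\<alpha>..\<beta>}"
    have "u t * 1 \<le> u t * (\<kappa>\<^sup>2 * L * pker a t)" by (intro mult_left_mono lower t) (simp add: u_def)
    thus "u t \<le> \<kappa>\<^sup>2 * L * (u t * pker a t)" by (simp add: mult_ac)
  qed
  also have "\<dots> = \<kappa>\<^sup>2 * L * integral {\<alpha>..\<beta>} (\<lambda>t. u t * pker a t)" by simp
  also have "\<dots> \<le> \<kappa>\<^sup>2 * L * integral {0..2*pi} (\<lambda>t. u t * pker a t)"
    using L by (intro mult_left_mono integral_subset_le integrable_continuous_interval contup)
      (use J nn in \<open>auto simp: u_def\<close>)
  also have "\<dots> \<le> \<kappa>\<^sup>2 * L * (8 * pi * K\<^sup>2 * A\<^sup>2 * (2 / L) powr (2 / q))"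
    unfolding u_def using L by (intro mult_left_mono poisson_oscillation_hardy[OF f F K dom r L a]) auto
  also have "\<dots> = (8 * pi * \<kappa>\<^sup>2 * K\<^sup>2 * A\<^sup>2) * ((2 / L) powr (2 / q) * L)" by (simp only: mult_ac)
  also have "\<dots> \<le> (8 * pi * \<kappa>\<^sup>2 * K\<^sup>2 * A\<^sup>2) * (2 * L powr (1 - 2 / q))"
    by (intro mult_left_mono powr_scale q L) auto
  finally show ?thesis unfolding u_def by (simp add: mult_ac)
qed

section \<open>Rotation of arcs to a standard position, and the kernel near an arc\<close>

lemma holomorphic_rotate:
  assumes F: "F holomorphic_on ball 0 1"
  shows "(\<lambda>z. F (cis \<alpha> * z)) holomorphic_on ball 0 1"
    and "\<And>z. cmod z < 1 \<Longrightarrow> deriv (\<lambda>z. F (cis \<alpha> * z)) z = cis \<alpha> * deriv F (cis \<alpha> * z)"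
proof -
  have im: "(\<lambda>z. cis \<alpha> * z) ` ball 0 1 \<subseteq> ball 0 1" by (auto simp: norm_mult)
  have "(\<lambda>z. cis \<alpha> * z) holomorphic_on ball 0 1" by (intro holomorphic_intros)
  from holomorphic_on_compose_gen[OF this F im]
  show "(\<lambda>z. F (cis \<alpha> * z)) holomorphic_on ball 0 1" by (simp only: o_def)
  fix z assume z: "cmod z < 1"
  have "(F has_field_derivative deriv F (cis \<alpha> * z)) (at (cis \<alpha> * z))"
    using z by (intro holomorphic_derivI[OF F]) (auto simp: norm_mult)
  moreover have "((\<lambda>z. cis \<alpha> * z) has_field_derivative cis \<alpha>) (at z)"
    by (auto intro!: derivative_eq_intros)
  ultimately have "((\<lambda>z. F (cis \<alpha> * z)) has_field_derivative (deriv F (cis \<alpha> * z) * cis \<alpha>)) (at z)"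
    by (rule DERIV_chain2)
  thus "deriv (\<lambda>z. F (cis \<alpha> * z)) z = cis \<alpha> * deriv F (cis \<alpha> * z)"
    by (simp add: DERIV_imp_deriv mult.commute)
qed

text \<open>An arc may start at any angle, while the circle integrals run over [0, 2 \<pi>].
  Rotating f moves the starting point of the arc to 0 and preserves the Hardy bound by
  periodicity.\<close>

lemma hardy_le_rotate:
  assumes f: "hardy_le q A f"
  shows "hardy_le q A (\<lambda>z. f (cis \<alpha> * z))"
proof -
  have hol: "f holomorphic_on ball 0 1" using f unfolding hardy_le_def by auto
  note hol' = holomorphic_rotate(1)[OF hol, of \<alpha>]
  have "integral {0..2*pi} (\<lambda>t. cmod (f (cis \<alpha> * (of_real r * cis t))) powr q)
     = integral {0..2*pi} (\<lambda>t. cmod (f (of_real r * cis t)) powr q)" if r: "0 < r" "r < 1" and q: "2 < q" for r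
  proof -
    define u where "u t = cmod (f (of_real r * cis t)) powr q" for t
    have "cis \<alpha> * (of_real r * cis t) = of_real r * cis (\<alpha> + t)" for t by (simp add: cis_mult mult.left_commute)
    hence "integral {0..2*pi} (\<lambda>t. cmod (f (cis \<alpha> * (of_real r * cis t))) powr q) = integral {0..2*pi} (u \<circ> (+) \<alpha>)"
      by (simp only: u_def o_def)
    also have "\<dots> = integral {\<alpha>..\<alpha> + 2*pi} u" by (subst integral_shift_Icc_real) (simp add: add.commute)
    also have "\<dots> = integral {0..2*pi} u"
    proof (rule integral_periodic_shift)
      show "continuous_on UNIV u"
        unfolding u_def using q by (intro continuous_on_powr' continuous_intros continuous_on_circle holomorphic_on_imp_continuous_on hol r) auto
      show "u (t + 2*pi) = u t" for t
        unfolding u_def by (simp add: cis_mult[symmetric])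
    qed
    finally show ?thesis unfolding u_def .
  qed
  thus ?thesis using f hol' unfolding hardy_le_def by (auto simp: norm_mult split: if_splits)
qed

lemma norm_cis_minus_1: "cmod (cis t - 1) \<le> \<bar>t\<bar>"
proof -
  have "cmod (cis t - 1) = 2 * \<bar>sin (t / 2)\<bar>" using dist_exp_i_1[of t] by (simp add: cis_conv_exp)
  also have "\<dots> \<le> 2 * \<bar>t / 2\<bar>" by (intro mult_left_mono abs_sin_x_le_abs_x) auto
  finally show ?thesis by simp
qed

text \<open>The radial defect 1 - (1 - L) * \<rho> contributes at most 2L and the angular one at
  most \<pi> L; since \<pi> < 4, the sum is below 6L. A general \<rho> serves Carleson boxes, \<rho>
  = 1 serves arcs.\<close>

lemma kernel_near_arc:
  assumes L: "0 < L" "L \<le> 1" and \<rho>: "1 - L \<le> \<rho>" "\<rho> \<le> 1" and t: "\<bar>t - \<theta>\<bar> \<le> pi * L"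
  shows "cmod (1 - cnj (of_real (1 - L) * cis \<theta>) * (of_real \<rho> * cis t)) \<le> 6 * L"
proof -
  have e: "cnj (of_real (1 - L) * cis \<theta>) * (of_real \<rho> * cis t) = of_real ((1 - L) * \<rho>) * cis (t - \<theta>)"
    using cis_mult[of t "- \<theta>"] by (simp add: cis_cnj mult_ac)
  have "1 - of_real ((1 - L) * \<rho>) * cis (t - \<theta>) = of_real (1 - (1 - L) * \<rho>) - of_real ((1 - L) * \<rho>) * (cis (t - \<theta>) - 1)"
    by (simp add: algebra_simps)
  also have "cmod \<dots> \<le> cmod (of_real (1 - (1 - L) * \<rho>)) + cmod (of_real ((1 - L) * \<rho>) * (cis (t - \<theta>) - 1))"
    by (rule norm_triangle_ineq4)
  also have "cmod (complex_of_real (1 - (1 - L) * \<rho>)) \<le> 2 * L"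
  proof -
    have "(1 - L) * (1 - L) \<le> (1 - L) * \<rho>" "(1 - L) * \<rho> \<le> 1 * 1" using L \<rho> by (intro mult_left_mono mult_mono; simp)+
    moreover have "1 - (1 - L) * (1 - L) \<le> 2 * L" by (simp add: algebra_simps)
    ultimately show ?thesis unfolding norm_of_real by simp
  qed
  also have "cmod (of_real ((1 - L) * \<rho>) * (cis (t - \<theta>) - 1)) \<le> 1 * (pi * L)"
    unfolding norm_mult norm_of_real
    using L \<rho> t norm_cis_minus_1[of "t - \<theta>"] mult_mono[of "1 - L" 1 \<rho> 1]
    by (intro mult_mono) auto
  also have "2 * L + 1 * (pi * L) \<le> 6 * L" using pi_less_4 L mult_right_mono[of pi 4 L] by simp
  finally show ?thesis unfolding e by simp
qed

text \<open>The Cauchy criterion written with countable quantifiers only: tolerances 1/(n+1),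
  neighbourhoods of 1 indexed by N, and rational radii. Continuity in the open interval makes this
  equivalent to the existence of the limit.\<close>

lemma has_radial_limit_iff:
  fixes h :: "real \<Rightarrow> complex"
  assumes cont: "continuous_on {0<..<1} h"
  shows "(\<exists>L. (h \<longlongrightarrow> L) (at_left 1)) \<longleftrightarrow>
    (\<forall>n::nat. \<exists>N::nat. \<forall>p\<in>radii. \<forall>q\<in>radii. 1 - 1 / real (Suc N) < p \<longrightarrow> 1 - 1 / real (Suc N) < q \<longrightarrow> cmod (h p - h q) \<le> 1 / real (Suc n))"
    (is "?L \<longleftrightarrow> ?R")
proof
  assume ?L
  then obtain L where L: "(h \<longlongrightarrow> L) (at_left 1)" by blast
  show ?R
  proof
    fix n :: nat
    have "\<forall>\<^sub>F r in at_left 1. dist (h r) L < 1 / (2 * real (Suc n))" using L by (rule tendstoD) simp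
    then obtain b where b: "b < 1" "\<And>r. b < r \<Longrightarrow> r < 1 \<Longrightarrow> dist (h r) L < 1 / (2 * real (Suc n))"
      unfolding eventually_at_left[of 0 1, OF zero_less_one] by auto
    obtain N where N: "1 / real (Suc N) < 1 - b" using nat_approx_posE[of "1 - b"] b by auto
    show "\<exists>N::nat. \<forall>p\<in>radii. \<forall>q\<in>radii. 1 - 1 / real (Suc N) < p \<longrightarrow> 1 - 1 / real (Suc N) < q \<longrightarrow> cmod (h p - h q) \<le> 1 / real (Suc n)"
    proof (intro exI ballI impI)
      fix p q assume pq: "p \<in> radii" "q \<in> radii" "1 - 1 / real (Suc N) < p" "1 - 1 / real (Suc N) < q"
      have "dist (h p) (h q) \<le> dist (h p) L + dist (h q) L" by (rule dist_triangle2)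
      also have "\<dots> \<le> 1 / (2 * real (Suc n)) + 1 / (2 * real (Suc n))"
        using pq N by (intro add_mono less_imp_le b(2)) auto
      also have "\<dots> = 1 / real (Suc n)" by (simp add: field_simps)
      finally show "cmod (h p - h q) \<le> 1 / real (Suc n)" by (simp add: dist_norm)
    qed
  qed
next
  assume R: ?R
  show ?L
  proof (rule radial_limit_exists)
    fix \<epsilon> :: real assume \<epsilon>: "0 < \<epsilon>"
    obtain n where n: "1 / real (Suc n) < \<epsilon>" using nat_approx_posE[OF \<epsilon>] by auto
    obtain N where N: "\<And>p q. p \<in> radii \<Longrightarrow> q \<in> radii \<Longrightarrow> 1 - 1 / real (Suc N) < p \<Longrightarrow> 1 - 1 / real (Suc N) < q \<Longrightarrow> cmod (h p - h q) \<le> 1 / real (Suc n)"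
      using R by meson
    obtain q where q: "q \<in> radii" "1 - 1 / real (Suc N) < q"
    proof -
      obtain q where "q \<in> \<rat>" "1 - 1 / real (Suc N) < q" "q < 1"
        using Rats_dense_in_real[of "1 - 1 / real (Suc N)" 1] by auto
      moreover have "0 \<le> 1 - 1 / real (Suc N)" by simp
      hence "0 < q" using \<open>1 - 1 / real (Suc N) < q\<close> by (rule le_less_trans)
      ultimately show ?thesis using that[of q] by simp
    qed
    have le: "cmod (h r - h q) \<le> \<epsilon>" if r: "1 - 1 / real (Suc N) < r" "r < 1" for r
    proof (rule field_le_epsilon)
      fix e :: real assume e: "0 < e"
      have r0: "0 < r" using r(1) by (rule le_less_trans[rotated]) simp
      obtain d where d: "0 < d" "\<And>p. p \<in> {0<..<1} \<Longrightarrow> \<bar>p - r\<bar> < d \<Longrightarrow> cmod (h p - h r) < e"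
        using cont r r0 e unfolding continuous_on_iff dist_norm real_norm_def by (metis greaterThanLessThan_iff)
      obtain p where p: "p \<in> radii" "\<bar>p - r\<bar> < min d (r - (1 - 1 / real (Suc N)))"
        using radii_dense[of r "min d (r - (1 - 1 / real (Suc N)))"] r r0 d(1) by auto
      have "1 - 1 / real (Suc N) < p" using p(2) by linarith
      hence 1: "cmod (h p - h q) \<le> 1 / real (Suc n)" using N p(1) q by blast
      have 2: "cmod (h p - h r) < e" using d(2)[of p] p by auto
      have "cmod (h r - h q) \<le> cmod (h p - h q) + cmod (h p - h r)"
        using norm_triangle_ineq4[of "h p - h q" "h p - h r"] by simp
      thus "cmod (h r - h q) \<le> \<epsilon> + e" using 1 2 n by linarith
    qed
    have "\<forall>\<^sub>F r in at_left (1::real). r \<in> {1 - 1 / real (Suc N)<..<1}" by (rule eventually_at_left_real) simp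
    hence "\<forall>\<^sub>F r in at_left 1. cmod (h r - h q) \<le> \<epsilon>"
      by eventually_elim (use le in auto)
    moreover have "((\<lambda>r. h q) \<longlongrightarrow> h q) (at_left (1::real))" by simp
    ultimately show "\<exists>P L. (P \<longlongrightarrow> L) (at_left 1) \<and> (\<forall>\<^sub>F r in at_left 1. cmod (h r - P r) \<le> \<epsilon>)"
      by (intro exI[of _ "\<lambda>_. h q"] exI[of _ "h q"]) auto
  qed
qed

text \<open>\<open>bval\<close> takes one fixed junk value wherever the radial limit does not exist, so it is measurable
  because the set of existence is.\<close>

lemma radii_sequence:
  "\<exists>x :: nat \<Rightarrow> real. (\<forall>n. 0 < x n) \<and> (\<forall>n. x n < 1) \<and> filterlim x (at_left 1) sequentially"
proof (intro exI conjI allI)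
  define x where "x n = 1 - inverse (real (Suc (Suc n)))" for n
  show x: "0 < x n" "x n < 1" for n unfolding x_def by (auto simp: field_simps)
  have "(\<lambda>n. inverse (real (Suc (Suc n)))) \<longlonglongrightarrow> 0"
    by (rule LIMSEQ_Suc[OF LIMSEQ_inverse_real_of_nat])
  hence "(\<lambda>n. 1 - inverse (real (Suc (Suc n)))) \<longlonglongrightarrow> 1 - 0" by (intro tendsto_intros)
  hence "x \<longlonglongrightarrow> 1" unfolding x_def by simp
  thus "filterlim x (at_left 1) sequentially" using x by (auto simp: filterlim_at intro!: always_eventually less_imp_neq)
qed

lemma pred_Ball_countable:
  assumes "countable X" "\<And>i. i \<in> X \<Longrightarrow> Measurable.pred M (P i)"
  shows "Measurable.pred M (\<lambda>x. \<forall>i\<in>X. P i x)"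
  using assms unfolding pred_def by (intro sets.sets_Collect_countable_All')

lemma bval_measurable:
  assumes F: "F holomorphic_on ball 0 1"
  shows "(\<lambda>t. bval F (cis t)) \<in> borel_measurable borel"
proof -
  obtain x :: "nat \<Rightarrow> real" where x: "\<And>n. 0 < x n" "\<And>n. x n < 1" and x1: "filterlim x (at_left 1) sequentially"
    using radii_sequence by metis
  define E where "E t \<longleftrightarrow> (\<exists>L. ((\<lambda>r. F (of_real r * cis t)) \<longlongrightarrow> L) (at_left 1))" for t
  have cr: "countable radii" using countable_rat by auto
  have [measurable]: "(\<lambda>t. F (of_real r * cis t)) \<in> borel_measurable borel" if "r \<in> {0<..<1}" for r
    using that by (intro borel_measurable_continuous_onI continuous_on_circle holomorphic_on_imp_continuous_on F) auto
  have E_iff: "E t \<longleftrightarrow> (\<forall>n::nat. \<exists>N::nat. \<forall>p\<in>radii. \<forall>q\<in>radii. 1 - 1 / real (Suc N) < p \<longrightarrow> 1 - 1 / real (Suc N) < q \<longrightarrow>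
      cmod (F (of_real p * cis t) - F (of_real q * cis t)) \<le> 1 / real (Suc n))" for t
    unfolding E_def
  proof (rule has_radial_limit_iff)
    show "continuous_on {0<..<1} (\<lambda>r. F (of_real r * cis t))"
      by (rule continuous_on_compose2[OF holomorphic_on_imp_continuous_on[OF F]])
         (auto intro!: continuous_intros simp: norm_mult)
  qed
  have E [measurable]: "Measurable.pred borel E"
    unfolding E_iff
    by (intro pred_intros_countable pred_Ball_countable[OF cr]) measurable
  \<comment> \<open>Without a limit the description inside \<open>Lim\<close> ranges over the empty
    predicate, which yields the same value \<open>THE l. False\<close> for every such t.\<close>
  have "(\<lambda>t. bval F (cis t)) = (\<lambda>t. if E t then lim (\<lambda>n. F (of_real (x n) * cis t)) else (THE l. False))"
  proof
    fix t
    show "bval F (cis t) = (if E t then lim (\<lambda>n. F (of_real (x n) * cis t)) else (THE l. False))"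
    proof (cases "E t")
      case True
      then obtain L where L: "((\<lambda>r. F (of_real r * cis t)) \<longlongrightarrow> L) (at_left 1)" unfolding E_def by blast
      have "bval F (cis t) = L" unfolding bval_def by (rule tendsto_Lim[OF _ L]) simp
      moreover have "(\<lambda>n. F (of_real (x n) * cis t)) \<longlonglongrightarrow> L" by (rule filterlim_compose[OF L x1])
      ultimately show ?thesis using True by (simp add: limI)
    next
      case False
      hence "(\<lambda>l. ((\<lambda>r. F (of_real r * cis t)) \<longlongrightarrow> l) (at_left 1)) = (\<lambda>l. False)" unfolding E_def by auto
      thus ?thesis using False unfolding bval_def Topological_Spaces.Lim_def by simp
    qed
  qed
  moreover have "(\<lambda>t. lim (\<lambda>n. F (of_real (x n) * cis t))) \<in> borel_measurable borel"
    by (rule borel_measurable_lim_metric) (use x in auto)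
  ultimately show ?thesis by simp
qed

text \<open>The mean minimises the mean-square deviation: passing from c to m subtracts l * |m -
  c|^2. The bound is assumed as a nonnegative integral, so that the integrability of \<beta> is
  derived here and not presupposed.\<close>

lemma mean_deviation_le:
  fixes \<beta> :: "real \<Rightarrow> complex"
  assumes \<beta> [measurable]: "\<beta> \<in> borel_measurable borel" and l: "0 < l" and D: "0 \<le> D"
    and bound: "(\<integral>\<^sup>+t\<in>{0..l}. ennreal ((cmod (\<beta> t - c))\<^sup>2) \<partial>lborel) \<le> ennreal D"
  defines "m \<equiv> (1 / l) *\<^sub>R (LINT t:{0..l}|lborel. \<beta> t)"
  shows "(LINT t:{0..l}|lborel. (cmod (\<beta> t - m))\<^sup>2) \<le> D"
proof -
  let ?N = "restrict_space lborel {0..l} :: real measure"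
  have eN: "emeasure ?N (space ?N) = ennreal l"
    using l by (simp add: space_restrict_space emeasure_restrict_space)
  interpret finite_measure ?N by (rule finite_measureI) (simp only: eN ennreal_neq_top not_False_eq_True infinity_ennreal_def)
  have mN: "measure ?N (space ?N) = l" unfolding measure_def eN using l by simp
  have [measurable]: "\<beta> \<in> borel_measurable ?N" by (rule measurable_restrict_space1) simp
  have set_int: "(LINT t:{0..l}|lborel. h t) = (LINT t|?N. h t)" for h :: "real \<Rightarrow> 'b::{banach, second_countable_topology}"
    unfolding set_lebesgue_integral_def by (subst integral_restrict_space) auto
  have nnb: "(\<integral>\<^sup>+t. ennreal ((cmod (\<beta> t - c))\<^sup>2) \<partial>?N) \<le> ennreal D"
    using bound by (subst nn_integral_restrict_space) auto
  have i2: "integrable ?N (\<lambda>t. (cmod (\<beta> t - c))\<^sup>2)"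
    by (rule integrableI_bounded) (use nnb in \<open>auto intro: le_less_trans\<close>)
  \<comment> \<open>On a finite measure space a square-integrable function is integrable, by x \<le>
    1 + x^2.\<close>
  have i1: "integrable ?N (\<lambda>t. \<beta> t - c)"
  proof (rule Bochner_Integration.integrable_bound)
    show "integrable ?N (\<lambda>t. 1 + (cmod (\<beta> t - c))\<^sup>2)" using i2 by simp
    have "x \<le> 1 + x\<^sup>2" for x :: real
      using sum_squares_bound[of x 1] zero_le_power2[of x] by (cases "0 \<le> x") (simp_all, smt (verit) zero_le_power2)
    thus "AE t in ?N. norm (\<beta> t - c) \<le> norm (1 + (cmod (\<beta> t - c))\<^sup>2)" by (auto intro: order_trans)
  qed measurable
  have i0: "integrable ?N \<beta>"
  proof -
    have "integrable ?N (\<lambda>t. (\<beta> t - c) + c)" by (intro Bochner_Integration.integrable_add i1) simp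
    thus ?thesis by simp
  qed
  define d where "d = m - c"
  have md: "(LINT t|?N. \<beta> t - c) = l *\<^sub>R d"
  proof -
    have "(LINT t|?N. \<beta> t - c) = (LINT t|?N. \<beta> t) - (LINT t|?N. c)"
      by (intro Bochner_Integration.integral_diff i0) simp
    also have "(LINT t|?N. c) = l *\<^sub>R c" by (simp only: lebesgue_integral_const mN)
    finally show ?thesis
      using l unfolding d_def m_def set_int scaleR_diff_right by simp
  qed
  have pt: "(cmod (\<beta> t - m))\<^sup>2 = (cmod (\<beta> t - c))\<^sup>2 - 2 * Re (cnj d * (\<beta> t - c)) + (cmod d)\<^sup>2" for t
    unfolding d_def cmod_power2 by (simp add: power2_eq_square algebra_simps)
  have iR: "integrable ?N (\<lambda>t. Re (cnj d * (\<beta> t - c)))"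
    by (intro integrable_Re integrable_mult_right i1)
  have "(LINT t:{0..l}|lborel. (cmod (\<beta> t - m))\<^sup>2) = (LINT t|?N. (cmod (\<beta> t - c))\<^sup>2 - 2 * Re (cnj d * (\<beta> t - c)) + (cmod d)\<^sup>2)"
    unfolding set_int pt ..
  also have "\<dots> = (LINT t|?N. (cmod (\<beta> t - c))\<^sup>2) - 2 * (LINT t|?N. Re (cnj d * (\<beta> t - c))) + l * (cmod d)\<^sup>2"
  proof -
    have i2R: "integrable ?N (\<lambda>t. 2 * Re (cnj d * (\<beta> t - c)))" by (intro integrable_mult_right iR)
    have "(LINT t|?N. (cmod (\<beta> t - c))\<^sup>2 - 2 * Re (cnj d * (\<beta> t - c)) + (cmod d)\<^sup>2)
      = (LINT t|?N. (cmod (\<beta> t - c))\<^sup>2 - 2 * Re (cnj d * (\<beta> t - c))) + (LINT t|?N. (cmod d)\<^sup>2)"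
      by (intro Bochner_Integration.integral_add Bochner_Integration.integrable_diff i2 i2R) simp
    also have "(LINT t|?N. (cmod (\<beta> t - c))\<^sup>2 - 2 * Re (cnj d * (\<beta> t - c)))
      = (LINT t|?N. (cmod (\<beta> t - c))\<^sup>2) - (LINT t|?N. 2 * Re (cnj d * (\<beta> t - c)))"
      by (intro Bochner_Integration.integral_diff i2 i2R)
    also have "(LINT t|?N. 2 * Re (cnj d * (\<beta> t - c))) = 2 * (LINT t|?N. Re (cnj d * (\<beta> t - c)))"
      by (rule integral_mult_right_zero)
    also have "(LINT t|?N. (cmod d)\<^sup>2) = l * (cmod d)\<^sup>2"
      by (simp only: lebesgue_integral_const mN real_scaleR_def)
    finally show ?thesis .
  qed
  also have "(LINT t|?N. Re (cnj d * (\<beta> t - c))) = Re (cnj d * (l *\<^sub>R d))"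
    using i1 md by (subst integral_Re) auto
  also have "Re (cnj d * (l *\<^sub>R d)) = l * (cmod d)\<^sup>2"
    unfolding cmod_power2 by (simp add: power2_eq_square algebra_simps)
  also have "(LINT t|?N. (cmod (\<beta> t - c))\<^sup>2) \<le> D"
  proof -
    have "ennreal (LINT t|?N. (cmod (\<beta> t - c))\<^sup>2) = (\<integral>\<^sup>+t. ennreal ((cmod (\<beta> t - c))\<^sup>2) \<partial>?N)"
      by (rule nn_integral_eq_integral[symmetric, OF i2]) auto
    also note nnb
    finally show ?thesis using D by simp
  qed
  finally have "(LINT t:{0..l}|lborel. (cmod (\<beta> t - m))\<^sup>2) \<le> D - 2 * (l * (cmod d)\<^sup>2) + l * (cmod d)\<^sup>2" by simp
  moreover have "0 \<le> l * (cmod d)\<^sup>2" using l by simp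
  ultimately show ?thesis by linarith
qed

text \<open>Fatou's lemma along radii tending to 1. The centre F (r * a) moves with the radius but
  converges to F a, since a is an interior point; the arc mean then does at least as well as the
  centre F a.\<close>

lemma boundary_oscillation_le:
  assumes F: "F holomorphic_on ball 0 1"
    and mean: "\<And>r. 0 < r \<Longrightarrow> r < 1 \<Longrightarrow> integral {0..2*pi} (\<lambda>t. (cmod (F (of_real r * cis t)))\<^sup>2) \<le> B"
    and l: "0 < l" "l \<le> 2 * pi" and D: "0 \<le> D" and a: "cmod a < 1"
    and osc: "\<And>r. 0 < r \<Longrightarrow> r < 1 \<Longrightarrow> integral {0..l} (\<lambda>t. (cmod (F (of_real r * cis t) - F (of_real r * a)))\<^sup>2) \<le> D"
  shows "(LINT t:{0..l}|lborel. (cmod (bval F (cis t) - (1 / l) *\<^sub>R (LINT t:{0..l}|lborel. bval F (cis t))))\<^sup>2) \<le> D"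
proof (rule mean_deviation_le[OF bval_measurable[OF F] l(1) D])
  obtain x :: "nat \<Rightarrow> real" where x: "\<And>n. 0 < x n" "\<And>n. x n < 1" and x1: "filterlim x (at_left 1) sequentially"
    using radii_sequence by metis
  define u where "u n t = ennreal ((cmod (F (of_real (x n) * cis t) - F (of_real (x n) * a)))\<^sup>2) * indicator {0..l} t" for n t
  have contF: "continuous_on S (\<lambda>t. F (of_real (x n) * cis t))" for S n
    by (intro continuous_on_circle holomorphic_on_imp_continuous_on F x)
  have [measurable]: "(\<lambda>t. F (of_real (x n) * cis t)) \<in> borel_measurable borel" for n
    by (intro borel_measurable_continuous_onI contF)
  have [measurable]: "u n \<in> borel_measurable lborel" for n unfolding u_def by measurable
  have uint: "(\<integral>\<^sup>+t. u n t \<partial>lborel) \<le> ennreal D" for n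
  proof -
    have c: "continuous_on {0..l} (\<lambda>t. (cmod (F (of_real (x n) * cis t) - F (of_real (x n) * a)))\<^sup>2)"
      by (intro continuous_intros contF)
    have "(\<integral>\<^sup>+t. u n t \<partial>lborel) = ennreal (integral {0..l} (\<lambda>t. (cmod (F (of_real (x n) * cis t) - F (of_real (x n) * a)))\<^sup>2))"
      unfolding u_def by (intro set_nn_integral_has_integral integrable_integral integrable_continuous_interval c) auto
    also have "\<dots> \<le> ennreal D" by (intro ennreal_leI osc x)
    finally show ?thesis .
  qed
  have lim_a: "(\<lambda>n. F (of_real (x n) * a)) \<longlonglongrightarrow> F a"
  proof -
    have "isCont F a" using holomorphic_on_imp_continuous_on[OF F] a by (simp add: continuous_on_eq_continuous_at)
    moreover have "(\<lambda>n. of_real (x n) * a) \<longlonglongrightarrow> of_real 1 * a"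
      using x1 by (intro tendsto_intros) (simp add: filterlim_at)
    ultimately show ?thesis using isCont_tendsto_compose[of a F] by simp
  qed
  have "AE t in lborel. t \<in> {0..2*pi} \<longrightarrow> (\<exists>L. ((\<lambda>r. F (of_real r * cis t)) \<longlongrightarrow> L) (at_left 1))"
    by (rule AE_radial_limit[OF F mean])
  \<comment> \<open>Wherever the radial limit exists it equals \<open>bval\<close>, and the lower
    limit is an honest limit; off the arc both sides vanish.\<close>
  hence "AE t in lborel. liminf (\<lambda>n. u n t) = ennreal ((cmod (bval F (cis t) - F a))\<^sup>2) * indicator {0..l} t"
  proof eventually_elim
    case (elim t)
    show ?case
    proof (cases "t \<in> {0..l}")
      case True
      with elim l obtain L where L: "((\<lambda>r. F (of_real r * cis t)) \<longlongrightarrow> L) (at_left 1)" by auto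
      have bv: "bval F (cis t) = L" unfolding bval_def by (rule tendsto_Lim[OF _ L]) simp
      have "(\<lambda>n. F (of_real (x n) * cis t)) \<longlonglongrightarrow> L" by (rule filterlim_compose[OF L x1])
      hence "(\<lambda>n. ennreal ((cmod (F (of_real (x n) * cis t) - F (of_real (x n) * a)))\<^sup>2)) \<longlonglongrightarrow> ennreal ((cmod (L - F a))\<^sup>2)"
        by (intro tendsto_ennrealI tendsto_intros lim_a)
      hence "(\<lambda>n. u n t) \<longlonglongrightarrow> ennreal ((cmod (L - F a))\<^sup>2)" unfolding u_def using True by simp
      thus ?thesis using True bv lim_imp_Liminf[of sequentially "\<lambda>n. u n t"] by simp
    next
      case False
      thus ?thesis by (simp add: u_def Liminf_const)
    qed
  qed
  hence "(\<integral>\<^sup>+t\<in>{0..l}. ennreal ((cmod (bval F (cis t) - F a))\<^sup>2) \<partial>lborel) = (\<integral>\<^sup>+t. liminf (\<lambda>n. u n t) \<partial>lborel)"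
    by (intro nn_integral_cong_AE) auto
  also have "\<dots> \<le> liminf (\<lambda>n. \<integral>\<^sup>+t. u n t \<partial>lborel)" by (rule nn_integral_liminf) measurable
  also have "\<dots> \<le> liminf (\<lambda>n. ennreal D)" by (intro Liminf_mono always_eventually allI uint)
  also have "\<dots> = ennreal D" by (simp add: Liminf_const)
  finally show "(\<integral>\<^sup>+t\<in>{0..l}. ennreal ((cmod (bval F (cis t) - F a))\<^sup>2) \<partial>lborel) \<le> ennreal D" .
qed

section \<open>The primitive of f' * g\<close>

lemma Ig_primitive:
  assumes f: "f holomorphic_on ball 0 1" and g: "g holomorphic_on ball 0 1"
  shows "Ig g f holomorphic_on ball 0 1" "Ig g f 0 = 0"
    "\<And>z. cmod z < 1 \<Longrightarrow> deriv (Ig g f) z = deriv f z * g z"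
proof -
  have "(\<lambda>w. deriv f w * g w) holomorphic_on ball 0 1"
    by (intro holomorphic_intros holomorphic_deriv f g) auto
  from holomorphic_convex_primitive'[OF convex_ball open_ball this]
  obtain H where H: "\<And>z. z \<in> ball 0 1 \<Longrightarrow> (H has_field_derivative (deriv f z * g z)) (at z within ball 0 1)" by blast
  have eq: "Ig g f z = H z - H 0" if z: "z \<in> ball 0 1" for z
  proof -
    have "path_image (linepath 0 z) \<subseteq> ball 0 1"
      unfolding path_image_linepath using z by (intro closed_segment_subset) auto
    hence "((\<lambda>w. deriv f w * g w) has_contour_integral (H z - H 0)) (linepath 0 z)"
      using contour_integral_primitive[OF H valid_path_linepath] by fastforce
    thus ?thesis unfolding Ig_def by (rule contour_integral_unique)
  qed
  have D: "(Ig g f has_field_derivative (deriv f z * g z)) (at z)" if z: "z \<in> ball 0 1" for z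
  proof (rule has_field_derivative_transform_within_open[OF _ open_ball z])
    have "(H has_field_derivative (deriv f z * g z)) (at z)"
      using H[OF z] z by (simp add: at_within_open[OF z open_ball])
    thus "((\<lambda>z. H z - H 0) has_field_derivative (deriv f z * g z)) (at z)"
      by (auto intro!: derivative_eq_intros)
  qed (use eq in auto)
  show "Ig g f holomorphic_on ball 0 1"
    unfolding holomorphic_on_def using D field_differentiable_def field_differentiable_at_within by blast
  show "Ig g f 0 = 0" using eq[of 0] by simp
  show "deriv (Ig g f) z = deriv f z * g z" if "cmod z < 1" for z
    using D[of z] that by (auto intro: DERIV_imp_deriv)
qed

section \<open>The integral operator\<close>

lemma arc_int_shift:
  fixes h :: "complex \<Rightarrow> 'b::{banach,second_countable_topology}"
  assumes "0 < l"
  shows "arc_int a l h = (1 / (2*pi)) *\<^sub>R (LINT t:{0..l}|lborel. h (cis a * cis t))"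
proof -
  have "(LBINT t=a..a+l. h (cis t)) = (LBINT t:{a..a+l}. h (cis t))"
    using assms by (intro interval_integral_Icc) simp
  also have "\<dots> = (LBINT t. indicator {a..a+l} (a + 1 * t) *\<^sub>R h (cis (a + 1 * t)))"
    unfolding set_lebesgue_integral_def by (subst lborel_integral_real_affine[of 1 _ a]) simp_all
  also have "\<dots> = (LINT t:{0..l}|lborel. h (cis a * cis t))"
    unfolding set_lebesgue_integral_def
    by (intro Bochner_Integration.integral_cong) (auto simp: indicator_def cis_mult)
  finally show ?thesis unfolding arc_int_def by simp
qed

lemma arc_mean_shift:
  assumes "0 < l"
  shows "arc_mean a l h = (1 / l) *\<^sub>R (LINT t:{0..l}|lborel. h (cis a * cis t))"
  unfolding arc_mean_def arc_int_shift[OF assms] arc_len_def using assms by simp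

lemma hardy_mean_eq_integral:
  assumes f: "f holomorphic_on ball 0 1" and q: "0 < q" and r: "0 < r" "r < 1"
  shows "hardy_mean q f r = (1 / (2*pi)) * integral {0..2*pi} (\<lambda>t. cmod (f (of_real r * cis t)) powr q)"
proof -
  have c: "continuous_on {0..2*pi} (\<lambda>t. cmod (f (of_real r * cis t)) powr q)"
    using q by (intro continuous_on_powr' continuous_intros continuous_on_circle holomorphic_on_imp_continuous_on f r) auto
  have "(LBINT t=0..2*pi. cmod (f (of_real r * cis t)) powr q) = (LBINT t=ereal 0..ereal (2*pi). cmod (f (of_real r * cis t)) powr q)"
    by (simp add: zero_ereal_def)
  also have "\<dots> = integral {0..2*pi} (\<lambda>t. cmod (f (of_real r * cis t)) powr q)"
    by (intro interval_integral_eq_integral borel_integrable_atLeastAtMost' c) simp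
  finally show ?thesis unfolding hardy_mean_def by simp
qed

lemma hardy_mean_nonneg:
  assumes f: "f holomorphic_on ball 0 1" and q: "0 < q" and r: "0 < r" "r < 1"
  shows "0 \<le> hardy_mean q f r"
  unfolding hardy_mean_eq_integral[OF assms]
proof (intro mult_nonneg_nonneg integral_nonneg)
  show "(\<lambda>t. cmod (f (of_real r * cis t)) powr q) integrable_on {0..2*pi}"
    using q by (intro integrable_continuous_interval continuous_on_powr' continuous_intros
      continuous_on_circle holomorphic_on_imp_continuous_on f r) auto
qed auto

lemma hardy_norm_nonneg: "f \<in> hardy p \<Longrightarrow> 0 \<le> hardy_norm p f"
proof (cases "p = \<infinity>")
  case True
  assume "f \<in> hardy p"
  hence "bdd_above ((\<lambda>z. cmod (f z)) ` ball 0 1)"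
    using True unfolding hardy_def bounded_iff bdd_above_def by auto
  hence "cmod (f 0) \<le> (SUP z\<in>ball 0 1. cmod (f z))" by (intro cSUP_upper) auto
  from order_trans[OF norm_ge_zero this] show ?thesis using True unfolding hardy_norm_def by simp
qed (simp add: hardy_norm_def)

lemma hardy_imp_hardy_le:
  assumes p: "2 < p" and f: "f \<in> hardy p" and A: "hardy_norm p f < A"
  shows "hardy_le (real_of_ereal p) A f"
proof -
  have A0: "0 < A" using hardy_norm_nonneg[OF f] A by linarith
  have hol: "f holomorphic_on ball 0 1" using f unfolding hardy_def by auto
  show ?thesis
  proof (cases "p = \<infinity>")
    case True
    have bdd: "bdd_above ((\<lambda>z. cmod (f z)) ` ball 0 1)"
      using f True unfolding hardy_def bounded_iff bdd_above_def by auto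
    have "cmod (f z) \<le> A" if "z \<in> ball 0 1" for z
      using cSUP_upper[OF that bdd] A True unfolding hardy_norm_def by simp
    thus ?thesis unfolding hardy_le_def using True hol A0 by simp
  next
    case False
    define q where "q = real_of_ereal p"
    have q: "2 < q" using p False unfolding q_def by (cases p) auto
    define S where "S = (SUP r\<in>{0<..<1}. hardy_mean q f r)"
    have bdd: "bdd_above (hardy_mean q f ` {0<..<1})" using f False unfolding hardy_def q_def by auto
    have mean: "hardy_mean q f r \<le> S" if "r \<in> {0<..<1}" for r
      unfolding S_def by (rule cSUP_upper[OF that bdd])
    have "0 \<le> hardy_mean q f (1/2)" using q by (intro hardy_mean_nonneg hol) auto
    hence S0: "0 \<le> S" using mean[of "1/2"] by simp
    have "S powr (1 / q) < A" using A False unfolding hardy_norm_def S_def q_def by simp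
    hence "(S powr (1 / q)) powr q \<le> A powr q" using q by (intro powr_mono2) auto
    hence SA: "S \<le> A powr q" using q S0 by (simp add: powr_powr)
    have "integral {0..2*pi} (\<lambda>t. cmod (f (of_real r * cis t)) powr q) \<le> 2 * pi * A powr q" if r: "r \<in> {0<..<1}" for r
    proof -
      have "(1 / (2*pi)) * integral {0..2*pi} (\<lambda>t. cmod (f (of_real r * cis t)) powr q) \<le> A powr q"
        using mean[OF r] SA q r by (subst (asm) hardy_mean_eq_integral[OF hol]) auto
      thus ?thesis by (simp add: field_simps)
    qed
    thus ?thesis unfolding hardy_le_def q_def[symmetric] using q hol A0 by simp
  qed
qed

text \<open>The centre (1 - L) * cis (\<alpha> + l/2) lies over the midpoint of the arc, and l/2 =
  \<pi> L is the largest angular distance from it.\<close>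

lemma carleson_box_near:
  assumes l: "0 < l" "l \<le> 2 * pi" and z: "z \<in> carleson_box \<alpha> l"
  defines "L \<equiv> l / (2 * pi)"
  shows "cmod z < 1 \<and> 1 - L \<le> cmod z \<and> cmod (1 - cnj (of_real (1 - L) * cis (\<alpha> + l / 2)) * z) \<le> 6 * L"
proof -
  have L: "0 < L" "L \<le> 1" unfolding L_def using l by auto
  obtain t where t: "t \<in> {\<alpha>..\<alpha>+l}" "z / of_real (cmod z) = cis t"
    using z unfolding carleson_box_def arc_def by auto
  \<comment> \<open>For the full circle the modulus condition admits the origin; it is excluded
    because 0/0 = 0 is not on the arc.\<close>
  have "z \<noteq> 0" using t(2) by auto
  hence ze: "of_real (cmod z) * cis t = z" using t(2) by (simp add: field_simps)
  have z': "1 - L \<le> cmod z" "cmod z < 1" using z unfolding carleson_box_def arc_len_def L_def by auto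
  have "\<bar>t - (\<alpha> + l / 2)\<bar> \<le> pi * L" unfolding L_def using t(1) by (auto simp: abs_le_iff field_simps)
  from kernel_near_arc[OF L z'(1) _ this] z'(2) show ?thesis using z' unfolding ze by simp
qed

text \<open>The supremum of |g| comes out of the area integral as K^2, and the rest is the box
  estimate for f with \<kappa> = 6. The factor is 4 * (2 * 6^2 + 8) = 320 after division by \<pi>;
  the powers of the arc length cancel exactly.\<close>

lemma morrey_area_sup_Ig_le:
  assumes f: "hardy_le q A f" and q: "q = 0 \<or> 2 < q" and K: "0 \<le> K"
    and g: "g holomorphic_on ball 0 1" "\<And>z. cmod z < 1 \<Longrightarrow> cmod (g z) \<le> K"
  shows "morrey_area_sup (1 - 2 / q) (Ig g f) \<le> ennreal (320 * K\<^sup>2 * A\<^sup>2)"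
  unfolding morrey_area_sup_def
proof (rule SUP_least, clarify)
  fix \<alpha> l :: real assume "(\<alpha>, l) \<in> arc_params"
  hence l: "0 < l" "l \<le> 2 * pi" unfolding arc_params_def by auto
  have hol: "f holomorphic_on ball 0 1" using f unfolding hardy_le_def by auto
  define L where "L = l / (2 * pi)"
  have L: "0 < L" "L \<le> 1" unfolding L_def using l by auto
  define a where "a = complex_of_real (1 - L) * cis (\<alpha> + l / 2)"
  have a: "cmod a = 1 - L" unfolding a_def norm_mult norm_of_real norm_cis using L by simp
  \<comment> \<open>A superset of the box given by inequalities between continuous functions, so its
    measurability is visible.\<close>
  define S where "S = {z. cmod z < 1 \<and> 1 - L \<le> cmod z \<and> cmod (1 - cnj a * z) \<le> 6 * L}"
  have box: "carleson_box \<alpha> l \<subseteq> S"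
    using carleson_box_near[OF l] unfolding S_def a_def L_def by blast
  have Sb [measurable]: "S \<in> sets borel" unfolding S_def by measurable
  have est: "lp_integral S f
    \<le> ennreal (4 * pi * (2 * 6\<^sup>2 + 8) * A\<^sup>2 * L powr (1 - 2 / q))"
    by (rule carleson_estimate[OF f q L a]) (auto simp: S_def)
  have "(\<lambda>z. ennreal (lp_density f z) * indicator S z) \<in> borel_measurable borel"
    by (rule measurable_square_indicator[OF continuous_on_subset[OF holomorphic_on_imp_continuous_on[OF holomorphic_deriv[OF hol open_ball]]]])
       (auto simp: S_def)
  hence m: "(\<lambda>z. ennreal (lp_density f z) * indicator S z) \<in> borel_measurable lborel" by simp
  have "lp_integral (carleson_box \<alpha> l) (Ig g f)
     \<le> (\<integral>\<^sup>+z. ennreal (K\<^sup>2) * (ennreal (lp_density f z) * indicator S z) \<partial>lborel)"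
  proof (rule nn_integral_mono)
    fix z
    show "ennreal (lp_density (Ig g f) z) * indicator (carleson_box \<alpha> l) z
      \<le> ennreal (K\<^sup>2) * (ennreal (lp_density f z) * indicator S z)"
    proof (cases "z \<in> carleson_box \<alpha> l")
      case True
      hence zS: "z \<in> S" using box by blast
      hence z: "cmod z < 1" unfolding S_def by simp
      have nn: "0 \<le> 1 - (cmod z)\<^sup>2" using z by (simp add: power_le_one)
      have "(cmod (g z))\<^sup>2 \<le> K\<^sup>2" by (intro power_mono g z) auto
      hence "(cmod (g z))\<^sup>2 * lp_density f z \<le> K\<^sup>2 * lp_density f z"
        using nn by (intro mult_right_mono) auto
      hence "lp_density (Ig g f) z \<le> K\<^sup>2 * lp_density f z"
        unfolding Ig_primitive(3)[OF hol g(1) z] by (simp add: norm_mult power_mult_distrib mult_ac)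
      hence "ennreal (lp_density (Ig g f) z) \<le> ennreal (K\<^sup>2) * ennreal (lp_density f z)"
        using ennreal_leI by (subst ennreal_mult'[symmetric]) auto
      thus ?thesis using True zS by simp
    qed simp
  qed
  also have "\<dots> = ennreal (K\<^sup>2) * lp_integral S f"
    by (rule nn_integral_cmult[OF m])
  also have "\<dots> \<le> ennreal (K\<^sup>2) * ennreal (4 * pi * (2 * 6\<^sup>2 + 8) * A\<^sup>2 * L powr (1 - 2 / q))"
    by (rule mult_left_mono[OF est]) simp
  also have "\<dots> = ennreal (K\<^sup>2 * (4 * pi * (2 * 6\<^sup>2 + 8) * A\<^sup>2 * L powr (1 - 2 / q)))"
    by (rule ennreal_mult'[symmetric]) simp
  also have "K\<^sup>2 * (4 * pi * (2 * 6\<^sup>2 + 8) * A\<^sup>2 * L powr (1 - 2 / q)) = pi * (320 * K\<^sup>2 * A\<^sup>2 * L powr (1 - 2 / q))" by simp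
  finally have I: "lp_integral (carleson_box \<alpha> l) (Ig g f) / ennreal pi
     \<le> ennreal (pi * (320 * K\<^sup>2 * A\<^sup>2 * L powr (1 - 2 / q))) / ennreal pi"
    by (rule divide_right_mono_ennreal)
  also have "\<dots> = ennreal (320 * K\<^sup>2 * A\<^sup>2 * L powr (1 - 2 / q))"
    by (subst divide_ennreal) auto
  finally have "ennreal (arc_len l powr - (1 - 2 / q)) *
      (lp_integral (carleson_box \<alpha> l) (Ig g f) / ennreal pi)
      \<le> ennreal (arc_len l powr - (1 - 2 / q)) * ennreal (320 * K\<^sup>2 * A\<^sup>2 * L powr (1 - 2 / q))"
    by (rule mult_left_mono) simp
  also have "\<dots> = ennreal (arc_len l powr - (1 - 2 / q) * (320 * K\<^sup>2 * A\<^sup>2 * L powr (1 - 2 / q)))"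
    by (rule ennreal_mult'[symmetric]) simp
  also have "arc_len l powr - (1 - 2 / q) * (320 * K\<^sup>2 * A\<^sup>2 * L powr (1 - 2 / q)) = 320 * K\<^sup>2 * A\<^sup>2"
    using L unfolding arc_len_def L_def[symmetric] powr_minus by (simp add: field_simps)
  finally show "ennreal (arc_len l powr - (1 - 2 / q)) *
      (lp_integral (carleson_box \<alpha> l) (Ig g f) / ennreal pi)
      \<le> ennreal (320 * K\<^sup>2 * A\<^sup>2)" .
qed

lemma bval_rotate: "bval (\<lambda>z. F (cis \<alpha> * z)) \<zeta> = bval F (cis \<alpha> * \<zeta>)"
  unfolding bval_def by (simp add: mult.left_commute)

text \<open>The estimate for arcs is made for the rotated pair, whose arc is [0, l], and transferred
  back through the boundary values. Normalising the arc integral divides 16 \<pi> * 6^2 by 2 \<pi>,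
  whence 288.\<close>

lemma Ig_in_morrey:
  assumes f: "hardy_le q A f" and q: "q = 0 \<or> 2 < q" and K: "0 \<le> K"
    and g: "g holomorphic_on ball 0 1" "\<And>z. cmod z < 1 \<Longrightarrow> cmod (g z) \<le> K"
  shows "Ig g f \<in> morrey (1 - 2 / q)"
proof -
  have hol: "f holomorphic_on ball 0 1" using f unfolding hardy_le_def by auto
  define F where "F = Ig g f"
  have F: "F holomorphic_on ball 0 1" "F 0 = 0" unfolding F_def by (rule Ig_primitive[OF hol g(1)])+
  have dom: "cmod (deriv F z) \<le> K * cmod (deriv f z)" if z: "cmod z < 1" for z
    unfolding F_def Ig_primitive(3)[OF hol g(1) z] norm_mult
    using mult_right_mono[OF g(2)[OF z], of "cmod (deriv f z)"] by (simp add: mult.commute)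
  \<comment> \<open>The case L = 1, a = 0: the Poisson kernel is constant and F 0 = 0, so this
    bounds the mean squares of F itself.\<close>
  define B where "B = 8 * pi * K\<^sup>2 * A\<^sup>2 * (2 / 1) powr (2 / q)"
  have mean: "integral {0..2*pi} (\<lambda>t. (cmod (F (of_real r * cis t)))\<^sup>2) \<le> B" if r: "0 < r" "r < 1" for r
    using poisson_oscillation_hardy[OF f F(1) K dom r, of 1 0] F(2) unfolding B_def by (simp add: pker_def)
  have hardy2: "F \<in> hardy 2"
  proof -
    have "hardy_mean 2 F r \<le> B / (2 * pi)" if r: "r \<in> {0<..<1}" for r
    proof -
      have "hardy_mean 2 F r = (1 / (2*pi)) * integral {0..2*pi} (\<lambda>t. (cmod (F (of_real r * cis t)))\<^sup>2)"
        using r by (subst hardy_mean_eq_integral[OF F(1)]) auto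
      also have "\<dots> \<le> (1 / (2*pi)) * B" using r by (intro mult_left_mono mean) auto
      finally show ?thesis by simp
    qed
    hence "bdd_above (hardy_mean 2 F ` {0<..<1})" by (intro bdd_aboveI2)
    thus ?thesis unfolding hardy_def using F(1) by simp
  qed
  have bound: "sqrt (arc_len l powr - (1 - 2 / q) * arc_int \<alpha> l (\<lambda>\<zeta>. (cmod (bval F \<zeta> - arc_mean \<alpha> l (bval F)))\<^sup>2)) \<le> sqrt (288 * K\<^sup>2 * A\<^sup>2)"
    if l: "0 < l" "l \<le> 2 * pi" for \<alpha> l
  proof -
    define L where "L = l / (2 * pi)"
    have L: "0 < L" "L \<le> 1" unfolding L_def using l by auto
    define a where "a = complex_of_real (1 - L) * cis (l / 2)"
    have a: "cmod a = 1 - L" unfolding a_def norm_mult norm_of_real norm_cis using L by simp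
    define Fr where "Fr z = F (cis \<alpha> * z)" for z
    define fr where "fr z = f (cis \<alpha> * z)" for z
    have Fr: "Fr holomorphic_on ball 0 1" unfolding Fr_def by (rule holomorphic_rotate(1)[OF F(1)])
    have fr: "hardy_le q A fr" unfolding fr_def by (rule hardy_le_rotate[OF f])
    have domr: "cmod (deriv Fr z) \<le> K * cmod (deriv fr z)" if z: "cmod z < 1" for z
      unfolding Fr_def fr_def holomorphic_rotate(2)[OF F(1) z] holomorphic_rotate(2)[OF hol z] norm_mult norm_cis
      using dom[of "cis \<alpha> * z"] z by (simp add: norm_mult)
    have meanr: "integral {0..2*pi} (\<lambda>t. (cmod (Fr (of_real r * cis t)))\<^sup>2) \<le> B" if r: "0 < r" "r < 1" for r
      using poisson_oscillation_hardy[OF fr Fr K domr r, of 1 0] F(2) unfolding B_def by (simp add: pker_def Fr_def)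
    define D where "D = 16 * pi * 6\<^sup>2 * K\<^sup>2 * A\<^sup>2 * L powr (1 - 2 / q)"
    have D: "0 \<le> D" unfolding D_def by simp
    have osc: "integral {0..l} (\<lambda>t. (cmod (Fr (of_real r * cis t) - Fr (of_real r * a)))\<^sup>2) \<le> D" if r: "0 < r" "r < 1" for r
      unfolding D_def
    proof (rule arc_oscillation[OF fr q Fr K domr r L a])
      fix t assume t: "t \<in> {0..l}"
      have "\<bar>t - l / 2\<bar> \<le> pi * L" unfolding L_def using t by (auto simp: abs_le_iff field_simps)
      from kernel_near_arc[OF L _ _ this, of 1] show "cmod (1 - cnj a * cis t) \<le> 6 * L"
        unfolding a_def using L by simp
    qed (use l in auto)
    have "(LINT t:{0..l}|lborel. (cmod (bval Fr (cis t) - (1 / l) *\<^sub>R (LINT t:{0..l}|lborel. bval Fr (cis t))))\<^sup>2) \<le> D"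
      by (rule boundary_oscillation_le[OF Fr meanr l D _ osc]) (use a L in auto)
    hence "(1 / (2*pi)) * (LINT t:{0..l}|lborel. (cmod (bval F (cis \<alpha> * cis t) - arc_mean \<alpha> l (bval F)))\<^sup>2) \<le> (1 / (2*pi)) * D"
      unfolding arc_mean_shift[OF l(1)] Fr_def bval_rotate by (intro mult_left_mono) auto
    hence "arc_int \<alpha> l (\<lambda>\<zeta>. (cmod (bval F \<zeta> - arc_mean \<alpha> l (bval F)))\<^sup>2) \<le> 288 * K\<^sup>2 * A\<^sup>2 * L powr (1 - 2 / q)"
      unfolding arc_int_shift[OF l(1)] D_def by (simp add: mult_ac)
    hence "arc_len l powr - (1 - 2 / q) * arc_int \<alpha> l (\<lambda>\<zeta>. (cmod (bval F \<zeta> - arc_mean \<alpha> l (bval F)))\<^sup>2)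
      \<le> arc_len l powr - (1 - 2 / q) * (288 * K\<^sup>2 * A\<^sup>2 * L powr (1 - 2 / q))"
      by (intro mult_left_mono) auto
    also have "\<dots> = 288 * K\<^sup>2 * A\<^sup>2"
      using L unfolding arc_len_def L_def[symmetric] powr_minus by (simp add: field_simps)
    finally show ?thesis by (rule real_sqrt_le_mono)
  qed
  have "bdd_above ((\<lambda>(a, l). sqrt (arc_len l powr (- (1 - 2 / q)) *
        arc_int a l (\<lambda>\<zeta>. cmod (bval F \<zeta> - arc_mean a l (bval F)) ^ 2))) ` arc_params)"
    by (rule bdd_aboveI2[where M = "sqrt (288 * K\<^sup>2 * A\<^sup>2)"]) (use bound in \<open>auto simp: arc_params_def\<close>)
  thus ?thesis using hardy2 unfolding F_def[symmetric] morrey_def by simp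
qed

section \<open>Test functions\<close>

text \<open>After scaling to the unit disc, the area integral of |h|^2 is a series of nonnegative
  terms; the term n = 0 alone is \<pi> |g a|^2.\<close>

lemma nn_integral_disc_ge:
  assumes g: "g holomorphic_on ball 0 1" and \<rho>: "0 < \<rho>" and sub: "cmod a + \<rho> \<le> 1"
  shows "ennreal (pi * \<rho>\<^sup>2 * (cmod (g a))\<^sup>2) \<le> (\<integral>\<^sup>+z\<in>ball a \<rho>. ennreal ((cmod (g z))\<^sup>2) \<partial>lborel)"
proof -
  define h where "h w = g (a + of_real \<rho> * w)" for w
  have im: "a + of_real \<rho> * w \<in> ball 0 1" if "w \<in> ball 0 1" for w
  proof -
    have "cmod (a + of_real \<rho> * w) \<le> cmod a + \<rho> * cmod w"
      using norm_triangle_ineq[of a "of_real \<rho> * w"] \<rho> by (simp add: norm_mult)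
    also have "\<dots> < cmod a + \<rho>" using that \<rho> by simp
    finally show ?thesis using sub by simp
  qed
  have h: "h holomorphic_on ball 0 1"
  proof -
    have "(\<lambda>w. a + of_real \<rho> * w) holomorphic_on ball 0 1" by (intro holomorphic_intros)
    from holomorphic_on_compose_gen[OF this g] show ?thesis using im unfolding h_def o_def by blast
  qed
  obtain b where b: "\<And>z. cmod z < 1 \<Longrightarrow> (\<lambda>n. b n * z ^ n) sums h z"
    using holomorphic_power_series_0[OF h] by metis
  have b0: "b 0 = g a" using b[of 0] by (simp add: h_def powser_sums_zero_iff)
  have mean: "(\<integral>\<^sup>+z\<in>ball 0 1. ennreal ((cmod (h z))\<^sup>2 * 1) \<partial>lborel)
     = (\<Sum>n. ennreal (pi * (cmod (b n))\<^sup>2) * (\<integral>\<^sup>+s\<in>{0..1}. ennreal (s ^ n * 1) \<partial>lborel))"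
    by (rule nn_integral_disc_square[OF b, of "\<lambda>_. 1"]) (auto intro: holomorphic_on_imp_continuous_on h)
  have "(\<Sum>n\<in>{0}. ennreal (pi * (cmod (b n))\<^sup>2) * (\<integral>\<^sup>+s\<in>{0..1}. ennreal (s ^ n * 1) \<partial>lborel))
     \<le> (\<integral>\<^sup>+z\<in>ball 0 1. ennreal ((cmod (h z))\<^sup>2 * 1) \<partial>lborel)"
    unfolding mean by (intro sum_le_suminf) (auto intro: summableI)
  hence le: "ennreal (pi * (cmod (g a))\<^sup>2) \<le> (\<integral>\<^sup>+z\<in>ball 0 1. ennreal ((cmod (h z))\<^sup>2) \<partial>lborel)"
    using b0 by simp
  define u where "u z = ennreal ((cmod (g z))\<^sup>2) * indicator (ball a \<rho>) z" for z
  have u [measurable]: "u \<in> borel_measurable borel"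
  proof -
    have "ball a \<rho> \<subseteq> ball 0 1"
    proof
      fix z assume "z \<in> ball a \<rho>"
      hence "cmod (z - a) < \<rho>" by (simp add: dist_norm norm_minus_commute)
      thus "z \<in> ball 0 1" using sub norm_triangle_ineq[of a "z - a"] by simp
    qed
    hence "continuous_on (ball a \<rho>) g"
      by (rule continuous_on_subset[OF holomorphic_on_imp_continuous_on[OF g]])
    from measurable_square_indicator[OF this, of "\<lambda>_. 1"] show ?thesis unfolding u_def by simp
  qed
  have ub: "u (a + \<rho> *\<^sub>R w) = ennreal ((cmod (h w))\<^sup>2) * indicator (ball 0 1) w" for w
    unfolding u_def h_def using \<rho> by (auto simp: indicator_def scaleR_conv_of_real dist_norm norm_mult)
  have "(\<integral>\<^sup>+z. u z \<partial>lborel) = (\<integral>\<^sup>+z. u z \<partial>density (distr lborel borel (\<lambda>x. a + \<rho> *\<^sub>R x)) (\<lambda>_. ennreal (\<bar>\<rho>\<bar> ^ DIM(complex))))"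
    using \<rho> by (subst lborel_affine[of \<rho> a]) auto
  also have "\<dots> = ennreal (\<rho>\<^sup>2) * (\<integral>\<^sup>+w. u (a + \<rho> *\<^sub>R w) \<partial>lborel)"
    using \<rho> by (subst nn_integral_density, simp, simp, subst nn_integral_cmult, simp, subst nn_integral_distr) auto
  also have "\<dots> = ennreal (\<rho>\<^sup>2) * (\<integral>\<^sup>+w\<in>ball 0 1. ennreal ((cmod (h w))\<^sup>2) \<partial>lborel)"
    unfolding ub ..
  also have "\<dots> \<ge> ennreal (\<rho>\<^sup>2) * ennreal (pi * (cmod (g a))\<^sup>2)" by (rule mult_left_mono[OF le]) simp
  also have "ennreal (\<rho>\<^sup>2) * ennreal (pi * (cmod (g a))\<^sup>2) = ennreal (pi * \<rho>\<^sup>2 * (cmod (g a))\<^sup>2)"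
    by (subst ennreal_mult[symmetric]) (auto simp: mult_ac)
  finally show ?thesis unfolding u_def .
qed

text \<open>Write \<delta> = 1 - |a|. Radially, |z| is at least 1 - 3\<delta>/2, which exceeds 1 - L
  = 1 - 2\<delta>. Angularly, |z/a - 1| < \<delta> \<le> 1/2, so the argument of z/a is at most
  2\<delta> = L in modulus, by the estimate for the logarithm near 1. The condition |a| \<ge> 1/2
  also keeps L \<le> 1.\<close>

lemma disc_subset_carleson_box:
  assumes a: "1 / 2 \<le> cmod a" "cmod a < 1" and z: "z \<in> ball a ((1 - cmod a) / 2)"
  defines "L \<equiv> 2 * (1 - cmod a)"
  shows "z \<in> carleson_box (Arg a - pi * L) (2 * pi * L)"
proof -
  define \<delta> where "\<delta> = 1 - cmod a"
  have \<delta>: "0 < \<delta>" "\<delta> \<le> 1 / 2" "cmod a = 1 - \<delta>" "L = 2 * \<delta>" unfolding \<delta>_def L_def using a by auto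
  have za: "cmod (z - a) < \<delta> / 2" using z unfolding \<delta>_def by (simp add: dist_norm norm_minus_commute)
  have zl: "cmod z \<ge> 1 - 3 / 2 * \<delta>" using norm_triangle_ineq2[of a "a - z"] za \<delta>(3) by (simp add: norm_minus_commute)
  have zu: "cmod z < 1" using norm_triangle_ineq[of a "z - a"] za \<delta> by simp
  have z0: "z \<noteq> 0" using zl \<delta> by auto
  have a0: "a \<noteq> 0" using a by auto
  define s where "s = Arg (z / a)"
  have cs: "cis s = sgn (z / a)" unfolding s_def using z0 a0 by (intro cis_Arg) auto
  have ca: "cis (Arg a) = sgn a" using a0 by (rule cis_Arg)
  have zs: "z / of_real (cmod z) = cis (Arg a + s)"
  proof -
    have "cis (Arg a + s) = sgn a * sgn (z / a)" by (simp only: cis_mult[symmetric] cs ca)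
    also have "\<dots> = z / of_real (cmod z)" using a0 z0 by (simp add: sgn_eq norm_divide)
    finally show ?thesis ..
  qed
  have "cmod (z / a - 1) = cmod (z - a) / cmod a"
    using a0 by (simp add: norm_divide[symmetric] diff_divide_distrib)
  also have "\<dots> < (\<delta> / 2) / (1 / 2)" using za a \<delta> by (intro frac_less) auto
  finally have near: "cmod (z / a - 1) < \<delta>" by simp
  have "\<bar>s\<bar> \<le> cmod (Ln (1 + (z / a - 1)))"
    unfolding s_def using z0 a0 abs_Im_le_cmod[of "Ln (z / a)"] by (simp add: Arg_eq_Im_Ln)
  also have "\<dots> \<le> 2 * cmod (z / a - 1)" using near \<delta> by (intro norm_Ln_le) auto
  also have "\<dots> \<le> L" using near \<delta> by simp
  also have "L \<le> pi * L" using \<delta> pi_ge_two mult_right_mono[of 1 pi L] by simp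
  finally have s_le: "\<bar>s\<bar> \<le> pi * L" .
  have "Arg a + s \<in> {Arg a - pi * L..Arg a - pi * L + 2 * pi * L}"
    using s_le unfolding atLeastAtMost_iff mult.assoc by linarith
  hence "z / of_real (cmod z) \<in> arc (Arg a - pi * L) (2 * pi * L)" unfolding arc_def zs by blast
  thus ?thesis unfolding carleson_box_def arc_len_def using zl zu \<delta> by simp
qed

text \<open>The Cauchy kernel at a, scaled to Hardy norm at most 1. For \<open>q = 0\<close> the
  power is 1 - |a|^2 itself, the right scaling for bounded functions.\<close>

definition test_fun :: "real \<Rightarrow> complex \<Rightarrow> complex \<Rightarrow> complex" where
  "test_fun q a z = of_real ((1 - (cmod a)\<^sup>2) powr (1 - 1 / q) / 2) / (1 - cnj a * z)"

lemma test_fun_holomorphic: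
  assumes "cmod a < 1" shows "test_fun q a holomorphic_on ball 0 1"
  unfolding test_fun_def using one_minus_cnj_mult_nonzero[OF assms]
  by (intro holomorphic_intros) auto

lemma deriv_test_fun:
  assumes "cmod a < 1" "cmod z < 1"
  shows "deriv (test_fun q a) z = of_real ((1 - (cmod a)\<^sup>2) powr (1 - 1 / q) / 2) * cnj a / (1 - cnj a * z)\<^sup>2"
proof -
  have nz: "1 - cnj a * z \<noteq> 0" using one_minus_cnj_mult_nonzero[OF assms(1)] assms(2) by simp
  have "((\<lambda>z. c / (1 - cnj a * z)) has_field_derivative (c * cnj a / (1 - cnj a * z)\<^sup>2)) (at z)" for c
    using nz by (auto intro!: derivative_eq_intros simp: power2_eq_square)
  thus ?thesis unfolding test_fun_def by (rule DERIV_imp_deriv)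
qed

text \<open>The kernel has modulus at least d/2 with d = 1 - |a|^2, so q - 2 of its powers are
  traded for powers of d/2, and the remaining square integrates explicitly through the Poisson
  kernel. The factor 2^(-q) from the normalisation meets 2^(q-2) from the trade and leaves
  1/4.\<close>

lemma test_fun_hardy_mean:
  assumes a: "cmod a < 1" and q: "2 < q" and r: "0 < r" "r < 1"
  shows "hardy_mean q (test_fun q a) r \<le> 1"
proof -
  define d where "d = 1 - (cmod a)\<^sup>2"
  have d: "0 < d" unfolding d_def using a by (simp add: abs_square_less_1)
  have "d = (1 - cmod a) * (1 + cmod a)" unfolding d_def by (simp add: power2_eq_square algebra_simps)
  also have "\<dots> \<le> (1 - cmod a) * 2" using a by (intro mult_left_mono) auto
  finally have d2: "d \<le> 2 * (1 - cmod a)" by simp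
  define v where "v t = cmod (1 - cnj a * (of_real r * cis t))" for t
  have v: "1 - cmod a \<le> v t" for t
  proof -
    have "cmod a * r \<le> cmod a" using r by (simp add: mult_left_le)
    thus ?thesis unfolding v_def using norm_triangle_ineq2[of 1 "cnj a * (of_real r * cis t)"] r by (simp add: norm_mult)
  qed
  have vd: "d / 2 \<le> v t" for t using v[of t] d2 by simp
  have v0: "0 < v t" for t using vd[of t] d by linarith
  have ar: "cmod (of_real r * a) < 1" "cmod (of_real r * a) \<le> cmod a"
    using a r by (auto simp: norm_mult mult_left_le_one_le intro: le_less_trans[of _ "cmod a"])
  have pk: "1 / (v t)\<^sup>2 = pker (of_real r * a) t / (1 - (cmod (of_real r * a))\<^sup>2)" for t
  proof -
    have "1 - (cmod (of_real r * a))\<^sup>2 \<noteq> 0" using ar abs_square_less_1[of "cmod (of_real r * a)"] by simp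
    thus ?thesis unfolding v_def pker_def by (simp add: mult_ac)
  qed
  have "((\<lambda>t. 1 / (v t)\<^sup>2) has_integral (2 * pi / (1 - (cmod (of_real r * a))\<^sup>2))) {0..2*pi}"
    unfolding pk by (intro has_integral_divide poisson_kernel_integral ar)
  hence iv: "(\<lambda>t. 1 / (v t)\<^sup>2) integrable_on {0..2*pi}"
    and ivv: "integral {0..2*pi} (\<lambda>t. 1 / (v t)\<^sup>2) = 2 * pi / (1 - (cmod (of_real r * a))\<^sup>2)"
    by (auto simp: integral_unique)
  have "(cmod (of_real r * a))\<^sup>2 \<le> (cmod a)\<^sup>2" "(cmod (of_real r * a))\<^sup>2 < 1"
    using ar abs_square_less_1[of "cmod (of_real r * a)"] by (auto intro: power_mono)
  hence ivle: "integral {0..2*pi} (\<lambda>t. 1 / (v t)\<^sup>2) \<le> 2 * pi / d"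
    unfolding ivv using d unfolding d_def by (intro divide_left_mono mult_pos_pos) auto
  have pt: "cmod (test_fun q a (of_real r * cis t)) powr q \<le> d * (1 / (v t)\<^sup>2)" for t
  proof -
    have "cmod (test_fun q a (of_real r * cis t)) = d powr (1 - 1 / q) / 2 / v t"
      unfolding test_fun_def v_def d_def norm_divide norm_of_real by simp
    hence "cmod (test_fun q a (of_real r * cis t)) powr q = (d powr (1 - 1 / q)) powr q / 2 powr q / v t powr q"
      using v0[of t] by (simp add: powr_divide powr_mult)
    also have "(d powr (1 - 1 / q)) powr q = d powr (q - 1)"
      using q by (simp add: powr_powr left_diff_distrib)
    also have "d powr (q - 1) = d * d powr (q - 2)"
      using d powr_add[of d 1 "q - 2"] by simp
    also have "v t powr q = (v t)\<^sup>2 * v t powr (q - 2)"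
      using v0[of t] powr_add[of "v t" 2 "q - 2"] by simp
    also have "d * d powr (q - 2) / 2 powr q / ((v t)\<^sup>2 * v t powr (q - 2))
       \<le> d * d powr (q - 2) / 2 powr q / ((v t)\<^sup>2 * (d / 2) powr (q - 2))"
      using d q vd[of t] v0[of t] by (intro divide_left_mono mult_left_mono powr_mono2 mult_pos_pos) auto
    also have "\<dots> = d * (1 / (v t)\<^sup>2) / 4"
      using d v0[of t] by (simp add: powr_divide powr_diff field_simps)
    also have "\<dots> \<le> d * (1 / (v t)\<^sup>2)"
    proof -
      have quarter: "x / 4 \<le> x" if "0 \<le> x" for x :: real using that by simp
      show ?thesis by (rule quarter) (use d in simp)
    qed
    finally show ?thesis .
  qed
  have q0: "0 < q" using q by simp
  have "integral {0..2*pi} (\<lambda>t. cmod (test_fun q a (of_real r * cis t)) powr q) \<le> integral {0..2*pi} (\<lambda>t. d * (1 / (v t)\<^sup>2))"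
  proof (rule integral_le)
    show "(\<lambda>t. cmod (test_fun q a (of_real r * cis t)) powr q) integrable_on {0..2*pi}"
      using q by (intro integrable_continuous_interval continuous_on_powr' continuous_intros
            continuous_on_circle holomorphic_on_imp_continuous_on test_fun_holomorphic a r) auto
    show "(\<lambda>t. d * (1 / (v t)\<^sup>2)) integrable_on {0..2*pi}" by (intro integrable_on_mult_right iv)
  qed (rule pt)
  also have "\<dots> = d * integral {0..2*pi} (\<lambda>t. 1 / (v t)\<^sup>2)" by (rule integral_mult_right)
  also have "\<dots> \<le> d * (2 * pi / d)" using d by (intro mult_left_mono ivle) auto
  also have "\<dots> = 2 * pi" using d by simp
  finally show ?thesis
    unfolding hardy_mean_eq_integral[OF test_fun_holomorphic[OF a] q0 r] by simp
qed

lemma test_fun_hardy: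
  assumes p: "2 < p" and a: "cmod a < 1"
  shows "test_fun (real_of_ereal p) a \<in> hardy p" "hardy_norm p (test_fun (real_of_ereal p) a) \<le> 1"
proof -
  define q where "q = real_of_ereal p"
  have "test_fun q a \<in> hardy p \<and> hardy_norm p (test_fun q a) \<le> 1"
  proof (cases "p = \<infinity>")
    case True
    hence q: "q = 0" unfolding q_def by simp
    have le: "cmod (test_fun q a z) \<le> 1" if z: "z \<in> ball 0 1" for z
    proof -
      have "cmod a * cmod z \<le> cmod a" using z by (intro mult_left_le) auto
      hence lower: "1 - cmod a \<le> cmod (1 - cnj a * z)"
        using norm_triangle_ineq2[of 1 "cnj a * z"] by (simp add: norm_mult)
      have nn: "0 < 1 - (cmod a)\<^sup>2" using a by (simp add: abs_square_less_1)
      have "1 - (cmod a)\<^sup>2 = (1 - cmod a) * (1 + cmod a)" by (simp add: power2_eq_square algebra_simps)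
      also have "\<dots> \<le> cmod (1 - cnj a * z) * 2" using a lower by (intro mult_mono) auto
      finally have "(1 - (cmod a)\<^sup>2) / 2 \<le> cmod (1 - cnj a * z)" by simp
      hence "(1 - (cmod a)\<^sup>2) / 2 / cmod (1 - cnj a * z) \<le> 1"
        using nn lower a by (intro divide_le_eq_1_pos[THEN iffD2]) auto
      moreover have "cmod (test_fun q a z) = (1 - (cmod a)\<^sup>2) / 2 / cmod (1 - cnj a * z)"
        unfolding test_fun_def q norm_divide norm_of_real using nn by simp
      ultimately show ?thesis by simp
    qed
    hence "bounded (test_fun q a ` ball 0 1)" unfolding bounded_iff by blast
    moreover have "(SUP z\<in>ball 0 1. cmod (test_fun q a z)) \<le> 1" by (rule cSUP_least) (use le in auto)
    ultimately show ?thesis using True test_fun_holomorphic[OF a] unfolding hardy_def hardy_norm_def by simp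
  next
    case False
    have q: "2 < q" using p False unfolding q_def by (cases p) auto
    have le: "hardy_mean q (test_fun q a) r \<le> 1" if "r \<in> {0<..<1}" for r
      using test_fun_hardy_mean[OF a q] that by auto
    have bdd: "bdd_above (hardy_mean q (test_fun q a) ` {0<..<1})" using le by (rule bdd_aboveI2)
    define S where "S = (SUP r\<in>{0<..<1}. hardy_mean q (test_fun q a) r)"
    have "S \<le> 1" unfolding S_def by (rule cSUP_least) (use le in auto)
    moreover have "0 \<le> S"
    proof -
      have "0 \<le> hardy_mean q (test_fun q a) (1/2)" using q by (intro hardy_mean_nonneg test_fun_holomorphic a) auto
      also have "\<dots> \<le> S" unfolding S_def by (rule cSUP_upper[OF _ bdd]) simp
      finally show ?thesis .
    qed
    ultimately have "S powr (1 / q) \<le> 1" using q by (intro powr_le1) auto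
    thus ?thesis using False test_fun_holomorphic[OF a] bdd
      unfolding hardy_def hardy_norm_def S_def q_def[symmetric] by simp
  qed
  thus "test_fun (real_of_ereal p) a \<in> hardy p" "hardy_norm p (test_fun (real_of_ereal p) a) \<le> 1"
    unfolding q_def by auto
qed

text \<open>On the disc of radius \<delta>/2 around a, the denominator of the test function is at
  most 3\<delta> in modulus, so the derivative of the test function is large throughout and g is
  isolated as an area mean of |g|^2. A single box containing this disc already bounds the supremum
  from below.\<close>

lemma morrey_area_sup_test_fun_ge:
  assumes q: "q = 0 \<or> 2 < q" and a: "1 / 2 \<le> cmod a" "cmod a < 1" and g: "g holomorphic_on ball 0 1"
  shows "ennreal ((cmod (g a) / 144)\<^sup>2) \<le> morrey_area_sup (1 - 2 / q) (Ig g (test_fun q a))"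
proof -
  define \<delta> where "\<delta> = 1 - cmod a"
  have \<delta>: "0 < \<delta>" "\<delta> \<le> 1 / 2" "cmod a = 1 - \<delta>" unfolding \<delta>_def using a by auto
  define L where "L = 2 * \<delta>"
  define \<alpha> where "\<alpha> = Arg a - pi * L"
  have par: "(\<alpha>, 2 * pi * L) \<in> arc_params" unfolding arc_params_def L_def using \<delta> by auto
  have q1: "0 \<le> 1 / q" "1 / q \<le> 1" "0 \<le> 2 / q" "2 / q \<le> 1" using q by auto
  \<comment> \<open>The square of \<delta>^(1-1/q) / (36 \<delta>^2), a lower bound for the
    derivative, times \<delta>/2, a lower bound for 1 - |z|^2. Here 36 = 2 * 2 * 3^2 collects the
    normalisation 1/2, the bound |a| \<ge> 1/2 and the denominator, and 2592 = 2 * 36^2.\<close>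
  define c where "c = \<delta> powr (1 - 2 / q) / (2592 * \<delta>\<^sup>2)"
  have sub: "ball a (\<delta> / 2) \<subseteq> carleson_box \<alpha> (2 * pi * L)"
    using disc_subset_carleson_box[OF a] unfolding \<alpha>_def L_def \<delta>_def by blast
  have pt: "c * (cmod (g z))\<^sup>2 \<le> lp_density (Ig g (test_fun q a)) z"
    if z: "z \<in> ball a (\<delta> / 2)" for z
  proof -
    have za: "cmod (z - a) < \<delta> / 2" using z by (simp add: dist_norm norm_minus_commute)
    have z1: "cmod z \<le> 1 - \<delta> / 2" using norm_triangle_ineq[of a "z - a"] za \<delta> by simp
    hence zlt: "cmod z < 1" using \<delta> by linarith
    have nz: "0 < cmod (1 - cnj a * z)" using one_minus_cnj_mult_nonzero[OF a(2), of z] zlt by simp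
    have up: "cmod (1 - cnj a * z) \<le> 3 * \<delta>"
    proof -
      have "1 - cnj a * z = of_real (1 - (cmod a)\<^sup>2) - cnj a * (z - a)"
        using complex_norm_square[of a] by (simp add: algebra_simps)
      hence "cmod (1 - cnj a * z) \<le> cmod (of_real (1 - (cmod a)\<^sup>2)) + cmod (cnj a * (z - a))"
        using norm_triangle_ineq4 by metis
      also have "cmod (complex_of_real (1 - (cmod a)\<^sup>2)) \<le> 2 * \<delta>"
      proof -
        have "1 - (cmod a)\<^sup>2 = \<delta> * (2 - \<delta>)" unfolding \<delta>(3) by (simp add: power2_eq_square algebra_simps)
        moreover have "0 \<le> \<delta> * (2 - \<delta>)" "\<delta> * (2 - \<delta>) \<le> \<delta> * 2" using \<delta> by (auto intro: mult_left_mono)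
        ultimately show ?thesis unfolding norm_of_real by simp
      qed
      also have "cmod (cnj a * (z - a)) \<le> 1 * (\<delta> / 2)"
        unfolding norm_mult using za a by (intro mult_mono) auto
      finally show ?thesis using \<delta> by simp
    qed
    have d1: "\<delta> \<le> 1 - (cmod a)\<^sup>2"
    proof -
      have "(1 - \<delta>) * (1 - \<delta>) \<le> 1 - \<delta>" using \<delta> by (intro mult_left_le) auto
      thus ?thesis unfolding \<delta>(3) power2_eq_square by linarith
    qed
    have "\<delta> powr (1 - 1 / q) / (36 * \<delta>\<^sup>2) = \<delta> powr (1 - 1 / q) / 2 * (1 / 2) / (3 * \<delta>)\<^sup>2"
      by (simp add: power_mult_distrib)
    also have "\<dots> \<le> (1 - (cmod a)\<^sup>2) powr (1 - 1 / q) / 2 * cmod a / (cmod (1 - cnj a * z))\<^sup>2"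
      using \<delta> a up nz d1 q1
      by (intro frac_le mult_mono divide_right_mono powr_mono2 power_mono mult_nonneg_nonneg divide_nonneg_nonneg)
        (insert \<delta>(1), (linarith | auto)+)
    also have "\<dots> = cmod (deriv (test_fun q a) z)"
      unfolding deriv_test_fun[OF a(2) zlt] by (simp add: norm_divide norm_mult norm_power)
    finally have "(\<delta> powr (1 - 1 / q) / (36 * \<delta>\<^sup>2))\<^sup>2 \<le> (cmod (deriv (test_fun q a) z))\<^sup>2"
      using \<delta> by (intro power_mono) auto
    moreover have "\<delta> / 2 \<le> 1 - (cmod z)\<^sup>2"
      using z1 zlt mult_left_le[of "cmod z" "cmod z"] by (simp add: power2_eq_square)
    ultimately have "(\<delta> powr (1 - 1 / q) / (36 * \<delta>\<^sup>2))\<^sup>2 * (\<delta> / 2) \<le> lp_density (test_fun q a) z"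
      using \<delta> by (intro mult_mono) auto
    moreover have "(\<delta> powr (1 - 1 / q) / (36 * \<delta>\<^sup>2))\<^sup>2 * (\<delta> / 2) = c"
    proof -
      have "(\<delta> powr (1 - 1 / q))\<^sup>2 = \<delta> powr (2 - 2 / q)"
        unfolding power2_eq_square powr_add[symmetric] by simp
      also have "\<dots> = \<delta> powr (1 - 2 / q) * \<delta>"
        using \<delta> powr_add[of \<delta> "1 - 2 / q" 1] by simp
      finally show ?thesis unfolding c_def using \<delta> by (simp add: power_divide power_mult_distrib field_simps power2_eq_square)
    qed
    ultimately have "c * (cmod (g z))\<^sup>2 \<le> lp_density (test_fun q a) z * (cmod (g z))\<^sup>2"
      by (intro mult_right_mono) auto
    thus ?thesis
      unfolding Ig_primitive(3)[OF test_fun_holomorphic[OF a(2)] g zlt]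
      by (simp add: norm_mult power_mult_distrib mult_ac)
  qed
  have c0: "0 \<le> c" unfolding c_def by simp
  have "ennreal (c * (pi * (\<delta> / 2)\<^sup>2 * (cmod (g a))\<^sup>2)) = ennreal c * ennreal (pi * (\<delta> / 2)\<^sup>2 * (cmod (g a))\<^sup>2)"
    by (rule ennreal_mult'[OF c0])
  also have "\<dots> \<le> ennreal c * (\<integral>\<^sup>+z\<in>ball a (\<delta> / 2). ennreal ((cmod (g z))\<^sup>2) \<partial>lborel)"
    by (intro mult_left_mono nn_integral_disc_ge g) (use \<delta> in auto)
  also have "\<dots> = (\<integral>\<^sup>+z. ennreal c * (ennreal ((cmod (g z))\<^sup>2) * indicator (ball a (\<delta> / 2)) z) \<partial>lborel)"
  proof (rule nn_integral_cmult[symmetric])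
    have "ball a (\<delta> / 2) \<subseteq> ball 0 1"
      using sub unfolding carleson_box_def by auto
    hence "continuous_on (ball a (\<delta> / 2)) g"
      by (rule continuous_on_subset[OF holomorphic_on_imp_continuous_on[OF g]])
    from measurable_square_indicator[OF this, of "\<lambda>_. 1"]
    show "(\<lambda>z. ennreal ((cmod (g z))\<^sup>2) * indicator (ball a (\<delta> / 2)) z) \<in> borel_measurable lborel" by simp
  qed
  also have "\<dots> \<le> lp_integral (carleson_box \<alpha> (2 * pi * L)) (Ig g (test_fun q a))"
  proof (rule nn_integral_mono)
    fix z
    show "ennreal c * (ennreal ((cmod (g z))\<^sup>2) * indicator (ball a (\<delta> / 2)) z)
       \<le> ennreal (lp_density (Ig g (test_fun q a)) z) * indicator (carleson_box \<alpha> (2 * pi * L)) z"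
    proof (cases "z \<in> ball a (\<delta> / 2)")
      case True
      hence "z \<in> carleson_box \<alpha> (2 * pi * L)" using sub by blast
      thus ?thesis using True ennreal_leI[OF pt[OF True]] ennreal_mult'[OF c0] by simp
    qed simp
  qed
  finally have "ennreal (c * (pi * (\<delta> / 2)\<^sup>2 * (cmod (g a))\<^sup>2)) / ennreal pi
     \<le> lp_integral (carleson_box \<alpha> (2 * pi * L)) (Ig g (test_fun q a)) / ennreal pi"
    by (rule divide_right_mono_ennreal)
  hence "ennreal (L powr - (1 - 2 / q)) * (ennreal (c * (pi * (\<delta> / 2)\<^sup>2 * (cmod (g a))\<^sup>2)) / ennreal pi)
     \<le> ennreal (L powr - (1 - 2 / q)) * (lp_integral (carleson_box \<alpha> (2 * pi * L)) (Ig g (test_fun q a)) / ennreal pi)"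
    by (rule mult_left_mono) simp
  also have "\<dots> \<le> morrey_area_sup (1 - 2 / q) (Ig g (test_fun q a))"
    unfolding morrey_area_sup_def using SUP_upper[OF par, of "\<lambda>(a, l). ennreal (arc_len l powr - (1 - 2 / q)) *
      (lp_integral (carleson_box a l) (Ig g (test_fun q a')) / ennreal pi)" for a']
    by (simp add: arc_len_def)
  finally have fin: "ennreal (L powr - (1 - 2 / q)) * (ennreal (c * (pi * (\<delta> / 2)\<^sup>2 * (cmod (g a))\<^sup>2)) / ennreal pi)
     \<le> morrey_area_sup (1 - 2 / q) (Ig g (test_fun q a))" .
  \<comment> \<open>The squared radius gives 2592 * 4 = 10368, and L = 2\<delta> costs at most
    another factor 2, since 1 - 2/q \<le> 1; the product is 144^2.\<close>
  have "(cmod (g a) / 144)\<^sup>2 \<le> L powr - (1 - 2 / q) * (c * (pi * (\<delta> / 2)\<^sup>2 * (cmod (g a))\<^sup>2) / pi)"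
  proof -
    have "(2::real) powr (1 - 2 / q) \<le> 2 powr 1" using q1 by (intro powr_mono) auto
    hence two: "1 / 2 \<le> (2::real) powr - (1 - 2 / q)" by (simp add: powr_minus divide_simps)
    have e1: "L powr - (1 - 2 / q) = 2 powr - (1 - 2 / q) * \<delta> powr - (1 - 2 / q)"
      unfolding L_def using \<delta> by (simp add: powr_mult)
    have e2: "\<delta> powr - (1 - 2 / q) * \<delta> powr (1 - 2 / q) = 1" using \<delta> by (simp flip: powr_add)
    have "c * (pi * (\<delta> / 2)\<^sup>2 * (cmod (g a))\<^sup>2) / pi = \<delta> powr (1 - 2 / q) * ((cmod (g a))\<^sup>2 / 10368)"
      unfolding c_def using \<delta> by (simp add: power_divide)
    hence "L powr - (1 - 2 / q) * (c * (pi * (\<delta> / 2)\<^sup>2 * (cmod (g a))\<^sup>2) / pi)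
      = 2 powr - (1 - 2 / q) * (\<delta> powr - (1 - 2 / q) * \<delta> powr (1 - 2 / q)) * ((cmod (g a))\<^sup>2 / 10368)"
      unfolding e1 by (simp only: mult.assoc)
    also have "\<dots> = 2 powr - (1 - 2 / q) * ((cmod (g a))\<^sup>2 / 10368)" unfolding e2 by simp
    also have "\<dots> \<ge> 1 / 2 * ((cmod (g a))\<^sup>2 / 10368)" by (intro mult_right_mono two) auto
    finally show ?thesis by (simp add: power_divide)
  qed
  hence "ennreal ((cmod (g a) / 144)\<^sup>2) \<le> ennreal (L powr - (1 - 2 / q) * (c * (pi * (\<delta> / 2)\<^sup>2 * (cmod (g a))\<^sup>2) / pi))"
    by (rule ennreal_leI)
  also have "\<dots> = ennreal (L powr - (1 - 2 / q)) * (ennreal (c * (pi * (\<delta> / 2)\<^sup>2 * (cmod (g a))\<^sup>2)) / ennreal pi)"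
    using c0 by (subst ennreal_mult', simp, subst divide_ennreal) auto
  also note fin
  finally show ?thesis .
qed

text \<open>The test functions reach only points with |a| \<ge> 1/2; the inner disc follows from its
  boundary circle by the maximum principle.\<close>

lemma bounded_of_outer_annulus:
  assumes g: "g holomorphic_on ball 0 1" and M: "\<And>a. 1 / 2 \<le> cmod a \<Longrightarrow> cmod a < 1 \<Longrightarrow> cmod (g a) \<le> M"
    and z: "cmod z < 1"
  shows "cmod (g z) \<le> M"
proof (cases "1 / 2 \<le> cmod z")
  case False
  show ?thesis
  proof (rule maximum_modulus_frontier[of g "ball 0 (1/2)"])
    show "g holomorphic_on interior (ball 0 (1/2))"
      by (rule holomorphic_on_subset[OF g]) auto
    show "continuous_on (closure (ball 0 (1/2))) g"
      by (rule continuous_on_subset[OF holomorphic_on_imp_continuous_on[OF g]]) auto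
    show "cmod (g w) \<le> M" if "w \<in> frontier (ball 0 (1/2))" for w
      using that by (intro M) auto
  qed (use False in auto)
qed (use M z in auto)

text \<open>The point term of the norm vanishes at 0, and 320 \<le> 324 = 18^2. The estimates hold
  for every A above the Hardy norm, so the norm itself is reached in the limit; K = 0 is treated
  apart because the limit is taken after dividing by 18 K.\<close>

lemma morrey_norm_Ig_le:
  assumes p: "2 < p" and f: "f \<in> hardy p" and g: "g holomorphic_on ball 0 1"
    and K: "0 \<le> K" "\<And>z. cmod z < 1 \<Longrightarrow> cmod (g z) \<le> K"
  shows "Ig g f \<in> morrey (lam_of p)" "morrey_area_sup (lam_of p) (Ig g f) < \<infinity>"
    "morrey_norm (lam_of p) (Ig g f) \<le> 18 * K * hardy_norm p f"
proof -
  define q where "q = real_of_ereal p"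
  have q: "q = 0 \<or> 2 < q" using p unfolding q_def by (cases p) auto
  have lam: "lam_of p = 1 - 2 / q" unfolding lam_of_def q_def by simp
  have hol: "f holomorphic_on ball 0 1" using f unfolding hardy_def by auto
  have le: "hardy_le q A f" if "hardy_norm p f < A" for A
    unfolding q_def by (rule hardy_imp_hardy_le[OF p f that])
  have sup: "morrey_area_sup (lam_of p) (Ig g f) \<le> ennreal (320 * K\<^sup>2 * A\<^sup>2)" if "hardy_norm p f < A" for A
    unfolding lam by (rule morrey_area_sup_Ig_le[OF le[OF that] q K(1) g K(2)])
  show "Ig g f \<in> morrey (lam_of p)"
    unfolding lam by (rule Ig_in_morrey[OF le[of "hardy_norm p f + 1"] q K(1) g K(2)]) auto
  show "morrey_area_sup (lam_of p) (Ig g f) < \<infinity>"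
    using le_less_trans[OF sup[of "hardy_norm p f + 1"]] by simp
  have norm: "morrey_norm (lam_of p) (Ig g f) \<le> 18 * K * A" if A: "hardy_norm p f < A" for A
  proof -
    have A0: "0 \<le> A" using hardy_norm_nonneg[OF f] A by linarith
    have "enn2real (morrey_area_sup (lam_of p) (Ig g f)) \<le> 320 * K\<^sup>2 * A\<^sup>2"
      using enn2real_mono[OF sup[OF A]] by simp
    also have "\<dots> \<le> 324 * K\<^sup>2 * A\<^sup>2" by (intro mult_right_mono) auto
    also have "\<dots> = (18 * K * A)\<^sup>2" by (simp add: power_mult_distrib)
    finally have "sqrt (enn2real (morrey_area_sup (lam_of p) (Ig g f))) \<le> 18 * K * A"
      by (rule real_le_lsqrt[rotated 1]) (use K A0 in auto)
    thus ?thesis unfolding morrey_norm_def Ig_primitive(2)[OF hol g] by simp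
  qed
  show "morrey_norm (lam_of p) (Ig g f) \<le> 18 * K * hardy_norm p f"
  proof (cases "K = 0")
    case True
    thus ?thesis using norm[of "hardy_norm p f + 1"] by simp
  next
    case False
    hence K0: "0 < K" using K by simp
    have "morrey_norm (lam_of p) (Ig g f) / (18 * K) \<le> hardy_norm p f"
    proof (rule dense_ge)
      fix A assume "hardy_norm p f < A"
      thus "morrey_norm (lam_of p) (Ig g f) / (18 * K) \<le> A" using norm[of A] K0 by (simp add: field_simps)
    qed
    thus ?thesis using K0 by (simp add: field_simps)
  qed
qed

lemma norm_le_morrey_norm_test_fun:
  assumes p: "2 < p" and a: "1 / 2 \<le> cmod a" "cmod a < 1" and g: "g holomorphic_on ball 0 1"
    and fin: "morrey_area_sup (lam_of p) (Ig g (test_fun (real_of_ereal p) a)) < \<infinity>"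
  shows "cmod (g a) \<le> 144 * morrey_norm (lam_of p) (Ig g (test_fun (real_of_ereal p) a))"
proof -
  define q where "q = real_of_ereal p"
  have q: "q = 0 \<or> 2 < q" using p unfolding q_def by (cases p) auto
  have lam: "lam_of p = 1 - 2 / q" unfolding lam_of_def q_def by simp
  have "ennreal ((cmod (g a) / 144)\<^sup>2) \<le> morrey_area_sup (lam_of p) (Ig g (test_fun q a))"
    unfolding lam by (rule morrey_area_sup_test_fun_ge[OF q a g])
  from enn2real_mono[OF this] fin
  have "(cmod (g a) / 144)\<^sup>2 \<le> enn2real (morrey_area_sup (lam_of p) (Ig g (test_fun q a)))"
    unfolding q_def by simp
  hence "cmod (g a) / 144 \<le> sqrt (enn2real (morrey_area_sup (lam_of p) (Ig g (test_fun q a))))"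
    by (rule real_le_rsqrt)
  also have "\<dots> \<le> morrey_norm (lam_of p) (Ig g (test_fun q a))" unfolding morrey_norm_def by simp
  finally show ?thesis unfolding q_def by simp
qed

text \<open>The operator norm is a supremum of reals and is meaningful only for a bounded set, so
  the two-sided estimate is attached to bounded g. In both lower estimates the points of the outer
  annulus are tested one by one, and the maximum principle covers the rest.\<close>

theorem theorem3:
  fixes p :: ereal
  assumes "2 < p"
  shows "\<exists>c1 c2. 0 < c1 \<and> 0 < c2 \<and>
    (\<forall>g. g holomorphic_on ball 0 1 \<longrightarrow>
      (Ig_bounded p (lam_of p) g \<longleftrightarrow> g \<in> hardy \<infinity>) \<and>
      (g \<in> hardy \<infinity> \<longrightarrow>
         c1 * sup_norm g \<le> Ig_opnorm p (lam_of p) g \<and>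
         Ig_opnorm p (lam_of p) g \<le> c2 * sup_norm g))"
proof (rule exI[of _ "1 / 144"], rule exI[of _ 18], intro conjI allI impI)
  fix g :: "complex \<Rightarrow> complex" assume g: "g holomorphic_on ball 0 1"
  let ?q = "real_of_ereal p" and ?l = "lam_of p"
  have bdd: "bdd_above ((\<lambda>z. cmod (g z)) ` ball 0 1)" if "g \<in> hardy \<infinity>"
    using that unfolding hardy_def bounded_iff bdd_above_def by auto
  have K: "cmod (g z) \<le> sup_norm g" if "g \<in> hardy \<infinity>" "cmod z < 1" for z
    unfolding sup_norm_def using that by (intro cSUP_upper bdd) auto
  have K0: "0 \<le> sup_norm g" if "g \<in> hardy \<infinity>"
    using order_trans[OF norm_ge_zero K[OF that, of 0]] by simp
  have upper: "Ig g f \<in> morrey ?l" "morrey_area_sup ?l (Ig g f) < \<infinity>"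
      "morrey_norm ?l (Ig g f) \<le> 18 * sup_norm g * hardy_norm p f" if "g \<in> hardy \<infinity>" "f \<in> hardy p" for f
    using morrey_norm_Ig_le[OF assms that(2) g K0[OF that(1)] K[OF that(1)]] by auto
  show "Ig_bounded p ?l g \<longleftrightarrow> g \<in> hardy \<infinity>"
  proof
    assume "Ig_bounded p ?l g"
    then obtain C where C: "\<And>f. f \<in> hardy p \<Longrightarrow> morrey_area_sup ?l (Ig g f) < \<infinity> \<and> morrey_norm ?l (Ig g f) \<le> C * hardy_norm p f"
      unfolding Ig_bounded_def by blast
    have "cmod (g z) \<le> 144 * \<bar>C\<bar>" if "cmod z < 1" for z
    proof (rule bounded_of_outer_annulus[OF g _ that])
      fix a assume a: "1 / 2 \<le> cmod a" "cmod a < 1"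
      note t = test_fun_hardy[OF assms a(2)]
      have "cmod (g a) \<le> 144 * morrey_norm ?l (Ig g (test_fun ?q a))"
        using C[OF t(1)] by (intro norm_le_morrey_norm_test_fun[OF assms a g]) auto
      also have "morrey_norm ?l (Ig g (test_fun ?q a)) \<le> C * hardy_norm p (test_fun ?q a)" using C[OF t(1)] by simp
      also have "\<dots> \<le> \<bar>C\<bar> * 1" using t(2) hardy_norm_nonneg[OF t(1)] by (intro mult_mono) auto
      finally show "cmod (g a) \<le> 144 * \<bar>C\<bar>" by simp
    qed
    hence "bounded (g ` ball 0 1)" unfolding bounded_iff by (intro exI[of _ "144 * \<bar>C\<bar>"]) auto
    thus "g \<in> hardy \<infinity>" unfolding hardy_def using g by simp
  next
    assume "g \<in> hardy \<infinity>"
    thus "Ig_bounded p ?l g" unfolding Ig_bounded_def using upper by blast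
  qed
  assume gb: "g \<in> hardy \<infinity>"
  let ?X = "{morrey_norm ?l (Ig g f) | f. f \<in> hardy p \<and> hardy_norm p f \<le> 1}"
  have X_le: "x \<le> 18 * sup_norm g" if x: "x \<in> ?X" for x
  proof -
    obtain f where f: "x = morrey_norm ?l (Ig g f)" "f \<in> hardy p" "hardy_norm p f \<le> 1" using x by blast
    have "x \<le> 18 * sup_norm g * hardy_norm p f" unfolding f(1) by (rule upper(3)[OF gb f(2)])
    also have "\<dots> \<le> 18 * sup_norm g * 1" using K0[OF gb] f(3) by (intro mult_left_mono) auto
    finally show ?thesis by simp
  qed
  \<comment> \<open>A witness that the set defining the operator norm is nonempty; the preceding
    bound shows that it is bounded above.\<close>
  have "morrey_norm ?l (Ig g (test_fun ?q 0)) \<in> ?X" using test_fun_hardy[OF assms, of 0] by auto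
  hence ne: "?X \<noteq> {}" by blast
  show "Ig_opnorm p ?l g \<le> 18 * sup_norm g"
    unfolding Ig_opnorm_def by (rule cSup_least[OF ne X_le])
  have "cmod (g z) \<le> 144 * Ig_opnorm p ?l g" if "cmod z < 1" for z
  proof (rule bounded_of_outer_annulus[OF g _ that])
    fix a assume a: "1 / 2 \<le> cmod a" "cmod a < 1"
    note t = test_fun_hardy[OF assms a(2)]
    have "cmod (g a) \<le> 144 * morrey_norm ?l (Ig g (test_fun ?q a))"
      by (rule norm_le_morrey_norm_test_fun[OF assms a g upper(2)[OF gb t(1)]])
    also have "morrey_norm ?l (Ig g (test_fun ?q a)) \<le> Ig_opnorm p ?l g"
      unfolding Ig_opnorm_def by (rule cSup_upper) (use t X_le in \<open>auto intro!: bdd_aboveI\<close>)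
    finally show "cmod (g a) \<le> 144 * Ig_opnorm p ?l g" by simp
  qed
  hence "sup_norm g \<le> 144 * Ig_opnorm p ?l g" unfolding sup_norm_def by (intro cSUP_least) auto
  thus "1 / 144 * sup_norm g \<le> Ig_opnorm p ?l g" by simp
qed auto

end
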